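(* Consider the graphon model on $\mathcal X=[0,1)^d$ with $n$ vertices and observation probability $\rho=\rho_n$. Suppose there exist positive constants $a$ and $b$ such that for all multi-indices $\kappa$ and all $y\in\mathcal X$, $$\sup_{x\in\mathcal X}\left|\frac{\partial^{|\kappa|}f(x,y)}{(\partial x)^\kappa}\right|\le b\,a^{|\kappa|}\,\kappa!.$$ Then there exist positive constants $c_0$ and $c_1$ depending only on $a,b,d$ such that for all integers $0\le r\le n-1$, $$\frac1{n^2}\sum_{i\ge r+1}\lambda_i^2(M)\le c_1\left(n^{-1}+\exp\left(-c_0r^{1/d}\right)\right).$$ Moreover, assume that $n\rho\ge C\log n$ for a constant $C>0$. Then there exist positive constants $c',c''$ such that if $\hat M$ is the output of USVT with input $(A,\rho,\tau)$, $\tau=c''\sqrt{n\rho}$, then $$\mathrm{MSE}(\hat M)\le c'\,\frac{\log^d(n\rho)}{n\rho}.$$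
   Context: Graphon model: $f:\mathcal X\times\mathcal X\to[0,1]$ is a symmetric measurable function and $x_1,\dots,x_n$ are i.i.d. from a probability distribution $\mu$ on $\mathcal X$. The edge probability matrix $M$ has $M_{ij}=f(x_i,x_j)$ for $i\ne j$ and $M_{ii}=0$. With observation probability $\rho\in(0,1]$ (which may depend on $n$), the observed symmetric adjacency matrix $A$ has $A_{ii}=0$ and, conditional on $(x_1,\dots,x_n)$, the entries $A_{ij}=A_{ji}$, $1\le i<j\le n$, are independent with $A_{ij}\sim\mathrm{Bernoulli}(\rho M_{ij})$. The eigenvalues of $M$ are ordered so that $|\lambda_1(M)|\ge\cdots\ge|\lambda_n(M)|$. For a multi-index $\kappa=(\kappa_1,\dots,\kappa_d)$ of nonnegative integers, $|\kappa|=\sum_i\kappa_i$, $\kappa!=\prod_i\kappa_i!$, and $\partial^{|\kappa|}f/(\partial x)^\kappa$ is the corresponding partial derivative in the first argument (assumed to exist for all $\kappa$). USVT (universal singular value thresholding) with input $(A,\rho,\tau)$, $\tau>0$: take a singular value decomposition $A=\sum_{i=1}^n s_iu_iv_i^\top$, $s_1\ge\cdots\ge s_n$, set $\hat A=\sum_{i:\,s_i\ge\tau}s_iu_iv_i^\top$ and $\tilde M=\hat A/\rho$. The output $\hat M$ is the symmetric matrix with $\hat M_{ii}=0$ and, for $i<j$, $\hat M_{ij}=\hat M_{ji}=\min\{1,\max\{0,\tilde M_{ij}\}\}$. $\mathrm{MSE}(\hat M)=\frac1{n^2}\mathbb E[\|M-\hat M\|_F^2]$, with expectation over both $(x_i)$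 and $A$. The constants $c',c''$ do not depend on $n$.
   Formalization: The MSE bound is stated for nρ ≥ K with an arbitrary constant K > 1, and c' may depend on K; without this it fails, e.g. at nρ = 1, where the right-hand side is 0 while the MSE is positive. *)

theory Defs
  imports "HOL-Probability.Probability" "Jordan_Normal_Form.Char_Poly"
begin

text \<open>
  Both Cartesian vectors (points of the cube, type \<open>real ^ 'd\<close>) and the dimension-carrying matrices
  \<open>real mat\<close> are used; the ambiguous infix notation is avoided by writing \<open>vec_nth\<close>,
  \<open>vec_index\<close> and \<open>scalar_prod\<close>. Vertices, eigenvalues and singular values are indexed from 0.
\<close>

section \<open>Graphons on the cube\<close>

definition unit_cube :: "(real ^ 'd) set" where
  "unit_cube = {x. \<forall>i. 0 \<le> vec_nth x i \<and> vec_nth x i < 1}"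

definition cube_space :: "(real ^ 'd) measure" where
  "cube_space = restrict_space borel unit_cube"

definition graphon :: "(real ^ 'd \<Rightarrow> real ^ 'd \<Rightarrow> real) \<Rightarrow> bool" where
  "graphon f \<longleftrightarrow>
     (\<lambda>(x, y). f x y) \<in> borel_measurable (cube_space \<Otimes>\<^sub>M cube_space) \<and>
     (\<forall>x\<in>unit_cube. \<forall>y\<in>unit_cube. f x y = f y x \<and> 0 \<le> f x y \<and> f x y \<le> 1)"

definition cube_distribution :: "(real ^ 'd) measure \<Rightarrow> bool" where
  "cube_distribution \<mu> \<longleftrightarrow> prob_space \<mu> \<and> sets \<mu> = sets cube_space"

text \<open>
  \<open>D\<close> is the family of all mixed partial derivatives of \<open>g\<close> on the cube, indexed by multi-indices:
  each \<open>D \<kappa>\<close> is partially differentiable in every coordinate, with derivative \<open>D (\<kappa> + e\<^sub>i)\<close> in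
  coordinate \<open>i\<close>. The derivatives are taken relative to the cube, hence one-sided on the faces
  \<open>x\<^sub>i = 0\<close>. On the cube, \<open>D\<close> is uniquely determined by \<open>g\<close>.
\<close>

definition mixed_partials ::
    "(real ^ 'd::finite \<Rightarrow> real) \<Rightarrow> (('d \<Rightarrow> nat) \<Rightarrow> real ^ 'd \<Rightarrow> real) \<Rightarrow> bool" where
  "mixed_partials g D \<longleftrightarrow>
     (\<forall>x\<in>unit_cube. D (\<lambda>_. 0) x = g x) \<and>
     (\<forall>\<kappa> i. \<forall>x\<in>unit_cube.
        ((\<lambda>h. D \<kappa> (x + h *\<^sub>R axis i 1)) has_real_derivative D (\<kappa>(i := Suc (\<kappa> i))) x)
          (at 0 within {h. x + h *\<^sub>R axis i 1 \<in> unit_cube}))"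

definition analytic_bound ::
    "real \<Rightarrow> real \<Rightarrow> (real ^ 'd::finite \<Rightarrow> real ^ 'd \<Rightarrow> real) \<Rightarrow> bool" where
  "analytic_bound a b f \<longleftrightarrow>
     (\<forall>y\<in>unit_cube. \<exists>D. mixed_partials (\<lambda>x. f x y) D \<and>
        (\<forall>\<kappa>. \<forall>x\<in>unit_cube. \<bar>D \<kappa> x\<bar> \<le> b * a ^ (\<Sum>i\<in>UNIV. \<kappa> i) * (\<Prod>i\<in>UNIV. fact (\<kappa> i))))"

section \<open>Matrices\<close>

definition ordered_eigenvalues :: "real mat \<Rightarrow> real list" where
  "ordered_eigenvalues A =
     (SOME es. char_poly A = (\<Prod>e\<leftarrow>es. [:- e, 1:]) \<and> sorted_wrt (\<lambda>x y. \<bar>x\<bar> \<ge> \<bar>y\<bar>) es)"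

definition frobenius_norm :: "real mat \<Rightarrow> real" where
  "frobenius_norm A = sqrt (\<Sum>i<dim_row A. \<Sum>j<dim_col A. (A $$ (i, j))\<^sup>2)"

definition orthonormal_family :: "nat \<Rightarrow> (nat \<Rightarrow> real vec) \<Rightarrow> bool" where
  "orthonormal_family n u \<longleftrightarrow>
     (\<forall>i<n. u i \<in> carrier_vec n) \<and>
     (\<forall>i<n. \<forall>j<n. scalar_prod (u i) (u j) = (if i = j then 1 else 0))"

definition is_svd ::
    "nat \<Rightarrow> real mat \<Rightarrow> (nat \<Rightarrow> real) \<Rightarrow> (nat \<Rightarrow> real vec) \<Rightarrow> (nat \<Rightarrow> real vec) \<Rightarrow> bool" where
  "is_svd n A s u v \<longleftrightarrow>
     (\<forall>i<n. 0 \<le> s i) \<and> (\<forall>i<n. \<forall>j<n. i \<le> j \<longrightarrow> s j \<le> s i) \<and>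
     orthonormal_family n u \<and> orthonormal_family n v \<and>
     A = mat n n (\<lambda>(k, l). \<Sum>i<n. s i * vec_index (u i) k * vec_index (v i) l)"

text \<open>
  The singular value decomposition is only unique up to rotations inside the singular spaces, but
  the thresholded matrix does not depend on the chosen decomposition.
\<close>

definition sv_threshold :: "nat \<Rightarrow> real mat \<Rightarrow> real \<Rightarrow> real mat" where
  "sv_threshold n A \<tau> =
     (case (SOME (s, u, v). is_svd n A s u v) of (s, u, v) \<Rightarrow>
        mat n n (\<lambda>(k, l). \<Sum>i | i < n \<and> \<tau> \<le> s i. s i * vec_index (u i) k * vec_index (v i) l))"

definition usvt :: "nat \<Rightarrow> real \<Rightarrow> real \<Rightarrow> real mat \<Rightarrow> real mat" where
  "usvt n \<rho> \<tau> A =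
     mat n n (\<lambda>(i, j). if i = j then 0
        else min 1 (max 0 (sv_threshold n A \<tau> $$ (min i j, max i j) / \<rho>)))"

section \<open>The random graph model\<close>

definition edge_prob_mat ::
    "(real ^ 'd \<Rightarrow> real ^ 'd \<Rightarrow> real) \<Rightarrow> nat \<Rightarrow> (nat \<Rightarrow> real ^ 'd) \<Rightarrow> real mat" where
  "edge_prob_mat f n x = mat n n (\<lambda>(i, j). if i = j then 0 else f (x i) (x j))"

definition adjacency_pmf :: "nat \<Rightarrow> real \<Rightarrow> real mat \<Rightarrow> real mat pmf" where
  "adjacency_pmf n \<rho> M =
     map_pmf (\<lambda>e. mat n n (\<lambda>(i, j). if i = j then 0 else of_bool (e (min i j, max i j))))
       (Pi_pmf {(i, j). i < j \<and> j < n} False (\<lambda>(i, j). bernoulli_pmf (\<rho> * M $$ (i, j))))"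

text \<open>The joint law of the latent positions and the observed adjacency matrix.\<close>

definition graphon_law ::
    "(real ^ 'd \<Rightarrow> real ^ 'd \<Rightarrow> real) \<Rightarrow> (real ^ 'd) measure \<Rightarrow> nat \<Rightarrow> real
      \<Rightarrow> ((nat \<Rightarrow> real ^ 'd) \<times> real mat) measure" where
  "graphon_law f \<mu> n \<rho> =
     (let X = Pi\<^sub>M {..<n} (\<lambda>_. \<mu>) in
        X \<bind> (\<lambda>x. distr (measure_pmf (adjacency_pmf n \<rho> (edge_prob_mat f n x)))
                    (X \<Otimes>\<^sub>M count_space UNIV) (\<lambda>A. (x, A))))"

definition MSE ::
    "(real ^ 'd \<Rightarrow> real ^ 'd \<Rightarrow> real) \<Rightarrow> (real ^ 'd) measure \<Rightarrow> nat \<Rightarrow> real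
      \<Rightarrow> (real mat \<Rightarrow> real mat) \<Rightarrow> real" where
  "MSE f \<mu> n \<rho> est =
     (1 / (real n)\<^sup>2) *
     (\<integral>(x, A). (frobenius_norm (edge_prob_mat f n x - est A))\<^sup>2 \<partial>graphon_law f \<mu> n \<rho>)"

end

theory Submission
  imports Defs "Jordan_Normal_Form.Schur_Decomposition"
begin

text \<open>
  On a subcube of side \<open>1 / N\<close> with \<open>N \<ge> 4 a\<close> the Taylor expansion of \<open>f(\<cdot>, y)\<close> of coordinate degree below
  \<open>l\<close> has error \<open>O(2 ^ (- l))\<close>, so \<open>f\<close> is uniformly close to a kernel of rank \<open>(N l) ^ d\<close>; the eigenvalue
  bound follows from the Eckart--Young inequality, with \<open>1 / n\<close> paid for the diagonal.

  For the risk, one needs \<open>\<parallel>A - \<rho> M\<parallel> = O(sqrt (n \<rho>))\<close> with probability at least \<open>1 - 1 / n\<close>. Take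
  \<open>p \<ge> n \<rho>\<close> and \<open>p \<ge> ln n\<close> of order \<open>n \<rho>\<close>. In the expansion of \<open>E tr (A - \<rho> M) ^ (2 p)\<close> into closed walks
  only walks without simply traversed edges survive, and one with \<open>m\<close> vertices weighs at most
  \<open>\<rho> ^ (m - 1)\<close>. Comparing the number of realisations of each walk pattern in \<open>n\<close> and in
  \<open>r = 2 p + 1\<close> vertices bounds the expansion by \<open>n\<close> times that of an \<open>r\<close>-dimensional symmetric matrix whose
  entries are \<open>2\<close> with probability \<open>1 / 3\<close> and \<open>- 1\<close> otherwise: their mean is \<open>0\<close> and all higher
  moments are at least \<open>1\<close>. These entries are subgaussian, so an \<open>\<epsilon>\<close>-net bounds the norm of that matrix by
  \<open>O(sqrt r)\<close>, in the sense of its \<open>2 p\<close>-th moment.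
  Given the noise bound, the risk of thresholding at \<open>\<tau>\<close> is \<open>O(R \<tau>\<^sup>2 / \<rho>\<^sup>2)\<close> plus the eigenvalue tail
  beyond \<open>R\<close>, and \<open>R\<close> of order \<open>ln (n \<rho>) ^ d\<close> balances the two.
\<close>

section \<open>Vectors and matrices indexed by initial segments\<close>

text \<open>The obstacle is sparsity. A union bound over a net, applied to
  \<open>A - \<rho> M\<close> itself, is too weak for small \<open>\<rho>\<close>: the subgaussian
  scale of a centred Bernoulli entry is much larger than its standard deviation, which is of order
  \<open>sqrt \<rho>\<close>. The walk comparison moves the problem to a dense matrix whose
  dimension is proportional to \<open>p\<close>, so a net of size exponential in the dimension costs
  only a constant after the \<open>2 p\<close>-th root. It also replaces any enumeration of
  tree-like walks. Both conditions on \<open>p\<close> are used: \<open>p \<ge> n \<rho>\<close>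
  turns the weight \<open>(n \<rho>) ^ (m - 1)\<close> of a pattern into \<open>p ^ (m - 1)\<close>,
  and \<open>p \<ge> ln n\<close> gives \<open>n \<le> exp p\<close>, so that the factor
  \<open>n\<close> of the trace and the failure probability \<open>1 / n\<close> cost only
  constants. The hypothesis \<open>n \<rho> \<ge> C ln n\<close> keeps such a \<open>p\<close> of
  order \<open>n \<rho>\<close>. Fair signs could not serve as comparison entries, because their odd
  moments vanish while a walk may use an edge three times; the skewed values 2 and -1 repair this.
  Operator norms never appear as suprema: they are inequalities between squared norms, valid for all
  vectors.\<close>

definition dotp :: "nat \<Rightarrow> (nat \<Rightarrow> real) \<Rightarrow> (nat \<Rightarrow> real) \<Rightarrow> real" where
  "dotp n x y = (\<Sum>i<n. x i * y i)"

abbreviation sqnorm :: "nat \<Rightarrow> (nat \<Rightarrow> real) \<Rightarrow> real" where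
  "sqnorm n x \<equiv> dotp n x x"

text \<open>Vectors and matrices are plain functions read only below \<open>n\<close>, so no
  dimension conditions are carried along. The price is that vectors agree only up to index
  \<open>n\<close>, which \<open>dotp_cong\<close> and \<open>mat_app_cong\<close> absorb.\<close>

definition mat_app :: "nat \<Rightarrow> (nat \<Rightarrow> nat \<Rightarrow> real) \<Rightarrow> (nat \<Rightarrow> real) \<Rightarrow> nat \<Rightarrow> real" where
  "mat_app n S x = (\<lambda>i. \<Sum>j<n. S i j * x j)"

definition orthonormal :: "nat \<Rightarrow> (nat \<Rightarrow> nat \<Rightarrow> real) \<Rightarrow> bool" where
  "orthonormal n u \<longleftrightarrow> (\<forall>i<n. \<forall>j<n. dotp n (u i) (u j) = (if i = j then 1 else 0))"

text \<open>Zero vectors are allowed so that Gram--Schmidt needs no linear independence.\<close>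

definition orthonormal0 :: "nat \<Rightarrow> (nat \<Rightarrow> nat \<Rightarrow> real) \<Rightarrow> nat set \<Rightarrow> bool" where
  "orthonormal0 n u I \<longleftrightarrow> (\<forall>i\<in>I. \<forall>j\<in>I. i \<noteq> j \<longrightarrow> dotp n (u i) (u j) = 0) \<and>
     (\<forall>i\<in>I. sqnorm n (u i) = 1 \<or> (\<forall>k<n. u i k = 0))"

lemma dotp_commute: "dotp n x y = dotp n y x"
  by (simp add: dotp_def mult.commute)

lemma dotp_self_nonneg: "0 \<le> sqnorm n x"
  by (simp add: dotp_def sum_nonneg)

lemma dotp_self_eq_0_iff: "sqnorm n x = 0 \<longleftrightarrow> (\<forall>k<n. x k = 0)"
  by (auto simp: dotp_def sum_nonneg_eq_0_iff)

lemma dotp_cong: "(\<And>k. k < n \<Longrightarrow> x k = x' k) \<Longrightarrow> (\<And>k. k < n \<Longrightarrow> y k = y' k) \<Longrightarrow> dotp n x y = dotp n x' y'"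
  by (simp add: dotp_def)

lemma dotp_diff_right: "dotp n x (\<lambda>k. y k - z k) = dotp n x y - dotp n x z"
  by (simp add: dotp_def algebra_simps sum_subtractf)

lemma dotp_scale_right: "dotp n x (\<lambda>k. c * y k) = c * dotp n x y"
  by (simp add: dotp_def sum_distrib_left algebra_simps)

lemma dotp_sum_right: "dotp n x (\<lambda>k. \<Sum>i\<in>I. c i * y i k) = (\<Sum>i\<in>I. c i * dotp n x (y i))"
proof -
  have "dotp n x (\<lambda>k. \<Sum>i\<in>I. c i * y i k) = (\<Sum>k<n. \<Sum>i\<in>I. c i * (x k * y i k))"
    by (simp add: dotp_def sum_distrib_left algebra_simps)
  also have "\<dots> = (\<Sum>i\<in>I. c i * dotp n x (y i))"
    by (subst sum.swap) (simp add: dotp_def sum_distrib_left)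
  finally show ?thesis .
qed

lemma dotp_sum_left: "dotp n (\<lambda>k. \<Sum>i\<in>I. c i * y i k) x = (\<Sum>i\<in>I. c i * dotp n (y i) x)"
  using dotp_sum_right[of n x c y I] by (simp add: dotp_commute)

lemma dotp_diff_left: "dotp n (\<lambda>k. y k - z k) x = dotp n y x - dotp n z x"
  using dotp_diff_right[of n x y z] by (simp add: dotp_commute)

lemma dotp_scale_left: "dotp n (\<lambda>k. c * y k) x = c * dotp n y x"
  using dotp_scale_right[of n x c y] by (simp add: dotp_commute)

lemma dotp_mat_app:
  "dotp n x (mat_app n S y) = dotp n (mat_app n (\<lambda>i j. S j i) x) y"
proof -
  have "dotp n x (mat_app n S y) = (\<Sum>i<n. \<Sum>j<n. x i * (S i j * y j))"
    by (simp add: dotp_def mat_app_def sum_distrib_left)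
  also have "\<dots> = (\<Sum>j<n. \<Sum>i<n. x i * (S i j * y j))" by (rule sum.swap)
  also have "\<dots> = dotp n (mat_app n (\<lambda>i j. S j i) x) y"
    by (simp add: dotp_def mat_app_def sum_distrib_left mult.commute mult.left_commute)
  finally show ?thesis .
qed

lemma dotp_linear_combination:
  assumes "\<And>k. k < n \<Longrightarrow> y k = (\<Sum>i\<in>I. c i * z i k)"
  shows "dotp n x y = (\<Sum>i\<in>I. c i * dotp n x (z i))"
  unfolding dotp_sum_right[symmetric] using assms by (intro dotp_cong) auto

lemma mat_app_sum: "mat_app n S (\<lambda>k. \<Sum>i\<in>I. c i * y i k) = (\<lambda>k. \<Sum>i\<in>I. c i * mat_app n S (y i) k)"
proof
  fix k
  show "mat_app n S (\<lambda>k. \<Sum>i\<in>I. c i * y i k) k = (\<Sum>i\<in>I. c i * mat_app n S (y i) k)"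
    using dotp_sum_right[of n "S k" c y I] by (simp add: dotp_def mat_app_def)
qed

lemma mat_app_cong: "(\<And>k. k < n \<Longrightarrow> x k = y k) \<Longrightarrow> mat_app n S x = mat_app n S y"
  by (simp add: mat_app_def)

lemma dotp_Cauchy_Schwarz: "(dotp n x y)\<^sup>2 \<le> sqnorm n x * sqnorm n y"
  using Cauchy_Schwarz_ineq_sum[of x y "{..<n}"] by (simp add: dotp_def power2_eq_square)

lemma orthonormal0_coeff:
  assumes "orthonormal0 n u I" "i \<in> I"
  shows "dotp n (u i) x * sqnorm n (u i) = dotp n (u i) x"
proof -
  consider "sqnorm n (u i) = 1" | "\<forall>k<n. u i k = 0"
    using assms unfolding orthonormal0_def by blast
  then show ?thesis by cases (simp_all add: dotp_def)
qed

text \<open>Pythagoras for the part \<open>v\<close> of \<open>x\<close> left after projection onto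
  the family. Zero members drop out of the projection, so the usual formulas survive.\<close>

lemma orthonormal0_residual:
  fixes u x I n
  defines "v \<equiv> (\<lambda>k. x k - (\<Sum>i\<in>I. dotp n (u i) x * u i k))"
  assumes "finite I" "orthonormal0 n u I"
  shows orthonormal0_residual_orth: "i \<in> I \<Longrightarrow> dotp n (u i) v = 0"
    and orthonormal0_residual_dotp: "dotp n v x = sqnorm n v"
    and orthonormal0_residual_norm: "sqnorm n v = sqnorm n x - (\<Sum>i\<in>I. (dotp n (u i) x)\<^sup>2)"
proof -
  show orth: "dotp n (u i) v = 0" if i: "i \<in> I" for i
  proof -
    have "dotp n (u i) v = dotp n (u i) x - (\<Sum>j\<in>I. dotp n (u j) x * dotp n (u i) (u j))"
      unfolding v_def dotp_diff_right dotp_sum_right ..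
    also have "(\<Sum>j\<in>I. dotp n (u j) x * dotp n (u i) (u j)) =
      (\<Sum>j\<in>I. if j = i then dotp n (u i) x * sqnorm n (u i) else 0)"
      using assms(3) i by (intro sum.cong) (auto simp: orthonormal0_def)
    also have "\<dots> = dotp n (u i) x"
      using i assms(2) orthonormal0_coeff[OF assms(3) i] by simp
    finally show ?thesis by simp
  qed
  have "sqnorm n v = dotp n v x - (\<Sum>i\<in>I. dotp n (u i) x * dotp n v (u i))"
    by (subst (2) v_def) (simp add: dotp_diff_right dotp_sum_right)
  then show vx: "dotp n v x = sqnorm n v" using orth by (simp add: dotp_commute[of n v "u _"])
  have "dotp n v x = sqnorm n x - (\<Sum>i\<in>I. (dotp n (u i) x)\<^sup>2)"
    by (simp add: v_def dotp_diff_left dotp_sum_left power2_eq_square)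
  with vx show "sqnorm n v = sqnorm n x - (\<Sum>i\<in>I. (dotp n (u i) x)\<^sup>2)" by simp
qed

lemma bessel_inequality:
  assumes "finite I" "orthonormal0 n u I"
  shows "(\<Sum>i\<in>I. (dotp n (u i) x)\<^sup>2) \<le> sqnorm n x"
proof -
  define v where "v k = x k - (\<Sum>i\<in>I. dotp n (u i) x * u i k)" for k
  have "sqnorm n v = sqnorm n x - (\<Sum>i\<in>I. (dotp n (u i) x)\<^sup>2)"
    using orthonormal0_residual_norm[OF assms, of x] by (simp add: v_def[abs_def])
  with dotp_self_nonneg[of n v] show ?thesis by simp
qed

lemma orthonormal_imp_orthonormal0: "orthonormal n u \<Longrightarrow> I \<subseteq> {..<n} \<Longrightarrow> orthonormal0 n u I"
  unfolding orthonormal_def orthonormal0_def by (simp add: subset_iff)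

text \<open>A one-sided inverse of a square matrix is two-sided.\<close>

lemma orthonormal_columns:
  assumes "orthonormal n u" "k < n" "l < n"
  shows "(\<Sum>i<n. u i k * u i l) = (if k = l then 1 else 0)"
proof -
  define P where "P = mat n n (\<lambda>(i, k). u i k)"
  have P: "P \<in> carrier_mat n n" and Pt: "transpose_mat P \<in> carrier_mat n n" by (auto simp: P_def)
  have "P * transpose_mat P = 1\<^sub>m n"
    using assms(1) by (intro eq_matI) (auto simp: P_def orthonormal_def dotp_def scalar_prod_def atLeast0LessThan)
  from mat_mult_left_right_inverse[OF P Pt this]
  have "(transpose_mat P * P) $$ (k, l) = 1\<^sub>m n $$ (k, l)" by simp
  thus ?thesis using assms(2,3) by (simp add: P_def scalar_prod_def atLeast0LessThan)
qed

lemma orthonormal_expand: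
  assumes "orthonormal n u" "k < n"
  shows "x k = (\<Sum>i<n. dotp n (u i) x * u i k)"
proof -
  have "(\<Sum>i<n. dotp n (u i) x * u i k) = (\<Sum>i<n. \<Sum>l<n. x l * (u i l * u i k))"
    by (simp add: dotp_def sum_distrib_left mult.commute mult.left_commute)
  also have "\<dots> = (\<Sum>l<n. x l * (\<Sum>i<n. u i l * u i k))"
    by (subst sum.swap) (simp add: sum_distrib_left)
  also have "\<dots> = (\<Sum>l<n. if l = k then x l else 0)"
    by (intro sum.cong) (auto simp: orthonormal_columns[OF assms(1) _ assms(2)])
  finally show ?thesis using assms(2) by simp
qed

lemma parseval:
  assumes "orthonormal n u"
  shows "(\<Sum>i<n. (dotp n (u i) x)\<^sup>2) = sqnorm n x"
proof -
  have "sqnorm n x = dotp n x (\<lambda>k. \<Sum>i<n. dotp n (u i) x * u i k)"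
    using orthonormal_expand[OF assms] by (intro dotp_cong) auto
  also have "\<dots> = (\<Sum>i<n. (dotp n (u i) x)\<^sup>2)"
    by (simp add: dotp_sum_right dotp_commute[of n x] power2_eq_square)
  finally show ?thesis by simp
qed

text \<open>Parseval is applied to each row of \<open>S\<close>. Squared errors of matrices can thus
  be computed in whichever orthonormal basis is convenient.\<close>

lemma frobenius_parseval:
  assumes "orthonormal n u"
  shows "(\<Sum>j<n. sqnorm n (mat_app n S (u j))) = (\<Sum>i<n. \<Sum>j<n. (S i j)\<^sup>2)"
proof -
  have "(\<Sum>j<n. sqnorm n (mat_app n S (u j))) = (\<Sum>j<n. \<Sum>i<n. (dotp n (u j) (S i))\<^sup>2)"
    by (simp add: dotp_def mat_app_def power2_eq_square mult.commute)
  also have "\<dots> = (\<Sum>i<n. \<Sum>j<n. (S i j)\<^sup>2)"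
    by (subst sum.swap) (simp add: parseval[OF assms], simp add: dotp_def power2_eq_square)
  finally show ?thesis .
qed

text \<open>Triangular relations are recorded in both directions, so the initial segments of
  \<open>p\<close> and \<open>u\<close> have equal spans; the spectral theorem uses each
  direction.\<close>

lemma gram_schmidt:
  fixes p :: "nat \<Rightarrow> nat \<Rightarrow> real"
  shows "\<exists>u. orthonormal0 n u {..<r} \<and>
     (\<forall>k<r. \<forall>i<n. p k i = (\<Sum>l\<le>k. dotp n (u l) (p k) * u l i)) \<and>
     (\<forall>k<r. \<exists>c. \<forall>i<n. u k i = (\<Sum>l\<le>k. c l * p l i))"
proof (induction r)
  case 0
  show ?case by (auto simp: orthonormal0_def)
next
  case (Suc r)
  then obtain u where u: "orthonormal0 n u {..<r}"
    and pu: "\<And>k i. k < r \<Longrightarrow> i < n \<Longrightarrow> p k i = (\<Sum>l\<le>k. dotp n (u l) (p k) * u l i)"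
    and up: "\<And>k. k < r \<Longrightarrow> \<exists>c. \<forall>i<n. u k i = (\<Sum>l\<le>k. c l * p l i)" by blast
  define w where "w i = p r i - (\<Sum>l<r. dotp n (u l) (p r) * u l i)" for i
  \<comment> \<open>If \<open>p r\<close> depends on its predecessors, the residual is zero and the
    scale 0 appends a zero vector.\<close>
  define s where "s = (if sqnorm n w = 0 then 0 else 1 / sqrt (sqnorm n w))"
  define u' where "u' = u(r := (\<lambda>i. s * w i))"
  have w: "w = (\<lambda>k. p r k - (\<Sum>l<r. dotp n (u l) (p r) * u l k))" by (auto simp: w_def)
  have ow: "dotp n (u k) w = 0" if "k < r" for k
    using orthonormal0_residual_orth[OF _ u, of k "p r"] that unfolding w by simp
  have ss: "s * s * sqnorm n w = (if sqnorm n w = 0 then 0 else 1)"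
    by (simp add: s_def dotp_self_nonneg)
  have "orthonormal0 n u' {..<Suc r}"
    unfolding orthonormal0_def
  proof (intro conjI ballI impI)
    fix i j assume ij: "i \<in> {..<Suc r}" "j \<in> {..<Suc r}" "i \<noteq> j"
    then consider "i < r" "j < r" | "i < r" "j = r" | "i = r" "j < r" by fastforce
    then show "dotp n (u' i) (u' j) = 0"
    proof cases
      case 1 with u ij show ?thesis by (simp add: u'_def orthonormal0_def)
    next
      case 2 with ow[of i] show ?thesis by (simp add: u'_def dotp_scale_right)
    next
      case 3 with ow[of j] show ?thesis by (simp add: u'_def dotp_scale_left dotp_commute[of n w])
    qed
  next
    fix i assume i: "i \<in> {..<Suc r}"
    show "sqnorm n (u' i) = 1 \<or> (\<forall>k<n. u' i k = 0)"
    proof (cases "i = r")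
      case True
      have "sqnorm n (u' r) = s * s * sqnorm n w"
        by (simp add: u'_def dotp_scale_left dotp_scale_right)
      with ss True show ?thesis by (cases "sqnorm n w = 0") (auto simp: u'_def s_def)
    next
      case False
      with i u show ?thesis by (auto simp: u'_def orthonormal0_def)
    qed
  qed
  moreover have "p k i = (\<Sum>l\<le>k. dotp n (u' l) (p k) * u' l i)" if "k < Suc r" "i < n" for k i
  proof (cases "k = r")
    case False
    with pu[of k i] that show ?thesis by (simp add: u'_def)
  next
    case True
    have "dotp n w (p r) = sqnorm n w"
      using orthonormal0_residual_dotp[OF _ u, of "p r"] unfolding w by simp
    then have "dotp n (u' r) (p r) * u' r i = s * s * sqnorm n w * w i"
      by (simp add: u'_def dotp_scale_left)
    also have "\<dots> = w i" using ss that dotp_self_eq_0_iff[of n w] by auto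
    finally have "dotp n (u' r) (p r) * u' r i = w i" .
    moreover have "(\<Sum>l<r. dotp n (u' l) (p r) * u' l i) = (\<Sum>l<r. dotp n (u l) (p r) * u l i)"
      by (simp add: u'_def)
    ultimately show ?thesis using True by (simp add: lessThan_Suc_atMost[symmetric] w_def)
  qed
  moreover have "\<exists>c. \<forall>i<n. u' k i = (\<Sum>l\<le>k. c l * p l i)" if "k < Suc r" for k
  proof (cases "k = r")
    case False
    with up[of k] that show ?thesis by (simp add: u'_def)
  next
    case True
    obtain c where c: "\<And>k i. k < r \<Longrightarrow> i < n \<Longrightarrow> u k i = (\<Sum>l\<le>k. c k l * p l i)" using up by metis
    \<comment> \<open>These coefficients arise by substituting the triangular expressions of the
      earlier \<open>u m\<close> into the residual.\<close>
    define d where "d l = (if l = r then s else - s * (\<Sum>m | m < r \<and> l \<le> m. dotp n (u m) (p r) * c m l))" for l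
    have "u' k i = (\<Sum>l\<le>k. d l * p l i)" if i: "i < n" for i
    proof -
      have "(\<Sum>m<r. dotp n (u m) (p r) * u m i) = (\<Sum>m<r. \<Sum>l<r. if l \<le> m then dotp n (u m) (p r) * c m l * p l i else 0)"
      proof (intro sum.cong refl)
        fix m assume m: "m \<in> {..<r}"
        have "(\<Sum>l<r. if l \<le> m then dotp n (u m) (p r) * c m l * p l i else 0) =
          (\<Sum>l\<le>m. dotp n (u m) (p r) * c m l * p l i)"
          using m by (subst sum.inter_filter[symmetric]) (auto intro!: sum.cong)
        then show "dotp n (u m) (p r) * u m i = (\<Sum>l<r. if l \<le> m then dotp n (u m) (p r) * c m l * p l i else 0)"
          using c[of m i] m i by (simp add: sum_distrib_left mult.assoc)
      qed
      also have "\<dots> = (\<Sum>l<r. (\<Sum>m | m < r \<and> l \<le> m. dotp n (u m) (p r) * c m l) * p l i)"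
        by (subst sum.swap) (auto intro!: sum.cong simp: sum_distrib_right sum.inter_filter[symmetric])
      finally have "w i = p r i - (\<Sum>l<r. (\<Sum>m | m < r \<and> l \<le> m. dotp n (u m) (p r) * c m l) * p l i)"
        by (simp add: w_def)
      moreover have "(\<Sum>l<r. d l * p l i) =
          - s * (\<Sum>l<r. (\<Sum>m | m < r \<and> l \<le> m. dotp n (u m) (p r) * c m l) * p l i)"
        unfolding sum_distrib_left by (intro sum.cong) (auto simp: d_def)
      ultimately have "u' k i = s * p r i + (\<Sum>l<r. d l * p l i)"
        using True by (simp add: u'_def right_diff_distrib)
      then show ?thesis using True by (simp add: lessThan_Suc_atMost[symmetric] d_def)
    qed
    then show ?thesis by blast
  qed
  ultimately show ?case by blast
qed

section \<open>Spectral theorem\<close>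

text \<open>The Hermitian form \<open>z\<close> of the eigenvector is its own conjugate by symmetry,
  and it equals \<open>a\<close> times a nonzero real number.\<close>

lemma symmetric_complex_eigenvalue_real:
  fixes A :: "real mat"
  assumes A: "A \<in> carrier_mat n n" and sym: "\<And>i j. i < n \<Longrightarrow> j < n \<Longrightarrow> A $$ (i, j) = A $$ (j, i)"
    and ev: "eigenvalue (map_mat complex_of_real A) a"
  shows "a \<in> \<real>"
proof -
  let ?A = "map_mat complex_of_real A"
  from ev obtain v where v: "v \<in> carrier_vec n" "v \<noteq> 0\<^sub>v n" "?A *\<^sub>v v = a \<cdot>\<^sub>v v"
    using A by (auto simp: eigenvalue_def eigenvector_def)
  define x where "x i = vec_index v i" for i
  have Av: "(\<Sum>j<n. complex_of_real (A $$ (i, j)) * x j) = a * x i" if "i < n" for i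
  proof -
    have "vec_index (?A *\<^sub>v v) i = (\<Sum>j<n. complex_of_real (A $$ (i, j)) * x j)"
      using that A v(1) by (auto simp: scalar_prod_def x_def atLeast0LessThan)
    then show ?thesis using v that by (simp add: x_def)
  qed
  define s where "s = (\<Sum>i<n. (cmod (x i))\<^sup>2)"
  define z where "z = (\<Sum>i<n. \<Sum>j<n. cnj (x i) * complex_of_real (A $$ (i, j)) * x j)"
  have "cnj z = (\<Sum>i<n. \<Sum>j<n. cnj (x j) * complex_of_real (A $$ (j, i)) * x i)"
    using sym by (simp add: z_def mult.commute mult.left_commute)
  also have "\<dots> = z" unfolding z_def by (rule sum.swap)
  finally have cz: "cnj z = z" .
  have "z = (\<Sum>i<n. cnj (x i) * (a * x i))"
    unfolding z_def by (intro sum.cong refl) (simp add: Av[symmetric] sum_distrib_left mult.assoc)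
  also have "\<dots> = a * of_real s"
    unfolding s_def of_real_sum sum_distrib_left
    by (intro sum.cong refl) (simp add: complex_norm_square[unfolded of_real_power] mult.commute mult.left_commute)
  finally have z: "z = a * of_real s" .
  have "s \<noteq> 0"
  proof
    assume "s = 0"
    then have "\<forall>i<n. x i = 0" by (auto simp: s_def sum_nonneg_eq_0_iff)
    then have "v = 0\<^sub>v n" using v(1) by (intro eq_vecI) (auto simp: x_def)
    with v(2) show False by simp
  qed
  with cz z have "cnj a = a" by simp
  then show ?thesis by (simp add: Reals_cnj_iff)
qed

text \<open>The polynomial splits over the complex numbers with real roots only; injectivity of the
  embedding on coefficients brings the factorisation back.\<close>

lemma symmetric_char_poly_splits:
  fixes A :: "real mat"
  assumes A: "A \<in> carrier_mat n n" and sym: "\<And>i j. i < n \<Longrightarrow> j < n \<Longrightarrow> A $$ (i, j) = A $$ (j, i)"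
  shows "\<exists>es. char_poly A = (\<Prod>e\<leftarrow>es. [:- e, 1:])"
proof -
  let ?A = "map_mat complex_of_real A"
  have cA: "?A \<in> carrier_mat n n" using A by simp
  obtain as where as: "char_poly ?A = (\<Prod>a\<leftarrow>as. [:- a, 1:])"
    using char_poly_factorized[OF cA] by blast
  have real: "complex_of_real (Re a) = a" if "a \<in> set as" for a
  proof -
    have "poly (char_poly ?A) a = 0" unfolding as by (rule linear_poly_root[OF that])
    then have "eigenvalue ?A a" using eigenvalue_root_char_poly[OF cA] by blast
    then have "a \<in> \<real>" using symmetric_complex_eigenvalue_real[OF A sym] by blast
    then show ?thesis by (auto elim: Reals_cases)
  qed
  define es where "es = map Re as"
  have hom: "map_poly complex_of_real (\<Prod>e\<leftarrow>xs. [:- e, 1:]) = (\<Prod>e\<leftarrow>xs. [:- complex_of_real e, 1:])" for xs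
  proof (induction xs)
    case (Cons x xs)
    interpret h: map_poly_comm_ring_hom complex_of_real ..
    show ?case using Cons by (simp only: list.map prod_list.Cons h.hom_mult) (simp add: of_real_hom.map_poly_pCons_hom)
  qed simp
  have "map Re as = es" "map (\<lambda>e. [:- complex_of_real e, 1:]) es = map (\<lambda>a. [:- a, 1:]) as"
    using real by (simp_all add: es_def)
  then have "map_poly complex_of_real (\<Prod>e\<leftarrow>es. [:- e, 1:]) = char_poly ?A"
    by (simp only: hom as)
  also have "\<dots> = map_poly complex_of_real (char_poly A)"
    by (rule of_real_hom.char_poly_hom[OF A])
  finally have eq: "map_poly complex_of_real (\<Prod>e\<leftarrow>es. [:- e, 1:]) = map_poly complex_of_real (char_poly A)" .
  have "char_poly A = (\<Prod>e\<leftarrow>es. [:- e, 1:])"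
  proof (rule poly_eqI)
    fix k
    from arg_cong[OF eq, of "\<lambda>p. coeff p k"]
    show "coeff (char_poly A) k = coeff (\<Prod>e\<leftarrow>es. [:- e, 1:]) k" by (simp add: coeff_map_poly)
  qed
  then show ?thesis by blast
qed

text \<open>The Schur decomposition is used only as a triangularisation by an invertible
  \<open>P\<close>. Gram-Schmidt on the columns of \<open>P\<close> preserves the flag of spans, so
  the matrix is triangular in the basis \<open>u\<close> as well, and symmetry then makes it
  diagonal. The eigenvalues inherit the order of \<open>es\<close> from the diagonal of
  \<open>B\<close>.\<close>

lemma spectral_theorem:
  fixes A :: "real mat"
  assumes A: "A \<in> carrier_mat n n" and sym: "\<And>i j. i < n \<Longrightarrow> j < n \<Longrightarrow> A $$ (i, j) = A $$ (j, i)"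
    and es: "char_poly A = (\<Prod>e\<leftarrow>es. [:- e, 1:])"
  shows "length es = n \<and> (\<exists>u. orthonormal n u \<and>
    (\<forall>k<n. \<forall>i<n. mat_app n (\<lambda>i j. A $$ (i, j)) (u k) i = es ! k * u k i))"
proof -
  obtain B P Q where BPQ: "schur_decomposition A es = (B, P, Q)" by (metis prod_cases3)
  from schur_decomposition[OF A es BPQ]
  have wit: "similar_mat_wit A B P Q" and ut: "upper_triangular B" and diag: "diag_mat B = es" by auto
  from similar_mat_witD2[OF A wit]
  have PQ: "P * Q = 1\<^sub>m n" and QP: "Q * P = 1\<^sub>m n" and APBQ: "A = P * B * Q"
    and B: "B \<in> carrier_mat n n" and P: "P \<in> carrier_mat n n" and Q: "Q \<in> carrier_mat n n" by auto
  have len: "length es = n" using diag B by (auto simp: diag_mat_def)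
  have Bd: "B $$ (k, k) = es ! k" if "k < n" for k
    using diag B that by (auto simp: diag_mat_def)
  let ?M = "mat_app n (\<lambda>i j. A $$ (i, j))"
  define p where "p k i = P $$ (i, k)" for k i
  have "A * P = P * B * (Q * P)" using APBQ A B P Q by (simp add: assoc_mult_mat[of _ n n _ n _ n])
  then have AP: "A * P = P * B" using QP B P by simp
  have Mp: "?M (p k) i = (\<Sum>l\<le>k. B $$ (l, k) * p l i)" if "k < n" "i < n" for k i
  proof -
    have "?M (p k) i = (A * P) $$ (i, k)"
      using that A P by (simp add: mat_app_def p_def scalar_prod_def atLeast0LessThan)
    also have "\<dots> = (\<Sum>l<n. B $$ (l, k) * p l i)"
      using that B P by (simp add: AP p_def scalar_prod_def atLeast0LessThan mult.commute)
    also have "\<dots> = (\<Sum>l\<le>k. B $$ (l, k) * p l i)"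
      using that B ut by (intro sum.mono_neutral_right) (auto simp: not_le)
    finally show ?thesis .
  qed
  obtain u where u: "orthonormal0 n u {..<n}"
    and pu: "\<And>k i. k < n \<Longrightarrow> i < n \<Longrightarrow> p k i = (\<Sum>l\<le>k. dotp n (u l) (p k) * u l i)"
    and up: "\<And>k. k < n \<Longrightarrow> \<exists>c. \<forall>i<n. u k i = (\<Sum>l\<le>k. c l * p l i)"
    using gram_schmidt[of n n p] by blast
  obtain c where c: "\<And>k i. k < n \<Longrightarrow> i < n \<Longrightarrow> u k i = (\<Sum>l\<le>k. c k l * p l i)" using up by metis
  \<comment> \<open>The column \<open>p k\<close> lies in the span of \<open>u 0\<close>, ...,
    \<open>u k\<close>.\<close>
  have up0: "dotp n (u m) (p k) = 0" if "k < m" "m < n" for k m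
  proof -
    have "dotp n (u m) (p k) = (\<Sum>l\<le>k. dotp n (u l) (p k) * dotp n (u m) (u l))"
      using that by (intro dotp_linear_combination pu) auto
    also have "\<dots> = 0" using u that by (intro sum.neutral) (auto simp: orthonormal0_def)
    finally show ?thesis .
  qed
  have expand: "x i = (\<Sum>l<n. dotp n (u l) x * u l i)" if i: "i < n" for x i
  proof -
    \<comment> \<open>The vector \<open>x\<close> lies in the span of the \<open>p k\<close>, hence of the \<open>u k\<close>, on which the projection is the identity.\<close>
    define z where "z = Q *\<^sub>v vec n x"
    have z: "z \<in> carrier_vec n" using Q by (auto simp: z_def)
    have "P *\<^sub>v z = (P * Q) *\<^sub>v vec n x" unfolding z_def using P Q by (intro assoc_mult_mat_vec[symmetric]) auto
    then have Pz: "P *\<^sub>v z = vec n x" using PQ by simp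
    have xp: "x j = (\<Sum>k<n. vec_index z k * p k j)" if "j < n" for j
    proof -
      have "vec_index (P *\<^sub>v z) j = (\<Sum>k<n. vec_index z k * p k j)"
        using that P z by (simp add: scalar_prod_def p_def atLeast0LessThan mult.commute)
      then show ?thesis using Pz that by simp
    qed
    have pe: "p k i = (\<Sum>l<n. dotp n (u l) (p k) * u l i)" if "k < n" for k
      unfolding pu[OF that i] using that up0 by (intro sum.mono_neutral_left) (auto simp: not_le)
    have "x i = (\<Sum>k<n. vec_index z k * (\<Sum>l<n. dotp n (u l) (p k) * u l i))"
      using xp[OF i] pe by simp
    also have "\<dots> = (\<Sum>l<n. (\<Sum>k<n. vec_index z k * dotp n (u l) (p k)) * u l i)"
      unfolding sum_distrib_left sum_distrib_right by (subst sum.swap) (simp add: mult.assoc)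
    also have "\<dots> = (\<Sum>l<n. dotp n (u l) x * u l i)"
    proof (intro sum.cong refl)
      fix l
      have "dotp n (u l) x = dotp n (u l) (\<lambda>j. \<Sum>k<n. vec_index z k * p k j)"
        using xp by (intro dotp_cong) auto
      then show "(\<Sum>k<n. vec_index z k * dotp n (u l) (p k)) * u l i = dotp n (u l) x * u l i"
        by (simp add: dotp_sum_right)
    qed
    finally show ?thesis .
  qed
  \<comment> \<open>This rules out the zero vectors that Gram-Schmidt permits: each squared norm is
    0 or 1, and expanding the standard basis shows that they sum to \<open>n\<close>.\<close>
  have on: "orthonormal n u"
  proof -
    have "(\<Sum>l<n. sqnorm n (u l)) = (\<Sum>l<n. \<Sum>i<n. u l i * u l i)"
      by (simp add: dotp_def)
    also have "\<dots> = (\<Sum>i<n. \<Sum>l<n. u l i * u l i)" by (rule sum.swap)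
    also have "\<dots> = (\<Sum>i<n. 1)"
    proof (intro sum.cong refl)
      fix i assume "i \<in> {..<n}"
      then have i: "i < n" by simp
      have "dotp n (u l) (\<lambda>j. if j = i then 1 else 0) = u l i" for l
        using i by (simp add: dotp_def if_distrib[of "\<lambda>x. _ * x"] cong: if_cong)
      then show "(\<Sum>l<n. u l i * u l i) = 1"
        using expand[OF i, of "\<lambda>j. if j = i then 1 else 0"] by simp
    qed
    finally have s: "(\<Sum>l<n. 1 - sqnorm n (u l)) = 0" by (simp add: sum_subtractf)
    have "\<forall>l\<in>{..<n}. 1 - sqnorm n (u l) = 0"
    proof (subst sum_nonneg_eq_0_iff[symmetric])
      fix l assume "l \<in> {..<n}"
      then have "sqnorm n (u l) = 1 \<or> sqnorm n (u l) = 0"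
        using u unfolding orthonormal0_def by (metis dotp_self_eq_0_iff)
      then show "0 \<le> 1 - sqnorm n (u l)" by auto
    qed (use s in auto)
    then show ?thesis using u by (simp add: orthonormal_def orthonormal0_def)
  qed
  have umM: "dotp n (u m) (?M (u k)) = 0" if "k < m" "m < n" for k m
  proof -
    have "?M (u k) = ?M (\<lambda>i. \<Sum>l\<le>k. c k l * p l i)" using c[of k] that by (intro mat_app_cong) auto
    also have "\<dots> = (\<lambda>i. \<Sum>l\<le>k. c k l * ?M (p l) i)" by (rule mat_app_sum)
    finally have "dotp n (u m) (?M (u k)) = (\<Sum>l\<le>k. c k l * dotp n (u m) (?M (p l)))"
      by (simp add: dotp_sum_right)
    also have "\<dots> = 0"
    proof (intro sum.neutral ballI)
      fix l assume l: "l \<in> {..k}"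
      have "dotp n (u m) (?M (p l)) = dotp n (u m) (\<lambda>i. \<Sum>j\<le>l. B $$ (j, l) * p j i)"
        using Mp[of l] l that by (intro dotp_cong) auto
      also have "\<dots> = (\<Sum>j\<le>l. B $$ (j, l) * dotp n (u m) (p j))" by (rule dotp_sum_right)
      also have "\<dots> = 0" using up0[of _ m] l that by (intro sum.neutral) auto
      finally show "c k l * dotp n (u m) (?M (p l)) = 0" by simp
    qed
    finally show ?thesis .
  qed
  have Msym: "dotp n x (?M y) = dotp n y (?M x)" for x y
  proof -
    have "mat_app n (\<lambda>i j. A $$ (j, i)) x k = ?M x k" if "k < n" for k
      using sym that by (simp add: mat_app_def)
    then show ?thesis unfolding dotp_mat_app[of n x] by (subst dotp_commute) (rule dotp_cong, auto)
  qed
  \<comment> \<open>Symmetry carries the zeros from one side of the diagonal to the other.\<close>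
  have umM': "dotp n (u m) (?M (u k)) = 0" if "k \<noteq> m" "m < n" "k < n" for k m
  proof (cases "k < m")
    case False
    with that have "m < k" by simp
    from umM[OF this that(3)] show ?thesis by (subst Msym)
  qed (use that umM in blast)
  define lam where "lam k = dotp n (u k) (?M (u k))" for k
  have Mu: "?M (u k) i = lam k * u k i" if "k < n" "i < n" for k i
  proof -
    have "?M (u k) i = (\<Sum>l<n. dotp n (u l) (?M (u k)) * u l i)" by (rule expand[OF that(2)])
    also have "\<dots> = (\<Sum>l<n. if l = k then lam k * u k i else 0)"
      using umM' that by (intro sum.cong) (auto simp: lam_def)
    finally show ?thesis using that by simp
  qed
  \<comment> \<open>The number \<open>dotp n (p k) (?M (u k))\<close> is computed twice, once from
    the triangular form and once from the eigenvector equation. The common factor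
    \<open>dotp n (u k) (p k)\<close> is nonzero because \<open>p k\<close> is the only term of the
    expansion of \<open>u k\<close> that is not orthogonal to \<open>u k\<close>.\<close>
  have "lam k = es ! k" if k: "k < n" for k
  proof -
    have "dotp n (u k) (?M (p k)) = (\<Sum>l\<le>k. B $$ (l, k) * dotp n (u k) (p l))"
      by (rule dotp_linear_combination) (rule Mp[OF k])
    also have "\<dots> = es ! k * dotp n (u k) (p k)"
      using up0[of _ k] k by (simp add: lessThan_Suc_atMost[symmetric] Bd)
    finally have 1: "dotp n (p k) (?M (u k)) = es ! k * dotp n (u k) (p k)" using Msym by metis
    have "dotp n (p k) (?M (u k)) = dotp n (p k) (\<lambda>i. lam k * u k i)"
      using Mu[OF k] by (intro dotp_cong) auto
    then have 2: "dotp n (p k) (?M (u k)) = lam k * dotp n (u k) (p k)"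
      by (simp add: dotp_scale_right dotp_commute)
    have "1 = sqnorm n (u k)" using on k by (simp add: orthonormal_def)
    also have "\<dots> = (\<Sum>l\<le>k. c k l * dotp n (u k) (p l))"
      by (rule dotp_linear_combination) (rule c[OF k])
    also have "\<dots> = c k k * dotp n (u k) (p k)"
      using up0[of _ k] k by (simp add: lessThan_Suc_atMost[symmetric])
    finally have "dotp n (u k) (p k) \<noteq> 0" by (metis mult_zero_right zero_neq_one)
    with trans[OF 2[symmetric] 1] show ?thesis by (metis mult_cancel_right)
  qed
  with Mu have "\<forall>k<n. \<forall>i<n. ?M (u k) i = es ! k * u k i" by metis
  with len on show ?thesis by blast
qed

text \<open>The choice in \<open>ordered_eigenvalues\<close> is not vacuous: any factorisation can
  be sorted by modulus without changing the product.\<close>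

lemma ordered_eigenvalues_props:
  fixes A :: "real mat"
  assumes A: "A \<in> carrier_mat n n" and sym: "\<And>i j. i < n \<Longrightarrow> j < n \<Longrightarrow> A $$ (i, j) = A $$ (j, i)"
  shows "char_poly A = (\<Prod>e\<leftarrow>ordered_eigenvalues A. [:- e, 1:])"
    and "sorted_wrt (\<lambda>x y. \<bar>x\<bar> \<ge> \<bar>y\<bar>) (ordered_eigenvalues A)"
proof -
  obtain es where es: "char_poly A = (\<Prod>e\<leftarrow>es. [:- e, 1:])"
    using symmetric_char_poly_splits[OF A sym] by blast
  define es' where "es' = sort_key (\<lambda>x. - \<bar>x\<bar>) es"
  have "mset (map (\<lambda>e. [:- e, 1:]) es') = mset (map (\<lambda>e. [:- e, 1:]) es)"
    by (simp add: es'_def)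
  then have "char_poly A = (\<Prod>e\<leftarrow>es'. [:- e, 1:])"
    unfolding es by (metis prod_mset_prod_list)
  moreover have "sorted_wrt (\<lambda>x y. \<bar>x\<bar> \<ge> \<bar>y\<bar>) es'"
    using sorted_sort_key[of "\<lambda>x. - \<bar>x\<bar>" es] by (simp add: es'_def sorted_map)
  ultimately have "\<exists>es. char_poly A = (\<Prod>e\<leftarrow>es. [:- e, 1:]) \<and> sorted_wrt (\<lambda>x y. \<bar>x\<bar> \<ge> \<bar>y\<bar>) es" by blast
  from someI_ex[OF this]
  show "char_poly A = (\<Prod>e\<leftarrow>ordered_eigenvalues A. [:- e, 1:])"
    and "sorted_wrt (\<lambda>x y. \<bar>x\<bar> \<ge> \<bar>y\<bar>) (ordered_eigenvalues A)"
    unfolding ordered_eigenvalues_def by auto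
qed

lemma symmetric_eigenbasis:
  fixes A :: "real mat"
  assumes A: "A \<in> carrier_mat n n" and sym: "\<And>i j. i < n \<Longrightarrow> j < n \<Longrightarrow> A $$ (i, j) = A $$ (j, i)"
  obtains u where "orthonormal n u"
    "\<And>k i. k < n \<Longrightarrow> i < n \<Longrightarrow> mat_app n (\<lambda>i j. A $$ (i, j)) (u k) i = ordered_eigenvalues A ! k * u k i"
    "\<And>k l. k \<le> l \<Longrightarrow> l < n \<Longrightarrow> \<bar>ordered_eigenvalues A ! l\<bar> \<le> \<bar>ordered_eigenvalues A ! k\<bar>"
proof -
  note oe = ordered_eigenvalues_props[OF A sym]
  have st: "length (ordered_eigenvalues A) = n \<and> (\<exists>u. orthonormal n u \<and>
    (\<forall>k<n. \<forall>i<n. mat_app n (\<lambda>i j. A $$ (i, j)) (u k) i = ordered_eigenvalues A ! k * u k i))"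
    by (rule spectral_theorem[OF A _ oe(1)]) (rule sym)
  then have len: "length (ordered_eigenvalues A) = n" by (rule conjunct1)
  obtain u where u: "orthonormal n u"
    "\<forall>k<n. \<forall>i<n. mat_app n (\<lambda>i j. A $$ (i, j)) (u k) i = ordered_eigenvalues A ! k * u k i"
    using conjunct2[OF st] by (elim exE conjE)
  show ?thesis
  proof (rule that[OF u(1)])
    show "mat_app n (\<lambda>i j. A $$ (i, j)) (u k) i = ordered_eigenvalues A ! k * u k i"
      if "k < n" "i < n" for k i using u(2) that by simp
    show "\<bar>ordered_eigenvalues A ! l\<bar> \<le> \<bar>ordered_eigenvalues A ! k\<bar>" if "k \<le> l" "l < n" for k l
      using sorted_wrt_nth_less[OF oe(2), of k l] that len by (cases "k = l") auto
  qed
qed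

section \<open>Low-rank approximation and singular value thresholding\<close>

text \<open>A bathtub argument: weights bounded by 1 with total at most \<open>r\<close> remove the
  most when they sit on the \<open>r\<close> largest values.\<close>

lemma sum_antitone_weights:
  fixes a g :: "nat \<Rightarrow> real"
  assumes "r \<le> n" and anti: "\<And>k l. k \<le> l \<Longrightarrow> l < n \<Longrightarrow> a l \<le> a k" and nonneg: "\<And>k. k < n \<Longrightarrow> 0 \<le> a k"
    and g: "\<And>k. k < n \<Longrightarrow> 0 \<le> g k" "\<And>k. k < n \<Longrightarrow> g k \<le> 1" and sum_g: "(\<Sum>k<n. g k) \<le> real r"
  shows "(\<Sum>k=r..<n. a k) \<le> (\<Sum>k<n. a k * (1 - g k))"
proof (cases "r = n")
  case True
  then show ?thesis using nonneg g by (auto intro!: sum_nonneg mult_nonneg_nonneg)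
next
  case False
  with assms(1) have r: "r < n" by simp
  have split: "(\<Sum>k<n. h k) = (\<Sum>k<r. h k) + (\<Sum>k=r..<n. h k)" for h :: "nat \<Rightarrow> real"
    using r by (simp add: lessThan_atLeast0 sum.atLeastLessThan_concat)
  \<comment> \<open>The value \<open>a r\<close> separates the two ranges: it is at most every
    earlier value and at least every later one.\<close>
  have "0 \<le> a r * (real r - (\<Sum>k<n. g k))" using nonneg[OF r] sum_g by simp
  also have "\<dots> = (\<Sum>k<r. a r * (1 - g k)) - (\<Sum>k=r..<n. a r * g k)"
    by (simp add: split sum_subtractf sum_distrib_left algebra_simps)
  also have "\<dots> \<le> (\<Sum>k<r. a k * (1 - g k)) - (\<Sum>k=r..<n. a k * g k)"
    using r anti g by (intro diff_mono sum_mono mult_right_mono) auto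
  also have "\<dots> = (\<Sum>k<n. a k * (1 - g k)) - (\<Sum>k=r..<n. a k)"
    by (simp add: split sum_subtractf algebra_simps)
  finally show ?thesis by simp
qed

text \<open>Only the column space of \<open>B\<close>, of dimension at most \<open>r\<close>,
  matters. If \<open>g j\<close> is the squared length of the projection of \<open>w j\<close> onto
  it, then \<open>B\<close> can cancel at most the fraction \<open>g j\<close> of the square of
  \<open>lam j\<close>, and the \<open>g j\<close> sum to at most \<open>r\<close>.\<close>

lemma eckart_young_lower:
  fixes M B :: "nat \<Rightarrow> nat \<Rightarrow> real" and \<phi> \<psi> :: "'t \<Rightarrow> nat \<Rightarrow> real"
  assumes on: "orthonormal n w"
    and Mw: "\<And>k i. k < n \<Longrightarrow> i < n \<Longrightarrow> mat_app n M (w k) i = lam k * w k i"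
    and anti: "\<And>k l. k \<le> l \<Longrightarrow> l < n \<Longrightarrow> \<bar>lam l\<bar> \<le> \<bar>lam k\<bar>"
    and I: "finite I" "card I \<le> r" "r \<le> n"
    and B: "\<And>i j. i < n \<Longrightarrow> j < n \<Longrightarrow> B i j = (\<Sum>t\<in>I. \<phi> t i * \<psi> t j)"
  shows "(\<Sum>i=r..<n. (lam i)\<^sup>2) \<le> (\<Sum>i<n. \<Sum>j<n. (M i j - B i j)\<^sup>2)"
proof -
  define m where "m = card I"
  obtain h where h: "bij_betw h {..<m} I"
    using ex_bij_betw_nat_finite[OF I(1)] by (auto simp: m_def atLeast0LessThan)
  obtain q where q: "orthonormal0 n q {..<m}"
    and pq: "\<And>k i. k < m \<Longrightarrow> i < n \<Longrightarrow> \<phi> (h k) i = (\<Sum>l\<le>k. dotp n (q l) (\<phi> (h k)) * q l i)"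
    using gram_schmidt[of n m "\<lambda>k. \<phi> (h k)"] by blast
  define g where "g j = (\<Sum>l<m. (dotp n (q l) (w j))\<^sup>2)" for j
  have ww: "sqnorm n (w j) = 1" if "j < n" for j using on that by (simp add: orthonormal_def)
  have g1: "g j \<le> 1" if "j < n" for j
    using bessel_inequality[OF _ q, of "w j"] ww[OF that] by (simp add: g_def)
  have "(\<Sum>j<n. g j) = (\<Sum>l<m. \<Sum>j<n. (dotp n (w j) (q l))\<^sup>2)"
    unfolding g_def by (subst sum.swap) (simp add: dotp_commute)
  also have "\<dots> = (\<Sum>l<m. sqnorm n (q l))" by (simp add: parseval[OF on])
  also have "\<dots> \<le> (\<Sum>l<m. 1)"
  proof (intro sum_mono)
    fix l assume "l \<in> {..<m}"
    then have "sqnorm n (q l) = 1 \<or> sqnorm n (q l) = 0"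
      using q unfolding orthonormal0_def dotp_self_eq_0_iff by blast
    then show "sqnorm n (q l) \<le> 1" by auto
  qed
  finally have sum_g: "(\<Sum>j<n. g j) \<le> real r" using I(2) by (simp add: m_def)
  define N where "N i j = M i j - B i j" for i j
  have key: "(lam j)\<^sup>2 * (1 - g j) \<le> sqnorm n (mat_app n N (w j))" if j: "j < n" for j
  proof -
    define v where "v k = w j k - (\<Sum>l<m. dotp n (q l) (w j) * q l k)" for k
    have v: "v = (\<lambda>k. w j k - (\<Sum>l<m. dotp n (q l) (w j) * q l k))" by (auto simp: v_def)
    have vq: "dotp n v (q l) = 0" if "l < m" for l
      using orthonormal0_residual_orth[OF _ q, of l "w j"] that unfolding v by (simp add: dotp_commute)
    have vv: "sqnorm n v = 1 - g j"
      using orthonormal0_residual_norm[OF _ q, of "w j"] ww[OF j] unfolding v g_def by simp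
    have vw: "dotp n v (w j) = 1 - g j"
      using orthonormal0_residual_dotp[OF _ q, of "w j"] vv unfolding v by simp
    have v\<phi>: "dotp n v (\<phi> t) = 0" if "t \<in> I" for t
    proof -
      from h that obtain k where k: "k < m" "t = h k" by (auto simp: bij_betw_def)
      have "dotp n v (\<phi> (h k)) = (\<Sum>l\<le>k. dotp n (q l) (\<phi> (h k)) * dotp n v (q l))"
        by (rule dotp_linear_combination) (rule pq[OF k(1)])
      then show ?thesis using k vq by simp
    qed
    have "mat_app n N (w j) i = lam j * w j i - (\<Sum>t\<in>I. dotp n (\<psi> t) (w j) * \<phi> t i)" if i: "i < n" for i
    proof -
      have "mat_app n N (w j) i = mat_app n M (w j) i - (\<Sum>l<n. (\<Sum>t\<in>I. \<phi> t i * \<psi> t l) * w j l)"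
        using i by (simp add: mat_app_def N_def B algebra_simps sum_subtractf)
      also have "(\<Sum>l<n. (\<Sum>t\<in>I. \<phi> t i * \<psi> t l) * w j l) = (\<Sum>t\<in>I. dotp n (\<psi> t) (w j) * \<phi> t i)"
        unfolding sum_distrib_right dotp_def by (subst sum.swap) (simp add: mult.commute mult.left_commute)
      finally show ?thesis using Mw[OF j i] by simp
    qed
    then have "dotp n v (mat_app n N (w j)) = dotp n v (\<lambda>i. lam j * w j i - (\<Sum>t\<in>I. dotp n (\<psi> t) (w j) * \<phi> t i))"
      by (intro dotp_cong) auto
    also have "\<dots> = lam j * (1 - g j)"
      by (simp add: dotp_diff_right dotp_scale_right dotp_sum_right v\<phi> vw)
    \<comment> \<open>Cauchy-Schwarz against \<open>v\<close>, whose squared length is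
      \<open>1 - g j\<close>. This factor is then cancelled, except when \<open>g j = 1\<close>,
      where the claim is trivial.\<close>
    finally have "(lam j * (1 - g j))\<^sup>2 \<le> (1 - g j) * sqnorm n (mat_app n N (w j))"
      using dotp_Cauchy_Schwarz[of n v "mat_app n N (w j)"] vv by simp
    then have "(1 - g j) * ((lam j)\<^sup>2 * (1 - g j)) \<le> (1 - g j) * sqnorm n (mat_app n N (w j))"
      by (simp add: power2_eq_square algebra_simps)
    then show ?thesis using g1[OF j] dotp_self_nonneg[of n "mat_app n N (w j)"]
      by (cases "g j = 1") (auto simp: mult_le_cancel_left)
  qed
  have "(\<Sum>i=r..<n. (lam i)\<^sup>2) \<le> (\<Sum>j<n. (lam j)\<^sup>2 * (1 - g j))"
    using I(3) g1 sum_g anti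
    by (intro sum_antitone_weights) (auto simp: g_def sum_nonneg abs_le_square_iff[symmetric])
  also have "\<dots> \<le> (\<Sum>j<n. sqnorm n (mat_app n N (w j)))"
    using key by (intro sum_mono) auto
  also have "\<dots> = (\<Sum>i<n. \<Sum>j<n. (M i j - B i j)\<^sup>2)"
    by (simp add: frobenius_parseval[OF on] N_def)
  finally show ?thesis .
qed

lemma sum_square_add_le: "((x::real) + y)\<^sup>2 \<le> 2 * x\<^sup>2 + 2 * y\<^sup>2"
  using sum_squares_ge_zero[of "x - y" 0] by (simp add: power2_eq_square algebra_simps)

text \<open>Measured in the basis \<open>u\<close>, the error is pure noise on a kept direction and
  pure signal on a discarded one. Noise of norm at most \<open>\<tau> / 2\<close> bounds both the
  number of kept directions and the signal that can be discarded. Left and right singular vectors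
  stay distinct, since the decomposition of a symmetric matrix need not use eigenvectors.\<close>

lemma sv_threshold_error:
  fixes A M :: "nat \<Rightarrow> nat \<Rightarrow> real"
  assumes u: "orthonormal n u" and v: "orthonormal n v" and w: "orthonormal n w"
    and A: "\<And>i j. i < n \<Longrightarrow> j < n \<Longrightarrow> A i j = (\<Sum>k<n. s k * u k i * v k j)"
    and Asym: "\<And>i j. i < n \<Longrightarrow> j < n \<Longrightarrow> A i j = A j i"
    and Msym: "\<And>i j. i < n \<Longrightarrow> j < n \<Longrightarrow> M i j = M j i"
    and s: "\<And>k. k < n \<Longrightarrow> 0 \<le> s k"
    and Mw: "\<And>k i. k < n \<Longrightarrow> i < n \<Longrightarrow> mat_app n M (w k) i = lam k * w k i"
    and \<tau>: "0 < \<tau>"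
    and E: "\<And>x. sqnorm n (mat_app n (\<lambda>i j. A i j - \<rho> * M i j) x)
              \<le> (\<tau> / 2)\<^sup>2 * sqnorm n x"
    and R: "R \<le> n"
  shows "(\<Sum>i<n. \<Sum>j<n. ((\<Sum>k | k < n \<and> \<tau> \<le> s k. s k * u k i * v k j) - \<rho> * M i j)\<^sup>2)
    \<le> 3 * real R * \<tau>\<^sup>2 + 2 * \<rho>\<^sup>2 * (\<Sum>j=R..<n. (lam j)\<^sup>2)"
proof -
  define J where "J = {k. k < n \<and> \<tau> \<le> s k}"
  define J' where "J' = {k. k < n \<and> \<not> \<tau> \<le> s k}"
  have J: "finite J" "J \<subseteq> {..<n}" "finite J'" "J' \<subseteq> {..<n}" "{..<n} = J \<union> J'" "J \<inter> J' = {}"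
    by (auto simp: J_def J'_def)
  have splitJ: "(\<Sum>k<n. f k) = (\<Sum>k\<in>J. f k) + (\<Sum>k\<in>J'. f k)" for f :: "nat \<Rightarrow> real"
    unfolding J(5) by (rule sum.union_disjoint) (use J in auto)
  have splitR: "(\<Sum>k<n. f k) = (\<Sum>k<R. f k) + (\<Sum>k=R..<n. f k)" for f :: "nat \<Rightarrow> real"
    using R by (simp add: lessThan_atLeast0 sum.atLeastLessThan_concat)
  define T where "T = (\<Sum>j=R..<n. (lam j)\<^sup>2)"
  define F where "F i j = A i j - \<rho> * M i j" for i j
  have EF: "sqnorm n (mat_app n F x) \<le> \<tau>\<^sup>2 / 4 * sqnorm n x" for x
    using E[of x] by (simp add: F_def[abs_def] power_divide)
  have unit: "sqnorm n (u k) = 1" "sqnorm n (v k) = 1" "sqnorm n (w k) = 1" if "k < n" for k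
    using u v w that by (auto simp: orthonormal_def)
  have Av: "mat_app n A (v k) i = s k * u k i" if "k < n" "i < n" for k i
  proof -
    have "mat_app n A (v k) i = (\<Sum>j<n. \<Sum>l<n. s l * u l i * (v l j * v k j))"
      using that by (simp add: mat_app_def A sum_distrib_right mult.assoc)
    also have "\<dots> = (\<Sum>l<n. s l * u l i * dotp n (v l) (v k))"
      by (subst sum.swap) (simp add: dotp_def sum_distrib_left)
    also have "\<dots> = (\<Sum>l<n. if l = k then s l * u l i else 0)"
      using v that by (intro sum.cong) (auto simp: orthonormal_def)
    finally show ?thesis using that by simp
  qed
  have AtJ: "(\<Sum>j<n. (\<Sum>l\<in>J. s l * u l j * v l i) * u k j) = (if k \<in> J then s k * v k i else 0)"
    if "k < n" "i < n" for k i
  proof -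
    have "(\<Sum>j<n. (\<Sum>l\<in>J. s l * u l j * v l i) * u k j) = (\<Sum>l\<in>J. s l * v l i * dotp n (u l) (u k))"
      unfolding dotp_def sum_distrib_right sum_distrib_left
      by (subst sum.swap) (simp add: mult.commute mult.left_commute)
    also have "\<dots> = (\<Sum>l\<in>J. if l = k then s l * v l i else 0)"
      using u that J by (intro sum.cong) (auto simp: orthonormal_def)
    finally show ?thesis using J by simp
  qed
  \<comment> \<open>By symmetry \<open>A\<close> exchanges \<open>u k\<close> and \<open>v k\<close>
    up to the factor \<open>s k\<close>.\<close>
  have Au: "mat_app n A (u k) i = s k * v k i" if "k < n" "i < n" for k i
  proof -
    have "mat_app n A (u k) i = (\<Sum>j<n. A j i * u k j)"
      using that Asym[of i] by (simp add: mat_app_def)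
    also have "\<dots> = (\<Sum>j<n. \<Sum>l<n. s l * v l i * (u l j * u k j))"
    proof (intro sum.cong refl)
      fix j assume "j \<in> {..<n}"
      then show "A j i * u k j = (\<Sum>l<n. s l * v l i * (u l j * u k j))"
        unfolding A[of j i, OF _ that(2)] sum_distrib_right
        by (subst A) (auto simp: that sum_distrib_right intro!: sum.cong)
    qed
    also have "\<dots> = (\<Sum>l<n. s l * v l i * dotp n (u l) (u k))"
      by (subst sum.swap) (simp add: dotp_def sum_distrib_left)
    also have "\<dots> = (\<Sum>l<n. if l = k then s l * v l i else 0)"
      using u that by (intro sum.cong) (auto simp: orthonormal_def)
    finally show ?thesis using that by simp
  qed
  have adjM: "dotp n x (mat_app n M y) = dotp n (mat_app n M x) y" for x y
    unfolding dotp_mat_app using Msym by (intro dotp_cong) (auto simp: mat_app_def)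
  have adjA: "dotp n x (mat_app n A y) = dotp n (mat_app n A x) y" for x y
    unfolding dotp_mat_app using Asym by (intro dotp_cong) (auto simp: mat_app_def)
  have Fx: "mat_app n F x = (\<lambda>i. mat_app n A x i - \<rho> * mat_app n M x i)" for x
    by (simp add: mat_app_def F_def algebra_simps sum_subtractf sum_distrib_left)
  have wM: "dotp n (w j) (mat_app n M x) = lam j * dotp n (w j) x" if "j < n" for j x
  proof -
    have "dotp n (mat_app n M (w j)) x = dotp n (\<lambda>i. lam j * w j i) x"
      using Mw that by (intro dotp_cong) auto
    then show ?thesis by (simp add: adjM dotp_scale_left)
  qed
  have wAu: "dotp n (w j) (mat_app n A (u k)) = s k * dotp n (w j) (v k)" if "k < n" for j k
    unfolding dotp_scale_right[symmetric] using Au that by (intro dotp_cong) auto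
  have wAv: "dotp n (w j) (mat_app n A (v k)) = s k * dotp n (w j) (u k)" if "k < n" for j k
    unfolding dotp_scale_right[symmetric] using Av that by (intro dotp_cong) auto
  have on0: "orthonormal0 n u J'" "orthonormal0 n v J'" "orthonormal0 n v J" "orthonormal0 n w {..<R}"
     "orthonormal0 n w {R..<n}" "orthonormal0 n u J"
    using u v w J R by (auto intro!: orthonormal_imp_orthonormal0)
  have low: "(\<Sum>k\<in>J. (dotp n (w j) (u k))\<^sup>2) \<le> 1" "(\<Sum>k\<in>J'. (dotp n (w j) (u k))\<^sup>2) \<le> 1"
    "(\<Sum>k\<in>J'. (dotp n (w j) (v k))\<^sup>2) \<le> 1" "(\<Sum>k\<in>J. (dotp n (w j) (v k))\<^sup>2) \<le> 1" if "j < n" for j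
    using bessel_inequality[OF J(1) on0(6), of "w j"] bessel_inequality[OF J(3) on0(1), of "w j"]
      bessel_inequality[OF J(3) on0(2), of "w j"] bessel_inequality[OF J(1) on0(3), of "w j"] unit(3)[OF that]
    by (simp_all add: dotp_commute)
  \<comment> \<open>For kept \<open>k\<close>, \<open>A\<close> maps \<open>v k\<close> to a vector
    of length at least \<open>\<tau>\<close>. Its part outside the first \<open>R\<close>
    eigenvectors of \<open>M\<close> comes from the spectral tail and the noise, and the noise
    accounts for at most half of \<open>\<tau>\<^sup>2\<close>. The first \<open>R\<close>
    directions absorb a total of at most \<open>R\<close> from the unit vectors
    \<open>u k\<close>.\<close>
  have cardJ: "real (card J) * \<tau>\<^sup>2 \<le> 2 * real R * \<tau>\<^sup>2 + 4 * \<rho>\<^sup>2 * T"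
  proof -
    define a where "a k = (\<Sum>j=R..<n. (dotp n (w j) (u k))\<^sup>2)" for k
    have a1: "\<tau>\<^sup>2 * a k \<le> 2 * \<rho>\<^sup>2 * (\<Sum>j=R..<n. (lam j)\<^sup>2 * (dotp n (w j) (v k))\<^sup>2) + \<tau>\<^sup>2 / 2"
      if k: "k \<in> J" for k
    proof -
      have kn: "k < n" "\<tau> \<le> s k" using k by (auto simp: J_def)
      have "\<tau>\<^sup>2 * a k \<le> (s k)\<^sup>2 * a k"
        using kn \<tau> by (intro mult_right_mono power_mono) (auto simp: a_def sum_nonneg)
      also have "\<dots> = (\<Sum>j=R..<n. (\<rho> * lam j * dotp n (w j) (v k) + dotp n (w j) (mat_app n F (v k)))\<^sup>2)"
        unfolding a_def sum_distrib_left
        by (intro sum.cong refl)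
          (simp add: Fx dotp_diff_right dotp_scale_right wM wAv[OF kn(1)] power_mult_distrib)
      also have "\<dots> \<le> (\<Sum>j=R..<n. 2 * (\<rho> * lam j * dotp n (w j) (v k))\<^sup>2 + 2 * (dotp n (w j) (mat_app n F (v k)))\<^sup>2)"
        by (intro sum_mono sum_square_add_le)
      also have "\<dots> = 2 * \<rho>\<^sup>2 * (\<Sum>j=R..<n. (lam j)\<^sup>2 * (dotp n (w j) (v k))\<^sup>2)
          + 2 * (\<Sum>j=R..<n. (dotp n (w j) (mat_app n F (v k)))\<^sup>2)"
        by (simp add: sum.distrib sum_distrib_left power_mult_distrib mult.assoc)
      also have "(\<Sum>j=R..<n. (dotp n (w j) (mat_app n F (v k)))\<^sup>2) \<le> \<tau>\<^sup>2 / 4"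
        using bessel_inequality[OF _ on0(5), of "mat_app n F (v k)"] EF[of "v k"] unit(2)[OF kn(1)] by simp
      finally show ?thesis by simp
    qed
    have "real (card J) - real R \<le> (\<Sum>k\<in>J. a k)"
    proof -
      have "a k = 1 - (\<Sum>j<R. (dotp n (w j) (u k))\<^sup>2)" if "k \<in> J" for k
      proof -
        have "k < n" using that J(2) by auto
        then show ?thesis using parseval[OF w, of "u k"] unit(1)[of k] splitR by (simp add: a_def)
      qed
      then have "(\<Sum>k\<in>J. a k) = real (card J) - (\<Sum>k\<in>J. \<Sum>j<R. (dotp n (w j) (u k))\<^sup>2)"
        by (simp add: sum_subtractf)
      moreover have "(\<Sum>k\<in>J. \<Sum>j<R. (dotp n (w j) (u k))\<^sup>2) \<le> (\<Sum>j<R. 1)"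
        by (subst sum.swap) (use low(1) R in \<open>intro sum_mono, auto\<close>)
      ultimately show ?thesis by simp
    qed
    then have "\<tau>\<^sup>2 * (real (card J) - real R) \<le> (\<Sum>k\<in>J. \<tau>\<^sup>2 * a k)"
      by (simp add: sum_distrib_left[symmetric] mult_left_mono)
    also have "\<dots> \<le> (\<Sum>k\<in>J. 2 * \<rho>\<^sup>2 * (\<Sum>j=R..<n. (lam j)\<^sup>2 * (dotp n (w j) (v k))\<^sup>2) + \<tau>\<^sup>2 / 2)"
      by (intro sum_mono a1)
    also have "\<dots> = 2 * \<rho>\<^sup>2 * (\<Sum>k\<in>J. \<Sum>j=R..<n. (lam j)\<^sup>2 * (dotp n (w j) (v k))\<^sup>2) + real (card J) * \<tau>\<^sup>2 / 2"
      by (simp add: sum.distrib sum_distrib_left[symmetric])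
    finally have 1: "\<tau>\<^sup>2 * (real (card J) - real R) \<le>
      2 * \<rho>\<^sup>2 * (\<Sum>k\<in>J. \<Sum>j=R..<n. (lam j)\<^sup>2 * (dotp n (w j) (v k))\<^sup>2) + real (card J) * \<tau>\<^sup>2 / 2" .
    have "(\<Sum>k\<in>J. \<Sum>j=R..<n. (lam j)\<^sup>2 * (dotp n (w j) (v k))\<^sup>2)
        = (\<Sum>j=R..<n. (lam j)\<^sup>2 * (\<Sum>k\<in>J. (dotp n (w j) (v k))\<^sup>2))"
      by (subst sum.swap) (simp add: sum_distrib_left)
    also have "\<dots> \<le> (\<Sum>j=R..<n. (lam j)\<^sup>2 * 1)"
      using low(4) by (intro sum_mono mult_left_mono) auto
    finally have "2 * \<rho>\<^sup>2 * (\<Sum>k\<in>J. \<Sum>j=R..<n. (lam j)\<^sup>2 * (dotp n (w j) (v k))\<^sup>2) \<le> 2 * \<rho>\<^sup>2 * T"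
      by (intro mult_left_mono) (auto simp: T_def)
    with 1 show ?thesis by (simp add: algebra_simps)
  qed
  let ?m = "\<lambda>j k. \<rho> * lam j * dotp n (w j) (u k)"
  define D where "D i j = (\<Sum>k\<in>J. s k * u k i * v k j) - \<rho> * M i j" for i j
  let ?Dt = "mat_app n (\<lambda>i j. D j i)"
  have Dt: "?Dt (u k) i = (if k \<in> J then s k * v k i else 0) - \<rho> * mat_app n M (u k) i" if "k < n" "i < n" for k i
  proof -
    have "?Dt (u k) i = (\<Sum>j<n. (\<Sum>l\<in>J. s l * u l j * v l i) * u k j) - \<rho> * (\<Sum>j<n. M j i * u k j)"
      by (simp add: mat_app_def D_def algebra_simps sum_subtractf sum_distrib_left)
    also have "(\<Sum>j<n. M j i * u k j) = mat_app n M (u k) i"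
      using Msym[of i] that by (simp add: mat_app_def)
    finally show ?thesis using AtJ[OF that] by simp
  qed
  have "(\<Sum>i<n. \<Sum>j<n. (D i j)\<^sup>2) = (\<Sum>i<n. \<Sum>j<n. (D j i)\<^sup>2)" by (rule sum.swap)
  also have "\<dots> = (\<Sum>k<n. sqnorm n (?Dt (u k)))" by (rule frobenius_parseval[OF u, symmetric])
  also have "\<dots> = (\<Sum>k\<in>J. sqnorm n (?Dt (u k))) + (\<Sum>k\<in>J'. sqnorm n (?Dt (u k)))"
    by (rule splitJ)
  finally have decomp: "(\<Sum>i<n. \<Sum>j<n. (D i j)\<^sup>2) = \<dots>" .
  \<comment> \<open>On a kept direction \<open>s k * v k\<close> is the image of \<open>u k\<close>
    under \<open>A\<close>, so the transposed error acts as the noise \<open>F\<close>.\<close>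
  have "(\<Sum>k\<in>J. sqnorm n (?Dt (u k))) \<le> (\<Sum>k\<in>J. \<tau>\<^sup>2 / 4)"
  proof (intro sum_mono)
    fix k assume k: "k \<in> J"
    then have kn: "k < n" using J by auto
    have "sqnorm n (?Dt (u k)) = sqnorm n (mat_app n F (u k))"
      using Dt[OF kn] k kn Au by (intro dotp_cong) (auto simp: Fx)
    then show "sqnorm n (?Dt (u k)) \<le> \<tau>\<^sup>2 / 4" using EF[of "u k"] unit(1)[OF kn] by simp
  qed
  then have part1: "(\<Sum>k\<in>J. sqnorm n (?Dt (u k))) \<le> real (card J) * \<tau>\<^sup>2 / 4" by simp
  have "(\<Sum>k\<in>J'. sqnorm n (?Dt (u k))) = (\<Sum>k\<in>J'. \<rho>\<^sup>2 * sqnorm n (mat_app n M (u k)))"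
  proof (intro sum.cong refl)
    fix k assume k: "k \<in> J'"
    then have kn: "k < n" "k \<notin> J" using J by auto
    have "sqnorm n (?Dt (u k)) = sqnorm n (\<lambda>i. - \<rho> * mat_app n M (u k) i)"
      using Dt[OF kn(1)] kn by (intro dotp_cong) auto
    then show "sqnorm n (?Dt (u k)) = \<rho>\<^sup>2 * sqnorm n (mat_app n M (u k))"
      unfolding dotp_scale_right dotp_scale_left by (simp add: power2_eq_square)
  qed
  also have "\<dots> = (\<Sum>k\<in>J'. \<Sum>j<n. (?m j k)\<^sup>2)"
    by (simp add: parseval[OF w, symmetric] wM sum_distrib_left power_mult_distrib mult.assoc)
  also have "\<dots> = (\<Sum>j<n. \<Sum>k\<in>J'. (?m j k)\<^sup>2)" by (rule sum.swap)
  also have "\<dots> = (\<Sum>j<R. \<Sum>k\<in>J'. (?m j k)\<^sup>2)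
      + (\<Sum>j=R..<n. \<Sum>k\<in>J'. (?m j k)\<^sup>2)" by (rule splitR)
  \<comment> \<open>On each of the first \<open>R\<close> eigenvectors the signal is rewritten as
    \<open>A\<close> minus noise: singular values below the threshold give
    \<open>2 * \<tau>\<^sup>2\<close>, the noise gives \<open>\<tau>\<^sup>2 / 2\<close>. The
    remaining eigenvectors are charged to the tail.\<close>
  also have "\<dots> \<le> (\<Sum>j<R. 5 / 2 * \<tau>\<^sup>2) + (\<Sum>j=R..<n. \<rho>\<^sup>2 * (lam j)\<^sup>2)"
  proof (intro add_mono sum_mono)
    fix j assume "j \<in> {R..<n}"
    then have jn: "j < n" by simp
    have "(\<Sum>k\<in>J'. (?m j k)\<^sup>2) = (\<rho> * lam j)\<^sup>2 * (\<Sum>k\<in>J'. (dotp n (w j) (u k))\<^sup>2)"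
      by (simp add: sum_distrib_left power_mult_distrib)
    also have "\<dots> \<le> (\<rho> * lam j)\<^sup>2 * 1" by (intro mult_left_mono low jn) simp
    finally show "(\<Sum>k\<in>J'. (?m j k)\<^sup>2) \<le> \<rho>\<^sup>2 * (lam j)\<^sup>2"
      by (simp add: power_mult_distrib)
  next
    fix j assume "j \<in> {..<R}"
    then have jn: "j < n" using R by simp
    have "(\<Sum>k\<in>J'. (?m j k)\<^sup>2)
        \<le> (\<Sum>k\<in>J'. 2 * (\<tau>\<^sup>2 * (dotp n (w j) (v k))\<^sup>2) + 2 * (dotp n (mat_app n F (w j)) (u k))\<^sup>2)"
    proof (intro sum_mono)
      fix k assume k: "k \<in> J'"
      then have kn: "k < n" "s k \<le> \<tau>" by (auto simp: J'_def)
      have "dotp n (mat_app n F (w j)) (u k) = dotp n (w j) (mat_app n A (u k)) - \<rho> * dotp n (w j) (mat_app n M (u k))"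
        by (simp add: Fx dotp_diff_left dotp_scale_left adjA adjM)
      then have "?m j k = s k * dotp n (w j) (v k) + - dotp n (mat_app n F (w j)) (u k)"
        by (simp add: wAu[OF kn(1)] wM[OF jn])
      then have "(?m j k)\<^sup>2 \<le>
          2 * (s k * dotp n (w j) (v k))\<^sup>2 + 2 * (- dotp n (mat_app n F (w j)) (u k))\<^sup>2"
        by (metis sum_square_add_le)
      also have "(s k * dotp n (w j) (v k))\<^sup>2 \<le> \<tau>\<^sup>2 * (dotp n (w j) (v k))\<^sup>2"
        unfolding power_mult_distrib using kn s by (intro mult_right_mono power_mono) auto
      finally show "(?m j k)\<^sup>2 \<le>
          2 * (\<tau>\<^sup>2 * (dotp n (w j) (v k))\<^sup>2) + 2 * (dotp n (mat_app n F (w j)) (u k))\<^sup>2" by simp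
    qed
    also have "\<dots> = 2 * \<tau>\<^sup>2 * (\<Sum>k\<in>J'. (dotp n (w j) (v k))\<^sup>2) + 2 * (\<Sum>k\<in>J'. (dotp n (u k) (mat_app n F (w j)))\<^sup>2)"
      by (simp add: sum.distrib sum_distrib_left mult.assoc dotp_commute)
    also have "\<dots> \<le> 2 * \<tau>\<^sup>2 * 1 + 2 * (\<tau>\<^sup>2 / 4)"
    proof (intro add_mono mult_left_mono)
      show "(\<Sum>k\<in>J'. (dotp n (u k) (mat_app n F (w j)))\<^sup>2) \<le> \<tau>\<^sup>2 / 4"
        using bessel_inequality[OF J(3) on0(1), of "mat_app n F (w j)"] EF[of "w j"] unit(3)[OF jn] by simp
    qed (use low(3)[OF jn] in auto)
    finally show "(\<Sum>k\<in>J'. (?m j k)\<^sup>2) \<le> 5 / 2 * \<tau>\<^sup>2" by simp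
  qed
  finally have part2: "(\<Sum>k\<in>J'. sqnorm n (?Dt (u k))) \<le> 5 / 2 * real R * \<tau>\<^sup>2 + \<rho>\<^sup>2 * T"
    by (simp add: T_def sum_distrib_left)
  have "(\<Sum>i<n. \<Sum>j<n. (D i j)\<^sup>2) \<le> 3 * real R * \<tau>\<^sup>2 + 2 * \<rho>\<^sup>2 * T"
    using decomp part1 part2 cardJ by simp
  then show ?thesis by (simp add: D_def J_def T_def)
qed

section \<open>Low-rank approximation of analytic kernels\<close>

no_notation vec_index (infixl "$" 100)

text \<open>Exponents outside \<open>S\<close> are pinned to 0, so a Taylor expansion can be built
  by inserting one coordinate at a time. Bounding each exponent instead of their sum makes the set a
  product.\<close>

definition multi_indices :: "'d set \<Rightarrow> nat \<Rightarrow> ('d \<Rightarrow> nat) set" where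
  "multi_indices S l = {\<kappa>. (\<forall>i\<in>S. \<kappa> i < l) \<and> (\<forall>i. i \<notin> S \<longrightarrow> \<kappa> i = 0)}"

lemma multi_indices_UNIV: "multi_indices (UNIV :: 'd::finite set) l = PiE UNIV (\<lambda>_. {..<l})"
  by (auto simp: multi_indices_def)

lemma card_multi_indices: "card (multi_indices (UNIV :: 'd::finite set) l) = l ^ CARD('d)"
  by (simp add: multi_indices_UNIV card_PiE)

lemma finite_multi_indices: "finite (multi_indices (S :: 'd::finite set) l)"
proof -
  have "multi_indices S l \<subseteq> multi_indices UNIV (Suc l)"
    by (auto simp: multi_indices_def) (metis less_Suc_eq zero_less_Suc)
  then show ?thesis by (rule finite_subset) (simp add: multi_indices_UNIV finite_PiE)
qed

lemma sum_multi_indices_insert: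
  fixes F :: "('d::finite \<Rightarrow> nat) \<Rightarrow> real"
  assumes "s \<notin> S"
  shows "(\<Sum>\<kappa>\<in>multi_indices (insert s S) l. F \<kappa>) = (\<Sum>\<kappa>\<in>multi_indices S l. \<Sum>k<l. F (\<kappa>(s := k)))"
proof -
  have "(\<Sum>\<kappa>\<in>multi_indices S l. \<Sum>k<l. F (\<kappa>(s := k))) =
      (\<Sum>(\<kappa>, k)\<in>multi_indices S l \<times> {..<l}. F (\<kappa>(s := k)))"
    by (rule sum.cartesian_product)
  also have "\<dots> = (\<Sum>\<kappa>\<in>multi_indices (insert s S) l. F \<kappa>)"
    by (rule sum.reindex_bij_witness[where i = "\<lambda>\<kappa>. (\<kappa>(s := 0), \<kappa> s)" and j = "\<lambda>(\<kappa>, k). \<kappa>(s := k)"])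
      (use assms in \<open>auto simp: multi_indices_def fun_eq_iff\<close>)
  finally show ?thesis by simp
qed

lemma prod_fun_upd_zero:
  fixes h :: "'d::finite \<Rightarrow> nat \<Rightarrow> real"
  assumes "\<kappa> s = 0" "h s 0 = 1"
  shows "(\<Prod>i\<in>UNIV. h i ((\<kappa>(s := k)) i)) = h s k * (\<Prod>i\<in>UNIV. h i (\<kappa> i))"
proof -
  have "(\<Prod>i\<in>UNIV. h i ((\<kappa>(s := k)) i)) = h s k * (\<Prod>i\<in>UNIV - {s}. h i (\<kappa> i))"
    by (subst prod.remove[of _ s]) auto
  moreover have "(\<Prod>i\<in>UNIV. h i (\<kappa> i)) = (\<Prod>i\<in>UNIV - {s}. h i (\<kappa> i))"
    by (subst prod.remove[of _ s]) (use assms in auto)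
  ultimately show ?thesis by simp
qed

lemma sum_quarter_powers_le: "(\<Sum>k<l. (1 / 4 :: real) ^ k) \<le> 2"
proof -
  have "(\<Sum>k<l. (1 / 4 :: real) ^ k) = 4 / 3 * (1 - (1 / 4) ^ l)"
    by (simp add: sum_gp_strict)
  also have "\<dots> \<le> 4 / 3 * 1" by (intro mult_left_mono) auto
  finally show ?thesis by simp
qed

text \<open>The sum factorises over the coordinates in \<open>S\<close> into geometric sums, each at
  most 2.\<close>

lemma sum_multi_indices_quarter_le:
  "(\<Sum>\<kappa>\<in>multi_indices (S :: 'd::finite set) l. \<Prod>i\<in>UNIV. (1 / 4 :: real) ^ \<kappa> i) \<le> 2 ^ card S"
proof (induction S rule: finite_induct[OF finite])
  case 1
  have "multi_indices ({} :: 'd set) l = {\<lambda>_. 0}" by (auto simp: multi_indices_def)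
  then show ?case by simp
next
  case (2 s S)
  have "(\<Sum>\<kappa>\<in>multi_indices (insert s S) l. \<Prod>i\<in>UNIV. (1 / 4 :: real) ^ \<kappa> i) =
    (\<Sum>\<kappa>\<in>multi_indices S l. \<Sum>k<l. (1 / 4) ^ k * (\<Prod>i\<in>UNIV. (1 / 4) ^ \<kappa> i))"
    unfolding sum_multi_indices_insert[OF 2(2)]
    by (intro sum.cong refl prod_fun_upd_zero[where h = "\<lambda>_ k. (1 / 4) ^ k"])
      (use 2(2) in \<open>auto simp: multi_indices_def\<close>)
  also have "\<dots> = (\<Sum>\<kappa>\<in>multi_indices S l. \<Prod>i\<in>UNIV. (1 / 4) ^ \<kappa> i) * (\<Sum>k<l. (1 / 4) ^ k)"
    by (simp add: sum_distrib_left sum_distrib_right mult.commute)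
  also have "\<dots> \<le> 2 ^ card S * 2"
    by (intro mult_mono 2(3) sum_quarter_powers_le sum_nonneg) auto
  finally show ?case using 2 by simp
qed

text \<open>Absorbs the factor \<open>l\<close> that remains when \<open>fact l\<close> from the
  derivative bound meets \<open>fact (l - 1)\<close> from the Taylor remainder.\<close>

lemma nat_quarter_power_le: "real l * (1 / 4) ^ l \<le> (1 / 2) ^ l"
proof -
  have "real l \<le> 2 ^ l" using less_exp[of l] by (metis less_imp_le of_nat_le_iff of_nat_numeral of_nat_power)
  then have "real l * (1 / 4) ^ l \<le> 2 ^ l * (1 / 4) ^ l" by (intro mult_right_mono) auto
  also have "\<dots> = (1 / 2) ^ l" by (simp add: power_mult_distrib[symmetric])
  finally show ?thesis .
qed

text \<open>The definition gives derivatives at \<open>h = 0\<close> from a moving base point. The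
  shift by \<open>t\<close> turns them into derivatives of one function along a whole coordinate
  line, as the one-variable Taylor theorem requires.\<close>

lemma mixed_partials_coordinate_derivative:
  assumes D: "mixed_partials g D" and t: "y + t *\<^sub>R axis s 1 \<in> unit_cube"
  shows "((\<lambda>t. D \<kappa> (y + t *\<^sub>R axis s 1)) has_real_derivative D (\<kappa>(s := Suc (\<kappa> s))) (y + t *\<^sub>R axis s 1))
    (at t within {t. y + t *\<^sub>R axis s 1 \<in> unit_cube})"
proof -
  let ?z = "y + t *\<^sub>R axis s 1"
  let ?S = "{t. y + t *\<^sub>R axis s 1 \<in> unit_cube}"
  have img: "(\<lambda>u. u - t) ` ?S = {h. ?z + h *\<^sub>R axis s 1 \<in> unit_cube}"
  proof (intro equalityI subsetI)
    fix h assume "h \<in> {h. ?z + h *\<^sub>R axis s 1 \<in> unit_cube}"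
    then have "t + h \<in> ?S" by (simp add: scaleR_add_left add.assoc)
    then show "h \<in> (\<lambda>u. u - t) ` ?S" by (intro image_eqI[of _ _ "t + h"]) simp_all
  qed (auto simp: scaleR_left_diff_distrib)
  have "((\<lambda>h. D \<kappa> (?z + h *\<^sub>R axis s 1)) has_real_derivative D (\<kappa>(s := Suc (\<kappa> s))) ?z)
      (at ((\<lambda>u. u - t) t) within (\<lambda>u. u - t) ` ?S)"
    using D t unfolding img mixed_partials_def by simp
  moreover have "((\<lambda>u. u - t) has_real_derivative 1) (at t within ?S)"
    by (auto intro!: derivative_eq_intros)
  ultimately have "((\<lambda>h. D \<kappa> (?z + h *\<^sub>R axis s 1)) \<circ> (\<lambda>u. u - t) has_real_derivative D (\<kappa>(s := Suc (\<kappa> s))) ?z * 1)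
      (at t within ?S)" by (rule DERIV_image_chain)
  moreover have "(\<lambda>h. D \<kappa> (?z + h *\<^sub>R axis s 1)) \<circ> (\<lambda>u. u - t) = (\<lambda>t. D \<kappa> (y + t *\<^sub>R axis s 1))"
    by (auto simp: scaleR_left_diff_distrib)
  ultimately show ?thesis by simp
qed

text \<open>The derivative of order \<open>l\<close> in coordinate \<open>s\<close> costs
  \<open>a ^ l * fact l\<close>; since \<open>a * (x $ s - c) \<le> 1 / 4\<close>, the remainder
  contains only \<open>l * (1 / 4) ^ l\<close>. The other derivatives in \<open>\<kappa>\<close> are
  carried along as a fixed factor.\<close>

lemma coordinate_taylor:
  fixes D :: "('d::finite \<Rightarrow> nat) \<Rightarrow> real ^ 'd \<Rightarrow> real"
  assumes D: "mixed_partials g D"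
    and bound: "\<And>\<kappa> x. x \<in> unit_cube \<Longrightarrow> \<bar>D \<kappa> x\<bar> \<le> b * a ^ (\<Sum>i\<in>UNIV. \<kappa> i) * (\<Prod>i\<in>UNIV. fact (\<kappa> i))"
    and x: "x \<in> unit_cube" and c: "0 \<le> c" "c \<le> x $ s" and a: "0 \<le> a" "a * (x $ s - c) \<le> 1 / 4"
    and b: "0 \<le> b" and \<kappa>: "\<kappa> s = 0" and l: "0 < l"
  shows "\<bar>D \<kappa> x - (\<Sum>k<l. D (\<kappa>(s := k)) (\<chi> i. if i = s then c else x $ i) * ((x $ s - c) ^ k / fact k))\<bar>
    \<le> b * (1 / 2) ^ l * (a ^ (\<Sum>i\<in>UNIV. \<kappa> i) * (\<Prod>i\<in>UNIV. fact (\<kappa> i)))"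
proof -
  define y where "y = (\<chi> i. if i = s then c else x $ i)"
  define t where "t = x $ s - c"
  let ?S = "{t. y + t *\<^sub>R axis s 1 \<in> unit_cube}"
  have S: "?S = {- c..<1 - c}"
    using x by (auto simp: unit_cube_def y_def axis_def split: if_splits)
  have x_eq: "x = y + t *\<^sub>R axis s 1" by (auto simp: Finite_Cartesian_Product.vec_eq_iff y_def t_def axis_def)
  have t: "0 \<le> t" "t \<in> ?S" and zero: "0 \<in> ?S"
    using c x unfolding S by (auto simp: t_def unit_cube_def intro: le_less_trans)
  obtain m where m: "l = Suc m" using l by (cases l) auto
  define C where "C = b * a ^ (\<Sum>i\<in>UNIV. \<kappa> i) * a ^ l * ((\<Prod>i\<in>UNIV. fact (\<kappa> i)) * fact l)"
  have "norm (D (\<kappa>(s := 0)) (y + t *\<^sub>R axis s 1) - (\<Sum>k\<le>m. D (\<kappa>(s := k)) (y + 0 *\<^sub>R axis s 1) * (t - 0) ^ k / fact k))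
      \<le> C * norm (t - 0) ^ Suc m / fact m"
  proof (rule field_Taylor[where S = ?S and f = "\<lambda>k t. D (\<kappa>(s := k)) (y + t *\<^sub>R axis s 1)"])
    show "convex ?S" unfolding S by simp
    fix t assume t: "t \<in> ?S"
    show "((\<lambda>t. D (\<kappa>(s := k)) (y + t *\<^sub>R axis s 1)) has_real_derivative D (\<kappa>(s := Suc k)) (y + t *\<^sub>R axis s 1))
        (at t within ?S)" for k
      using mixed_partials_coordinate_derivative[OF D, of y t s "\<kappa>(s := k)"] t by simp
    have "(\<Sum>i\<in>UNIV. (\<kappa>(s := l)) i) = (\<Sum>i\<in>UNIV. \<kappa> i) + l"
      by (subst (1 2) sum.remove[of _ s]) (use \<kappa> in auto)
    moreover have "(\<Prod>i\<in>UNIV. fact ((\<kappa>(s := l)) i) :: real) = fact l * (\<Prod>i\<in>UNIV. fact (\<kappa> i))"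
      by (rule prod_fun_upd_zero[where h = "\<lambda>_. fact"]) (use \<kappa> in auto)
    ultimately show "norm (D (\<kappa>(s := Suc m)) (y + t *\<^sub>R axis s 1)) \<le> C"
      using bound[of "y + t *\<^sub>R axis s 1" "\<kappa>(s := l)"] t m by (simp add: C_def power_add ac_simps)
  qed (use t zero in auto)
  moreover have "\<kappa>(s := 0) = \<kappa>" using \<kappa> by auto
  moreover have "(\<Sum>k\<le>m. D (\<kappa>(s := k)) (y + 0 *\<^sub>R axis s 1) * (t - 0) ^ k / fact k) =
      (\<Sum>k<l. D (\<kappa>(s := k)) y * (t ^ k / fact k))"
    unfolding m lessThan_Suc_atMost by simp
  moreover have "C * norm (t - 0) ^ Suc m / fact m \<le> b * (1 / 2) ^ l * (a ^ (\<Sum>i\<in>UNIV. \<kappa> i) * (\<Prod>i\<in>UNIV. fact (\<kappa> i)))"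
  proof -
    have "C * norm (t - 0) ^ Suc m / fact m =
        (b * (a ^ (\<Sum>i\<in>UNIV. \<kappa> i) * (\<Prod>i\<in>UNIV. fact (\<kappa> i)))) * (real l * (a * t) ^ l)"
      using t(1) by (simp add: C_def m power_mult_distrib)
    also have "\<dots> \<le> (b * (a ^ (\<Sum>i\<in>UNIV. \<kappa> i) * (\<Prod>i\<in>UNIV. fact (\<kappa> i)))) * (1 / 2) ^ l"
    proof (rule mult_left_mono)
      have "real l * (a * t) ^ l \<le> real l * (1 / 4) ^ l"
        using a t(1) by (intro mult_left_mono power_mono) (auto simp: t_def)
      then show "real l * (a * t) ^ l \<le> (1 / 2) ^ l" using nat_quarter_power_le[of l] by linarith
    qed (use a b in \<open>simp add: prod_nonneg\<close>)
    finally show ?thesis by (simp add: ac_simps)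
  qed
  moreover have "D \<kappa> (y + t *\<^sub>R axis s 1) = D \<kappa> x" by (simp only: x_eq[symmetric])
  ultimately have "\<bar>D \<kappa> x - (\<Sum>k<l. D (\<kappa>(s := k)) y * (t ^ k / fact k))\<bar>
      \<le> b * (1 / 2) ^ l * (a ^ (\<Sum>i\<in>UNIV. \<kappa> i) * (\<Prod>i\<in>UNIV. fact (\<kappa> i)))"
    by (simp only: real_norm_def)
  then show ?thesis by (simp only: y_def t_def)
qed

text \<open>Telescoping over the coordinates: each coordinate that is expanded adds one error of the
  one-variable theorem, summed over the multi-indices already present.\<close>

lemma multivariate_taylor:
  fixes D :: "('d::finite \<Rightarrow> nat) \<Rightarrow> real ^ 'd \<Rightarrow> real"
  assumes D: "mixed_partials g D"
    and bound: "\<And>\<kappa> x. x \<in> unit_cube \<Longrightarrow> \<bar>D \<kappa> x\<bar> \<le> b * a ^ (\<Sum>i\<in>UNIV. \<kappa> i) * (\<Prod>i\<in>UNIV. fact (\<kappa> i))"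
    and x: "x \<in> unit_cube" and c: "\<And>i. 0 \<le> c $ i" "\<And>i. c $ i \<le> x $ i"
    and a: "0 \<le> a" "\<And>i. a * (x $ i - c $ i) \<le> 1 / 4" and b: "0 \<le> b"
  shows "\<bar>g x - (\<Sum>\<kappa>\<in>multi_indices UNIV l. D \<kappa> c * (\<Prod>i\<in>UNIV. (x $ i - c $ i) ^ \<kappa> i / fact (\<kappa> i)))\<bar>
    \<le> b * real CARD('d) * 2 ^ CARD('d) * (1 / 2) ^ l"
proof (cases "l = 0")
  \<comment> \<open>The expansion is empty and the claim reduces to the bound on \<open>g\<close>
    itself; the one-variable expansion assumes a positive \<open>l\<close>.\<close>
  case True
  have "multi_indices (UNIV :: 'd set) 0 = {}" by (simp add: multi_indices_def)
  moreover have "\<bar>g x\<bar> \<le> b" using bound[OF x, of "\<lambda>_. 0"] D x by (simp add: mixed_partials_def)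
  moreover have "b * 1 \<le> b * (real CARD('d) * 2 ^ CARD('d))"
  proof (intro mult_left_mono b)
    have "1 * 1 \<le> real CARD('d) * 2 ^ CARD('d)"
      using zero_less_card_finite[where 'a = 'd] by (intro mult_mono) (auto simp: Suc_le_eq)
    then show "1 \<le> real CARD('d) * 2 ^ CARD('d)" by simp
  qed
  ultimately show ?thesis using True by simp
next
  case l: False
  \<comment> \<open>The points \<open>z S\<close> interpolate between \<open>x\<close>, for empty
    \<open>S\<close>, and the corner \<open>c\<close>, for full \<open>S\<close>.\<close>
  define z where "z S = (\<chi> i. if i \<in> S then c $ i else x $ i)" for S
  define w where "w \<kappa> = (\<Prod>i\<in>UNIV. (x $ i - c $ i) ^ \<kappa> i / fact (\<kappa> i))" for \<kappa> :: "'d \<Rightarrow> nat"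
  have zc: "z S \<in> unit_cube" for S
    using x c by (auto simp: unit_cube_def z_def intro: le_less_trans)
  let ?\<Sigma> = "\<lambda>S. \<Sum>\<kappa>\<in>multi_indices S l. D \<kappa> (z S) * w \<kappa>"
  have main: "\<bar>D (\<lambda>_. 0) x - ?\<Sigma> S\<bar>
      \<le> real (card S) * (b * 2 ^ CARD('d) * (1 / 2) ^ l)" for S
  proof (induction S rule: finite_induct[OF finite])
    case 1
    have "multi_indices ({} :: 'd set) l = {\<lambda>_. 0}" by (auto simp: multi_indices_def)
    moreover have "z {} = x" by (simp add: z_def Finite_Cartesian_Product.vec_eq_iff)
    ultimately show ?case by (simp add: w_def)
  next
    case (2 s S)
    let ?T = "\<lambda>\<kappa>. \<Sum>k<l. D (\<kappa>(s := k)) (z (insert s S)) * ((x $ s - c $ s) ^ k / fact k)"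
    have "?\<Sigma> (insert s S) =
        (\<Sum>\<kappa>\<in>multi_indices S l. w \<kappa> * ?T \<kappa>)"
      unfolding sum_multi_indices_insert[OF 2(2)] sum_distrib_left
    proof (intro sum.cong refl)
      fix \<kappa> k assume "\<kappa> \<in> multi_indices S l"
      then have "\<kappa> s = 0" using 2(2) by (simp add: multi_indices_def)
      then have "w (\<kappa>(s := k)) = (x $ s - c $ s) ^ k / fact k * w \<kappa>"
        unfolding w_def by (rule prod_fun_upd_zero[where h = "\<lambda>i k. (x $ i - c $ i) ^ k / fact k"]) simp
      then show "D (\<kappa>(s := k)) (z (insert s S)) * w (\<kappa>(s := k)) =
          w \<kappa> * (D (\<kappa>(s := k)) (z (insert s S)) * ((x $ s - c $ s) ^ k / fact k))"
        by simp
    qed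
    then have "\<bar>?\<Sigma> S - ?\<Sigma> (insert s S)\<bar> =
        \<bar>\<Sum>\<kappa>\<in>multi_indices S l. w \<kappa> * (D \<kappa> (z S) - ?T \<kappa>)\<bar>"
      by (simp add: sum_subtractf right_diff_distrib mult.commute)
    also have "\<dots> \<le> (\<Sum>\<kappa>\<in>multi_indices S l. \<bar>w \<kappa> * (D \<kappa> (z S) - ?T \<kappa>)\<bar>)"
      by (rule sum_abs)
    also have "\<dots> \<le> (\<Sum>\<kappa>\<in>multi_indices S l. b * (1 / 2) ^ l * (\<Prod>i\<in>UNIV. (1 / 4) ^ \<kappa> i))"
    proof (intro sum_mono)
      fix \<kappa> assume "\<kappa> \<in> multi_indices S l"
      then have \<kappa>s: "\<kappa> s = 0" using 2(2) by (simp add: multi_indices_def)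
      have zs: "z (insert s S) = (\<chi> i. if i = s then c $ s else z S $ i)" by (auto simp: z_def Finite_Cartesian_Product.vec_eq_iff)
      have zS: "z S $ s = x $ s" using 2(2) by (simp add: z_def)
      have w0: "0 \<le> w \<kappa>" unfolding w_def using c by (intro prod_nonneg) auto
      have "\<bar>D \<kappa> (z S) - ?T \<kappa>\<bar>
          \<le> b * (1 / 2) ^ l * (a ^ (\<Sum>i\<in>UNIV. \<kappa> i) * (\<Prod>i\<in>UNIV. fact (\<kappa> i)))"
      proof -
        have "\<bar>D \<kappa> (z S) - (\<Sum>k<l. D (\<kappa>(s := k)) (\<chi> i. if i = s then c $ s else z S $ i) * ((z S $ s - c $ s) ^ k / fact k))\<bar>
            \<le> b * (1 / 2) ^ l * (a ^ (\<Sum>i\<in>UNIV. \<kappa> i) * (\<Prod>i\<in>UNIV. fact (\<kappa> i)))"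
          by (rule coordinate_taylor[OF D bound zc _ _ a(1) _ b]) (use c a(2) l \<kappa>s in \<open>simp_all add: zS\<close>)
        then show ?thesis by (simp only: zs zS)
      qed
      then have "\<bar>w \<kappa> * (D \<kappa> (z S) - ?T \<kappa>)\<bar>
          \<le> w \<kappa> * (b * (1 / 2) ^ l * (a ^ (\<Sum>i\<in>UNIV. \<kappa> i) * (\<Prod>i\<in>UNIV. fact (\<kappa> i))))"
        using w0 by (simp add: abs_mult mult_left_mono)
      \<comment> \<open>The weight \<open>w \<kappa>\<close> contains the reciprocal factorials and
        the powers of \<open>x - c\<close>. These cancel the factorial and exponential growth of the
        derivatives and leave a geometric weight.\<close>
      also have "\<dots> = b * (1 / 2) ^ l * (w \<kappa> * (\<Prod>i\<in>UNIV. a ^ \<kappa> i * fact (\<kappa> i)))"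
        by (simp add: power_sum prod.distrib mult.commute mult.left_commute)
      also have "w \<kappa> * (\<Prod>i\<in>UNIV. a ^ \<kappa> i * fact (\<kappa> i)) = (\<Prod>i\<in>UNIV. (a * (x $ i - c $ i)) ^ \<kappa> i)"
        unfolding w_def prod.distrib[symmetric] by (simp add: power_mult_distrib mult.commute)
      also have "b * (1 / 2) ^ l * \<dots> \<le> b * (1 / 2) ^ l * (\<Prod>i\<in>UNIV. (1 / 4) ^ \<kappa> i)"
        using a b c by (intro mult_left_mono prod_mono conjI power_mono) auto
      finally show "\<bar>w \<kappa> * (D \<kappa> (z S) - ?T \<kappa>)\<bar>
          \<le> b * (1 / 2) ^ l * (\<Prod>i\<in>UNIV. (1 / 4) ^ \<kappa> i)" .
    qed
    also have "\<dots> = b * (1 / 2) ^ l * (\<Sum>\<kappa>\<in>multi_indices S l. \<Prod>i\<in>UNIV. (1 / 4) ^ \<kappa> i)"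
      by (simp add: sum_distrib_left)
    also have "\<dots> \<le> b * (1 / 2) ^ l * 2 ^ CARD('d)"
    proof (intro mult_left_mono order_trans[OF sum_multi_indices_quarter_le])
      show "(2::real) ^ card S \<le> 2 ^ CARD('d)" by (intro power_increasing card_mono) auto
    qed (use b in simp)
    finally have "\<bar>?\<Sigma> S - ?\<Sigma> (insert s S)\<bar>
        \<le> b * 2 ^ CARD('d) * (1 / 2) ^ l" by (simp add: mult.commute mult.left_commute)
    with 2(3) have "\<bar>D (\<lambda>_. 0) x - ?\<Sigma> (insert s S)\<bar>
        \<le> real (card S) * (b * 2 ^ CARD('d) * (1 / 2) ^ l) + b * 2 ^ CARD('d) * (1 / 2) ^ l" by linarith
    then show ?case using 2(1,2) by (simp add: algebra_simps)
  qed
  have "z UNIV = c" by (simp add: z_def Finite_Cartesian_Product.vec_eq_iff)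
  moreover have "D (\<lambda>_. 0) x = g x" using D x by (simp add: mixed_partials_def)
  ultimately show ?thesis using main[of UNIV] by (simp add: w_def mult.commute mult.left_commute)
qed

text \<open>Piecewise Taylor polynomials: one polynomial of coordinate degree below \<open>l\<close> on each of the
  \<open>N ^ CARD('d)\<close> subcubes of side \<open>1 / N\<close>, expanded at the lower corner.\<close>

lemma analytic_graphon_low_rank:
  fixes f :: "real ^ 'd::finite \<Rightarrow> real ^ 'd \<Rightarrow> real"
  assumes an: "analytic_bound a b f" and a: "0 < a" and b: "0 < b" and N: "4 * a \<le> real N"
  obtains I :: "(('d \<Rightarrow> nat) \<times> ('d \<Rightarrow> nat)) set" and \<phi> \<psi>
  where "finite I" "card I = (N * l) ^ CARD('d)"
    "\<And>x y. x \<in> unit_cube \<Longrightarrow> y \<in> unit_cube \<Longrightarrow>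
       \<bar>f x y - (\<Sum>t\<in>I. \<phi> t x * \<psi> t y)\<bar> \<le> b * real CARD('d) * 2 ^ CARD('d) * (1 / 2) ^ l"
proof -
  from N a have N0: "0 < real N" by linarith
  define corner where "corner \<gamma> = (\<chi> i. real (\<gamma> i) / real N)" for \<gamma> :: "'d \<Rightarrow> nat"
  define cell where "cell x = (\<lambda>i. nat \<lfloor>real N * x $ i\<rfloor>)" for x :: "real ^ 'd"
  have "\<forall>y. \<exists>D. y \<in> unit_cube \<longrightarrow> mixed_partials (\<lambda>x. f x y) D \<and>
        (\<forall>\<kappa>. \<forall>x\<in>unit_cube. \<bar>D \<kappa> x\<bar> \<le> b * a ^ (\<Sum>i\<in>UNIV. \<kappa> i) * (\<Prod>i\<in>UNIV. fact (\<kappa> i)))"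
    using an by (auto simp: analytic_bound_def)
  then obtain D where D: "\<And>y. y \<in> unit_cube \<Longrightarrow> mixed_partials (\<lambda>x. f x y) (D y)"
    and bound: "\<And>y \<kappa> x. y \<in> unit_cube \<Longrightarrow> x \<in> unit_cube \<Longrightarrow>
       \<bar>D y \<kappa> x\<bar> \<le> b * a ^ (\<Sum>i\<in>UNIV. \<kappa> i) * (\<Prod>i\<in>UNIV. fact (\<kappa> i))"
    by metis
  define I where "I = multi_indices (UNIV :: 'd set) N \<times> multi_indices (UNIV :: 'd set) l"
  \<comment> \<open>The cell test sits in \<open>\<phi>\<close>, so the piecewise expansion becomes
    a single sum of products of a function of \<open>x\<close> and a function of
    \<open>y\<close>.\<close>
  define \<phi> where "\<phi> t x = (if cell x = fst t then
      \<Prod>i\<in>UNIV. (x $ i - corner (fst t) $ i) ^ snd t i / fact (snd t i) else 0)" for t x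
  define \<psi> where "\<psi> t y = D y (snd t) (corner (fst t))" for t y
  have "\<bar>f x y - (\<Sum>t\<in>I. \<phi> t x * \<psi> t y)\<bar> \<le> b * real CARD('d) * 2 ^ CARD('d) * (1 / 2) ^ l"
    if x: "x \<in> unit_cube" and y: "y \<in> unit_cube" for x y
  proof -
    have x01: "0 \<le> x $ i" "x $ i < 1" for i using x by (auto simp: unit_cube_def)
    have cell: "real (cell x i) \<le> real N * x $ i" "real N * x $ i \<le> real (cell x i) + 1" for i
    proof -
      have "0 \<le> real N * x $ i" using x01 by simp
      then show "real (cell x i) \<le> real N * x $ i" "real N * x $ i \<le> real (cell x i) + 1"
        unfolding cell_def by linarith+
    qed
    have "cell x i < N" for i
    proof -
      have "real N * x $ i < real N * 1" using x01 N0 by (intro mult_strict_left_mono) auto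
      then have "real (cell x i) < real N" using cell(1)[of i] by linarith
      then show ?thesis by simp
    qed
    then have cell_in: "cell x \<in> multi_indices UNIV N" by (simp add: multi_indices_def)
    have "(\<Sum>t\<in>I. \<phi> t x * \<psi> t y) = (\<Sum>\<gamma>\<in>multi_indices UNIV N. \<Sum>\<kappa>\<in>multi_indices UNIV l. \<phi> (\<gamma>, \<kappa>) x * \<psi> (\<gamma>, \<kappa>) y)"
      unfolding I_def by (simp add: sum.cartesian_product case_prod_beta')
    also have "\<dots> = (\<Sum>\<gamma>\<in>multi_indices UNIV N. if \<gamma> = cell x then
        \<Sum>\<kappa>\<in>multi_indices UNIV l. \<phi> (cell x, \<kappa>) x * \<psi> (cell x, \<kappa>) y else 0)"
      by (intro sum.cong refl) (auto simp: \<phi>_def)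
    also have "\<dots> = (\<Sum>\<kappa>\<in>multi_indices UNIV l. \<phi> (cell x, \<kappa>) x * \<psi> (cell x, \<kappa>) y)"
      using cell_in finite_multi_indices[of "UNIV :: 'd set" N] by simp
    also have "\<dots> = (\<Sum>\<kappa>\<in>multi_indices UNIV l. D y \<kappa> (corner (cell x)) *
        (\<Prod>i\<in>UNIV. (x $ i - corner (cell x) $ i) ^ \<kappa> i / fact (\<kappa> i)))"
      by (simp add: \<phi>_def \<psi>_def mult.commute)
    finally have eq: "(\<Sum>t\<in>I. \<phi> t x * \<psi> t y) = \<dots>" .
    show ?thesis unfolding eq
    proof (rule multivariate_taylor[OF D[OF y] bound[OF y] x])
      fix i
      show "0 \<le> corner (cell x) $ i" by (simp add: corner_def)
      show "corner (cell x) $ i \<le> x $ i" using cell(1)[of i] N0 by (simp add: corner_def field_simps)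
      have "x $ i \<le> (real (cell x i) + 1) / real N" using cell(2)[of i] N0 by (simp add: pos_le_divide_eq mult.commute)
      then have "x $ i - corner (cell x) $ i \<le> 1 / real N" by (simp add: corner_def add_divide_distrib)
      then have "a * (x $ i - corner (cell x) $ i) \<le> a * (1 / real N)" using a by (intro mult_left_mono) auto
      also have "\<dots> \<le> 1 / 4" using N N0 by (simp add: field_simps)
      finally show "a * (x $ i - corner (cell x) $ i) \<le> 1 / 4" .
    qed (use a b in auto)
  qed
  moreover have "finite I" "card I = (N * l) ^ CARD('d)"
    by (simp_all add: I_def finite_multi_indices card_cartesian_product card_multi_indices power_mult_distrib)
  ultimately show ?thesis using that by blast
qed

lemma edge_prob_mat_props:
  assumes f: "graphon f" and x: "\<And>i. i < n \<Longrightarrow> x i \<in> unit_cube"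
  shows "edge_prob_mat f n x \<in> carrier_mat n n"
    and "i < n \<Longrightarrow> j < n \<Longrightarrow> edge_prob_mat f n x $$ (i, j) = edge_prob_mat f n x $$ (j, i)"
    and "i < n \<Longrightarrow> j < n \<Longrightarrow> 0 \<le> edge_prob_mat f n x $$ (i, j)"
    and "i < n \<Longrightarrow> j < n \<Longrightarrow> edge_prob_mat f n x $$ (i, j) \<le> 1"
  using f x by (auto simp: edge_prob_mat_def graphon_def)

text \<open>The Eckart-Young bound is applied to the sampled approximant, with the degree
  \<open>l\<close> chosen as large as the rank budget \<open>r\<close> permits. Since
  \<open>N\<close> is fixed, the rate \<open>ln 4 / N\<close> depends on the graphon only through
  \<open>a\<close>.\<close>

lemma analytic_eigenvalue_tail:
  fixes f :: "real ^ 'd::finite \<Rightarrow> real ^ 'd \<Rightarrow> real"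
  assumes f: "graphon f" and an: "analytic_bound a b f" and a: "0 < a" and b: "0 < b"
    and N: "4 * a \<le> real N" and x: "\<And>i. i < n \<Longrightarrow> x i \<in> unit_cube" and r: "r < n"
  shows "1 / (real n)\<^sup>2 * (\<Sum>i=r..<n. (ordered_eigenvalues (edge_prob_mat f n x) ! i)\<^sup>2)
    \<le> (2 + 8 * (b * real CARD('d) * 2 ^ CARD('d))\<^sup>2) *
        (1 / real n + exp (- (ln 4 / real N) * real r powr (1 / real CARD('d))))"
proof -
  from N a have N0: "0 < real N" by linarith
  let ?d = "CARD('d)"
  define u where "u = real r powr (1 / real ?d)"
  \<comment> \<open>With this \<open>l\<close> the rank \<open>(N * l) ^ CARD('d)\<close> is at most
    \<open>r\<close>.\<close>
  define l where "l = nat \<lfloor>u / real N\<rfloor>"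
  have u0: "0 \<le> u" by (simp add: u_def)
  have l: "real l \<le> u / real N" "u / real N \<le> real l + 1"
    using u0 N0 unfolding l_def by (simp_all add: le_nat_floor)
  have ud: "u ^ ?d = real r"
  proof (cases "r = 0")
    case False
    then have "u ^ ?d = u powr real ?d" by (simp add: u_def powr_realpow)
    also have "\<dots> = real r" using False by (simp add: u_def powr_powr)
    finally show ?thesis .
  qed (simp add: u_def)
  obtain I :: "(('d \<Rightarrow> nat) \<times> ('d \<Rightarrow> nat)) set" and \<phi> \<psi> where I: "finite I" "card I = (N * l) ^ ?d"
    and approx: "\<And>x y. x \<in> unit_cube \<Longrightarrow> y \<in> unit_cube \<Longrightarrow>
       \<bar>f x y - (\<Sum>t\<in>I. \<phi> t x * \<psi> t y)\<bar> \<le> b * real ?d * 2 ^ ?d * (1 / 2) ^ l"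
    by (rule analytic_graphon_low_rank[OF an a b N, where l = l]) blast
  have "real (N * l) \<le> u" using l(1) N0 by (simp add: field_simps)
  then have "real (N * l) ^ ?d \<le> real r" unfolding ud[symmetric] by (intro power_mono) auto
  then have card: "card I \<le> r" unfolding I(2) by (metis of_nat_le_iff of_nat_power)
  define E where "E = b * real ?d * 2 ^ ?d"
  define e where "e = E * (1 / 2) ^ l"
  have e: "0 \<le> e" using b by (simp add: e_def E_def)
  define M where "M = edge_prob_mat f n x"
  define B where "B i j = (\<Sum>t\<in>I. \<phi> t (x i) * \<psi> t (x j))" for i j
  note props = edge_prob_mat_props[OF f, where n = n and x = x, OF x]
  obtain w where w: "orthonormal n w"
    "\<And>k i. k < n \<Longrightarrow> i < n \<Longrightarrow> mat_app n (\<lambda>i j. M $$ (i, j)) (w k) i = ordered_eigenvalues M ! k * w k i"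
    "\<And>k l. k \<le> l \<Longrightarrow> l < n \<Longrightarrow> \<bar>ordered_eigenvalues M ! l\<bar> \<le> \<bar>ordered_eigenvalues M ! k\<bar>"
    unfolding M_def by (rule symmetric_eigenbasis[OF props(1)]) (use props(2) in blast)+
  \<comment> \<open>The matrix has a zero diagonal while the approximant follows \<open>f\<close>
    there. Each of the \<open>n\<close> diagonal entries costs up to 2 extra, the source of the term
    \<open>1 / n\<close>.\<close>
  have entry: "(M $$ (i, j) - B i j)\<^sup>2 \<le> 2 * e\<^sup>2 + (if j = i then 2 else 0)" if ij: "i < n" "j < n" for i j
  proof -
    have ap: "\<bar>f (x i) (x j) - B i j\<bar> \<le> e" using approx[OF x[OF ij(1)] x[OF ij(2)]] by (simp add: B_def e_def E_def)
    show ?thesis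
    proof (cases "i = j")
      case True
      have "0 \<le> f (x i) (x j)" "f (x i) (x j) \<le> 1" using f x ij by (auto simp: graphon_def)
      then have "\<bar>B i j\<bar> \<le> 1 + e" using ap by linarith
      then have "(B i j)\<^sup>2 \<le> (1 + e)\<^sup>2" using e by (simp add: abs_le_square_iff[symmetric])
      also have "\<dots> \<le> 2 * 1\<^sup>2 + 2 * e\<^sup>2" by (rule sum_square_add_le)
      finally show ?thesis using True ij by (simp add: M_def edge_prob_mat_def)
    next
      case False
      have "(f (x i) (x j) - B i j)\<^sup>2 \<le> e\<^sup>2" using ap e by (simp add: abs_le_square_iff[symmetric])
      then have "(f (x i) (x j) - B i j)\<^sup>2 \<le> 2 * e\<^sup>2" using zero_le_power2[of e] by linarith
      then show ?thesis using False ij by (simp add: M_def edge_prob_mat_def)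
    qed
  qed
  have "(\<Sum>i=r..<n. (ordered_eigenvalues M ! i)\<^sup>2) \<le> (\<Sum>i<n. \<Sum>j<n. (M $$ (i, j) - B i j)\<^sup>2)"
    by (rule eckart_young_lower[OF w I(1) card, where \<phi> = "\<lambda>t i. \<phi> t (x i)" and \<psi> = "\<lambda>t j. \<psi> t (x j)"])
      (use r in \<open>auto simp: B_def\<close>)
  also have "\<dots> \<le> (\<Sum>i<n. \<Sum>j<n. 2 * e\<^sup>2 + (if j = i then 2 else 0))"
    using entry by (intro sum_mono) auto
  also have "\<dots> = (real n)\<^sup>2 * (2 * e\<^sup>2) + 2 * real n"
    by (simp add: sum.distrib power2_eq_square algebra_simps)
  finally have main: "1 / (real n)\<^sup>2 * (\<Sum>i=r..<n. (ordered_eigenvalues M ! i)\<^sup>2) \<le> 2 * e\<^sup>2 + 2 * (1 / real n)"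
    using r by (simp add: field_simps power2_eq_square)
  have "((1 / 2 :: real) ^ l)\<^sup>2 = ((1 / 2)\<^sup>2) ^ l" by (simp only: power_mult[symmetric] mult.commute)
  then have e_sq: "e\<^sup>2 = E\<^sup>2 * (1 / 4) ^ l" by (simp add: e_def power_mult_distrib power2_eq_square)
  have "exp (- ln 4 :: real) = 1 / 4" by (simp add: exp_minus)
  then have "(1 / 4 :: real) ^ l = exp (real l * - ln 4)" by (simp only: exp_of_nat_mult)
  \<comment> \<open>Rounding \<open>u / N\<close> down to \<open>l\<close> loses at most a factor 4,
    which turns the 2 in front of the squared error into the constant 8.\<close>
  also have "\<dots> \<le> exp (ln 4 - ln 4 / real N * u)"
  proof -
    have "ln 4 * (u / real N) \<le> ln 4 * (real l + 1)" using l(2) by (intro mult_left_mono) auto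
    then show ?thesis by (simp add: algebra_simps)
  qed
  also have "exp (ln 4 - ln 4 / real N * u) = 4 * exp (- (ln 4 / real N) * u)"
    by (simp add: exp_diff exp_minus divide_inverse)
  finally have e2: "e\<^sup>2 \<le> E\<^sup>2 * (4 * exp (- (ln 4 / real N) * u))"
    unfolding e_sq by (rule mult_left_mono) simp
  have "2 * e\<^sup>2 + 2 * (1 / real n) \<le> 8 * E\<^sup>2 * exp (- (ln 4 / real N) * u) + 2 * (1 / real n)" using e2 by simp
  also have "\<dots> \<le> (2 + 8 * E\<^sup>2) * exp (- (ln 4 / real N) * u) + (2 + 8 * E\<^sup>2) * (1 / real n)"
    by (intro add_mono mult_right_mono) auto
  finally show ?thesis using main unfolding M_def E_def u_def by (simp add: distrib_left)
qed

section \<open>The trace method\<close>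

definition unit_fun :: "nat \<Rightarrow> nat \<Rightarrow> real" where
  "unit_fun a = (\<lambda>i. if i = a then 1 else 0)"

definition sym_fun :: "nat \<Rightarrow> (nat \<Rightarrow> nat \<Rightarrow> real) \<Rightarrow> bool" where
  "sym_fun n S \<longleftrightarrow> (\<forall>i<n. \<forall>j<n. S i j = S j i)"

definition closed_walks :: "nat \<Rightarrow> nat \<Rightarrow> (nat \<Rightarrow> nat) set" where
  "closed_walks n L = {w \<in> PiE {..L} (\<lambda>_. {..<n}). w 0 = w L}"

text \<open>This is the trace of the \<open>L\<close>-th power of \<open>S\<close>, written so that
  expectations can be taken walk by walk.\<close>

definition walk_sum :: "nat \<Rightarrow> (nat \<Rightarrow> nat \<Rightarrow> real) \<Rightarrow> nat \<Rightarrow> real" where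
  "walk_sum n S L = (\<Sum>w\<in>closed_walks n L. \<Prod>t<L. S (w t) (w (Suc t)))"

lemma dotp_unit_fun: "a < n \<Longrightarrow> dotp n (unit_fun a) x = x a"
  by (simp add: dotp_def unit_fun_def if_distrib[of "\<lambda>x. x * _"] cong: if_cong)

lemma finite_closed_walks: "finite (closed_walks n L)"
  unfolding closed_walks_def by (intro finite_subset[OF _ finite_PiE[of "{..L}" "\<lambda>_. {..<n}"]]) auto

lemma sum_PiE_atMost_Suc:
  fixes f :: "(nat \<Rightarrow> nat) \<Rightarrow> real"
  shows "(\<Sum>w\<in>PiE {..Suc L} (\<lambda>_. {..<n}). f w) = (\<Sum>w\<in>PiE {..L} (\<lambda>_. {..<n}). \<Sum>j<n. f (w(Suc L := j)))"
proof -
  have inj: "inj_on (\<lambda>(y, g). g(Suc L := y)) ({..<n} \<times> PiE {..L} (\<lambda>_. {..<n}))"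
    by (rule inj_combinator) simp
  have "(\<Sum>w\<in>PiE {..Suc L} (\<lambda>_. {..<n}). f w) = (\<Sum>x\<in>{..<n} \<times> PiE {..L} (\<lambda>_. {..<n}). f ((\<lambda>(y, g). g(Suc L := y)) x))"
    unfolding atMost_Suc PiE_insert_eq by (subst sum.reindex[OF inj]) simp
  also have "\<dots> = (\<Sum>j<n. \<Sum>w\<in>PiE {..L} (\<lambda>_. {..<n}). f (w(Suc L := j)))"
    by (subst sum.cartesian_product) (simp add: case_prod_beta')
  finally show ?thesis by (subst sum.swap)
qed

text \<open>Arbitrary end vectors make the induction work: the last step of the path is absorbed
  into \<open>g\<close>.\<close>

lemma sum_paths:
  "(\<Sum>w\<in>PiE {..L} (\<lambda>_. {..<n}). h (w 0) * (\<Prod>t<L. S (w t) (w (Suc t))) * g (w L)) =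
     dotp n h ((mat_app n S ^^ L) g)"
proof (induction L arbitrary: g)
  case 0
  have inj: "inj_on (\<lambda>j t. if t = (0::nat) then j else undefined) {..<n}"
    by (intro inj_onI) (metis)
  have "PiE {..0::nat} (\<lambda>_. {..<n}) = (\<lambda>j t. if t = (0::nat) then j else undefined) ` {..<n}"
    by (auto simp: PiE_def extensional_def image_iff fun_eq_iff Pi_def)
  then show ?case by (simp add: sum.reindex[OF inj] dotp_def)
next
  case (Suc L)
  have "(\<Sum>w\<in>PiE {..Suc L} (\<lambda>_. {..<n}). h (w 0) * (\<Prod>t<Suc L. S (w t) (w (Suc t))) * g (w (Suc L))) =
    (\<Sum>w\<in>PiE {..L} (\<lambda>_. {..<n}). h (w 0) * (\<Prod>t<L. S (w t) (w (Suc t))) * mat_app n S g (w L))"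
    unfolding sum_PiE_atMost_Suc by (simp add: mat_app_def sum_distrib_left mult.assoc)
  also have "\<dots> = dotp n h ((mat_app n S ^^ Suc L) g)"
    unfolding Suc by (simp add: funpow_swap1)
  finally show ?case .
qed

lemma walk_sum_eq_trace:
  "walk_sum n S L = (\<Sum>a<n. dotp n (unit_fun a) ((mat_app n S ^^ L) (unit_fun a)))"
proof -
  have fin: "finite (PiE {..L} (\<lambda>_. {..<n}))" by (intro finite_PiE) auto
  have "(\<Sum>a<n. dotp n (unit_fun a) ((mat_app n S ^^ L) (unit_fun a))) =
    (\<Sum>w\<in>PiE {..L} (\<lambda>_. {..<n}). \<Sum>a<n. unit_fun a (w 0) * (\<Prod>t<L. S (w t) (w (Suc t))) * unit_fun a (w L))"
    unfolding sum_paths[symmetric] by (rule sum.swap)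
  also have "\<dots> = (\<Sum>w\<in>PiE {..L} (\<lambda>_. {..<n}). if w 0 = w L then \<Prod>t<L. S (w t) (w (Suc t)) else 0)"
  proof (intro sum.cong refl)
    fix w assume w: "w \<in> PiE {..L} (\<lambda>_. {..<n})"
    then have "w 0 < n" "w L < n" by auto
    moreover have "(\<Sum>a<n. unit_fun a (w 0) * (\<Prod>t<L. S (w t) (w (Suc t))) * unit_fun a (w L)) =
      (\<Sum>a<n. if a = w 0 then (if w 0 = w L then \<Prod>t<L. S (w t) (w (Suc t)) else 0) else 0)"
      by (intro sum.cong) (auto simp: unit_fun_def)
    ultimately show "(\<Sum>a<n. unit_fun a (w 0) * (\<Prod>t<L. S (w t) (w (Suc t))) * unit_fun a (w L)) =
      (if w 0 = w L then \<Prod>t<L. S (w t) (w (Suc t)) else 0)" by simp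
  qed
  also have "\<dots> = walk_sum n S L"
    unfolding walk_sum_def closed_walks_def using fin by (simp add: sum.inter_filter)
  finally show ?thesis by simp
qed

lemma mat_app_power_adjoint:
  assumes "sym_fun n S"
  shows "dotp n x ((mat_app n S ^^ k) y) = dotp n ((mat_app n S ^^ k) x) y"
proof (induction k arbitrary: x)
  case (Suc k)
  have "dotp n x ((mat_app n S ^^ Suc k) y) = dotp n (mat_app n (\<lambda>i j. S j i) x) ((mat_app n S ^^ k) y)"
    by (simp add: dotp_mat_app)
  also have "\<dots> = dotp n (mat_app n S x) ((mat_app n S ^^ k) y)"
    using assms by (intro dotp_cong) (auto simp: mat_app_def sym_fun_def)
  also have "\<dots> = dotp n ((mat_app n S ^^ Suc k) x) y" by (simp add: Suc funpow_swap1)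
  finally show ?case .
qed simp

text \<open>Half of the steps is moved to the other side of the inner product, so the trace becomes
  the squared Frobenius norm of the \<open>p\<close>-th power.\<close>

lemma walk_sum_even:
  assumes "sym_fun n S"
  shows "walk_sum n S (2 * p) =
    (\<Sum>a<n. sqnorm n ((mat_app n S ^^ p) (unit_fun a)))"
  unfolding walk_sum_eq_trace mult_2 funpow_add by (simp add: mat_app_power_adjoint[OF assms])

lemma walk_sum_nonneg:
  assumes "sym_fun n S"
  shows "0 \<le> walk_sum n S (2 * p)"
  unfolding walk_sum_even[OF assms] by (intro sum_nonneg dotp_self_nonneg)

lemma walk_sum_le:
  assumes "sym_fun n S"
    and N: "\<And>x. sqnorm n (mat_app n S x) \<le> N\<^sup>2 * sqnorm n x"
  shows "walk_sum n S (2 * p) \<le> real n * N ^ (2 * p)"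
proof -
  have pow: "sqnorm n ((mat_app n S ^^ k) x) \<le> (N\<^sup>2) ^ k * sqnorm n x" for k x
  proof (induction k)
    case (Suc k)
    have "sqnorm n ((mat_app n S ^^ Suc k) x) \<le>
        N\<^sup>2 * sqnorm n ((mat_app n S ^^ k) x)"
      using N by simp
    also have "\<dots> \<le> N\<^sup>2 * ((N\<^sup>2) ^ k * sqnorm n x)" by (intro mult_left_mono Suc) simp
    finally show ?case by (simp add: mult.assoc)
  qed simp
  have "walk_sum n S (2 * p) \<le> (\<Sum>a<n. N ^ (2 * p))"
    unfolding walk_sum_even[OF assms(1)]
  proof (intro sum_mono)
    fix a assume "a \<in> {..<n}"
    then have "sqnorm n (unit_fun a) = 1" by (simp add: dotp_unit_fun) (simp add: unit_fun_def)
    with pow[of p "unit_fun a"]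
    show "sqnorm n ((mat_app n S ^^ p) (unit_fun a)) \<le> N ^ (2 * p)"
      by (simp add: power_mult)
  qed
  then show ?thesis by simp
qed

text \<open>The ratios of consecutive terms are nondecreasing, so the \<open>k\<close>-th term
  dominates the \<open>k\<close>-th power of the first ratio. Everything is cross-multiplied because
  terms may vanish.\<close>

lemma log_convex_power_le:
  fixes a :: "nat \<Rightarrow> real"
  assumes nonneg: "\<And>k. 0 \<le> a k" and conv: "\<And>k. (a (Suc k))\<^sup>2 \<le> a k * a (Suc (Suc k))"
  shows "a 1 ^ k * a 0 \<le> a 0 ^ k * a k"
proof -
  have ratio: "a 1 * a k \<le> a 0 * a (Suc k)" for k
  proof (induction k)
    case (Suc k)
    show ?case
    proof (cases "a k = 0")
      case True
      then have "a (Suc k) = 0" using conv[of k] by simp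
      then show ?thesis using nonneg by simp
    next
      case False
      then have pos: "0 < a k" using nonneg[of k] by simp
      have "a k * (a 1 * a (Suc k)) = (a 1 * a k) * a (Suc k)" by simp
      also have "\<dots> \<le> (a 0 * a (Suc k)) * a (Suc k)" by (intro mult_right_mono Suc nonneg)
      also have "\<dots> = a 0 * (a (Suc k))\<^sup>2" by (simp add: power2_eq_square)
      also have "\<dots> \<le> a 0 * (a k * a (Suc (Suc k)))" by (intro mult_left_mono conv nonneg)
      also have "\<dots> = a k * (a 0 * a (Suc (Suc k)))" by simp
      finally show ?thesis using pos by (simp only: mult_le_cancel_left_pos)
    qed
  qed simp
  show ?thesis
  proof (induction k)
    case (Suc k)
    have "a 1 ^ Suc k * a 0 = a 1 * (a 1 ^ k * a 0)" by simp
    also have "\<dots> \<le> a 1 * (a 0 ^ k * a k)" by (intro mult_left_mono Suc nonneg)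
    also have "\<dots> = a 0 ^ k * (a 1 * a k)" by simp
    also have "\<dots> \<le> a 0 ^ k * (a 0 * a (Suc k))" by (intro mult_left_mono ratio zero_le_power nonneg)
    finally show ?case by (simp add: mult.assoc mult.left_commute)
  qed simp
qed

text \<open>A single eigenvalue is dominated by the trace of an even power. This is shown without
  diagonalising: the squared norms of the iterates of \<open>x\<close> are log-convex, and the
  \<open>p\<close>-th iterate is controlled by the Frobenius norm of the \<open>p\<close>-th
  power.\<close>

lemma operator_norm_le_walk_sum:
  assumes sym: "sym_fun n S" and "0 < p"
  shows "(sqnorm n (mat_app n S x)) ^ p \<le> walk_sum n S (2 * p) * (sqnorm n x) ^ p"
proof -
  define a where "a k = sqnorm n ((mat_app n S ^^ k) x)" for k
  have nonneg: "0 \<le> a k" for k by (simp add: a_def dotp_self_nonneg)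
  have conv: "(a (Suc k))\<^sup>2 \<le> a k * a (Suc (Suc k))" for k
  proof -
    have "a (Suc k) = dotp n (mat_app n S ((mat_app n S ^^ k) x)) ((mat_app n S ^^ Suc k) x)"
      by (simp add: a_def)
    also have "\<dots> = dotp n ((mat_app n S ^^ k) x) ((mat_app n S ^^ Suc (Suc k)) x)"
      using mat_app_power_adjoint[OF sym, where k = 1 and x = "(mat_app n S ^^ k) x" and y = "(mat_app n S ^^ Suc k) x"] by simp
    finally show ?thesis
      using dotp_Cauchy_Schwarz[of n "(mat_app n S ^^ k) x" "(mat_app n S ^^ Suc (Suc k)) x"] by (simp add: a_def)
  qed
  have ap: "a p \<le> walk_sum n S (2 * p) * a 0"
  proof -
    have "a p = (\<Sum>i<n. (dotp n (unit_fun i) ((mat_app n S ^^ p) x))\<^sup>2)"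
      unfolding a_def by (simp add: dotp_unit_fun power2_eq_square) (simp add: dotp_def)
    also have "\<dots> \<le> (\<Sum>i<n. sqnorm n ((mat_app n S ^^ p) (unit_fun i)) * sqnorm n x)"
      unfolding mat_app_power_adjoint[OF sym, of _ _ x] by (intro sum_mono) (rule dotp_Cauchy_Schwarz)
    finally show ?thesis by (simp add: walk_sum_even[OF sym] sum_distrib_right a_def)
  qed
  have "a 1 ^ p \<le> walk_sum n S (2 * p) * a 0 ^ p"
  proof (cases "a 0 = 0")
    case True
    then have "a 1 = 0" using ap conv[of 0] by simp
    then show ?thesis using True assms(2) by (simp add: power_0_left)
  next
    case False
    then have pos: "0 < a 0" using nonneg[of 0] by (simp add: less_le)
    have "a 1 ^ p * a 0 \<le> a 0 ^ p * a p" by (rule log_convex_power_le) (rule nonneg, rule conv)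
    also have "\<dots> \<le> a 0 ^ p * (walk_sum n S (2 * p) * a 0)" by (intro mult_left_mono ap zero_le_power nonneg)
    finally have "a 1 ^ p * a 0 \<le> (walk_sum n S (2 * p) * a 0 ^ p) * a 0" by (simp add: mult.commute mult.left_commute)
    then show ?thesis using pos by (simp only: mult_le_cancel_right_pos)
  qed
  then show ?thesis by (simp add: a_def)
qed

definition walk_edge :: "(nat \<Rightarrow> nat) \<Rightarrow> nat \<Rightarrow> nat \<times> nat" where
  "walk_edge w t = (min (w t) (w (Suc t)), max (w t) (w (Suc t)))"

definition edge_mult :: "(nat \<Rightarrow> nat) \<Rightarrow> nat \<Rightarrow> nat \<times> nat \<Rightarrow> nat" where
  "edge_mult w L e = card {t. t < L \<and> walk_edge w t = e}"

text \<open>These are the walks that survive taking expectations: a first moment vanishes, and a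
  step in place meets the zero diagonal. A traversed edge has positive multiplicity, so excluding 1
  means at least 2.\<close>

definition good_walks :: "nat \<Rightarrow> nat \<Rightarrow> (nat \<Rightarrow> nat) set" where
  "good_walks n L = {w \<in> closed_walks n L. \<forall>t<L. w t \<noteq> w (Suc t) \<and> edge_mult w L (walk_edge w t) \<noteq> 1}"

text \<open>Each time is labelled by the first visit to its vertex, a canonical code for the
  partition of times by coincidence. The labels are themselves times, so they do not depend on the
  vertex set.\<close>

definition walk_pattern :: "nat \<Rightarrow> (nat \<Rightarrow> nat) \<Rightarrow> nat \<Rightarrow> nat" where
  "walk_pattern L w = (\<lambda>t\<in>{..L}. LEAST s. w s = w t)"

lemma finite_good_walks: "finite (good_walks n L)"
  unfolding good_walks_def using finite_closed_walks by simp

lemma walk_edge_eq_iff: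
  "walk_edge w s = walk_edge w t \<longleftrightarrow>
     (w s = w t \<and> w (Suc s) = w (Suc t)) \<or> (w s = w (Suc t) \<and> w (Suc s) = w t)"
  by (auto simp: walk_edge_def min_def max_def)

lemma card_walk_vertices_le: "card (w ` {..L}) \<le> card (walk_edge w ` {..<L}) + 1"
proof (induction L)
  case (Suc L)
  show ?case
  proof (cases "w (Suc L) \<in> w ` {..L}")
    case True
    then have "card (w ` {..Suc L}) = card (w ` {..L})" by (simp add: atMost_Suc insert_absorb)
    also have "\<dots> \<le> card (walk_edge w ` {..<L}) + 1" by (rule Suc)
    also have "\<dots> \<le> card (walk_edge w ` {..<Suc L}) + 1"
      by (intro add_right_mono card_mono image_mono) auto
    finally show ?thesis .
  next
    case False
    have "walk_edge w L \<notin> walk_edge w ` {..<L}"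
    proof
      assume "walk_edge w L \<in> walk_edge w ` {..<L}"
      then obtain t where "t < L" "walk_edge w L = walk_edge w t" by auto
      then have "w (Suc L) = w t \<or> w (Suc L) = w (Suc t)" by (auto simp: walk_edge_eq_iff)
      with False \<open>t < L\<close> show False by force
    qed
    moreover have "card (w ` {..Suc L}) = Suc (card (w ` {..L}))"
      using False by (simp add: atMost_Suc)
    ultimately show ?thesis using Suc by (simp add: lessThan_Suc)
  qed
qed simp

lemma sum_edge_mult: "(\<Sum>e\<in>walk_edge w ` {..<L}. edge_mult w L e) = L"
proof -
  have "(\<Sum>e\<in>walk_edge w ` {..<L}. edge_mult w L e) = card {..<L}"
    unfolding edge_mult_def
    by (subst card_eq_sum, subst sum.group[symmetric, where g = "walk_edge w" and T = "walk_edge w ` {..<L}"])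
      (auto intro!: sum.cong arg_cong[of _ _ card])
  then show ?thesis by simp
qed

lemma good_walk_edge_mult_ge_2:
  assumes "w \<in> good_walks n L" "t < L"
  shows "2 \<le> edge_mult w L (walk_edge w t)"
proof -
  have "t \<in> {s. s < L \<and> walk_edge w s = walk_edge w t}" using assms(2) by simp
  then have "edge_mult w L (walk_edge w t) \<noteq> 0" unfolding edge_mult_def by (subst card_eq_0_iff) auto
  moreover have "edge_mult w L (walk_edge w t) \<noteq> 1" using assms by (auto simp: good_walks_def)
  ultimately show ?thesis by linarith
qed

text \<open>Every edge uses at least two of the \<open>2 * p\<close> steps, leaving at most
  \<open>p\<close> edges.\<close>

lemma card_good_walk_vertices:
  assumes "w \<in> good_walks n (2 * p)"
  shows "card (w ` {..2 * p}) \<le> p + 1"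
proof -
  have "card (walk_edge w ` {..<2 * p}) * 2 \<le> (\<Sum>e\<in>walk_edge w ` {..<2 * p}. edge_mult w (2 * p) e)"
    using sum_bounded_below[of "walk_edge w ` {..<2 * p}" 2 "edge_mult w (2 * p)"]
      good_walk_edge_mult_ge_2[OF assms] by force
  then have "card (walk_edge w ` {..<2 * p}) \<le> p" by (simp add: sum_edge_mult)
  with card_walk_vertices_le[of w "2 * p"] show ?thesis by simp
qed

lemma walk_pattern_eq_iff:
  assumes "s \<le> L" "t \<le> L"
  shows "walk_pattern L w s = walk_pattern L w t \<longleftrightarrow> w s = w t"
proof
  have *: "w (LEAST s. w s = w t) = w t" for t by (rule LeastI) simp
  assume "walk_pattern L w s = walk_pattern L w t"
  then have "(LEAST s'. w s' = w s) = (LEAST s'. w s' = w t)" using assms by (simp add: walk_pattern_def)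
  then show "w s = w t" using * by metis
qed (use assms in \<open>simp add: walk_pattern_def\<close>)

lemma walk_pattern_le: "t \<le> L \<Longrightarrow> walk_pattern L w t \<le> t"
  by (simp add: walk_pattern_def Least_le)

lemma walk_at_pattern: "t \<le> L \<Longrightarrow> w (walk_pattern L w t) = w t"
  by (simp add: walk_pattern_def) (rule LeastI, simp)

lemma walk_pattern_cong:
  assumes "\<And>s t. s \<le> L \<Longrightarrow> t \<le> L \<Longrightarrow> w s = w t \<longleftrightarrow> w' s = w' t"
  shows "walk_pattern L w = walk_pattern L w'"
proof
  fix t
  show "walk_pattern L w t = walk_pattern L w' t"
  proof (cases "t \<le> L")
    case True
    have *: "walk_pattern L v t \<le> L" for v using walk_pattern_le[OF True, of v] True by simp
    have le: "walk_pattern L v t \<le> walk_pattern L v' t"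
      if "\<And>s t. s \<le> L \<Longrightarrow> t \<le> L \<Longrightarrow> v s = v t \<longleftrightarrow> v' s = v' t" for v v' :: "nat \<Rightarrow> nat"
    proof -
      have "v' (walk_pattern L v' t) = v' t" by (rule walk_at_pattern[OF True])
      then have "v (walk_pattern L v' t) = v t" using that[OF *[of v'] True] by simp
      then show ?thesis using True by (simp add: walk_pattern_def[of L v] Least_le)
    qed
    show ?thesis by (intro order_antisym le) (simp_all add: assms)
  qed (simp add: walk_pattern_def)
qed

text \<open>Being good depends only on which times coincide, so the property can be transported
  between vertex sets of different sizes.\<close>

lemma good_walks_cong:
  assumes same: "\<And>s t. s \<le> L \<Longrightarrow> t \<le> L \<Longrightarrow> w s = w t \<longleftrightarrow> w' s = w' t"
    and w: "w \<in> good_walks n L" and w': "w' \<in> PiE {..L} (\<lambda>_. {..<m})"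
  shows "w' \<in> good_walks m L"
proof -
  have edges: "walk_edge w s = walk_edge w t \<longleftrightarrow> walk_edge w' s = walk_edge w' t" if "s < L" "t < L" for s t
    unfolding walk_edge_eq_iff using same[of s t] same[of "Suc s" "Suc t"] same[of s "Suc t"] same[of "Suc s" t] that
    by simp
  have mult: "edge_mult w' L (walk_edge w' t) = edge_mult w L (walk_edge w t)" if "t < L" for t
    unfolding edge_mult_def using edges that by (intro arg_cong[of _ _ card]) auto
  have "w' t \<noteq> w' (Suc t)" if "t < L" for t
    using same[of t "Suc t"] that w by (simp add: good_walks_def)
  moreover have "w' 0 = w' L" using same[of 0 L] w by (simp add: good_walks_def closed_walks_def)
  ultimately show ?thesis using w w' mult by (auto simp: good_walks_def closed_walks_def)
qed

text \<open>Choosing the values one by one leaves at least \<open>k\<close> free values each time, a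
  crude lower bound for a falling factorial.\<close>

lemma card_injective_funs_ge:
  fixes V :: "nat set"
  assumes "finite V" "k + card V \<le> r"
  shows "k ^ card V \<le> card {f \<in> PiE V (\<lambda>_. {..<r}). inj_on f V}"
  using assms
proof (induction V rule: finite_induct)
  case empty
  then show ?case by (simp add: PiE_empty_domain Collect_conv_if)
next
  case (insert x V)
  let ?I = "\<lambda>V. {f \<in> PiE V (\<lambda>_. {..<r}). inj_on f V}"
  have finI: "finite (?I W)" if "finite W" for W :: "nat set"
    using finite_PiE[OF that, of "\<lambda>_. {..<r}"] by simp
  have inj: "inj_on (\<lambda>(f, y). f(x := y)) (Sigma (?I V) (\<lambda>f. {..<r} - f ` V))"
  proof (rule inj_onI, clarsimp)
    fix f y f' y'
    assume f: "f \<in> PiE V (\<lambda>_. {..<r})" "f' \<in> PiE V (\<lambda>_. {..<r})" and eq: "f(x := y) = f'(x := y')"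
    from fun_cong[OF eq, of x] have "y = y'" by simp
    moreover have "f = f'"
    proof
      fix z
      show "f z = f' z"
        using fun_cong[OF eq, of z] f insert.hyps(2) by (cases "z = x") (auto simp: PiE_def extensional_def)
    qed
    ultimately show "f = f' \<and> y = y'" by simp
  qed
  have sub: "(\<lambda>(f, y). f(x := y)) ` Sigma (?I V) (\<lambda>f. {..<r} - f ` V) \<subseteq> ?I (insert x V)"
  proof
    fix h assume "h \<in> (\<lambda>(f, y). f(x := y)) ` Sigma (?I V) (\<lambda>f. {..<r} - f ` V)"
    then obtain f y where h: "h = f(x := y)"
      and f: "f \<in> PiE V (\<lambda>_. {..<r})" "inj_on f V" "y \<in> {..<r}" "y \<notin> f ` V" by auto
    have "h \<in> PiE (insert x V) (\<lambda>_. {..<r})" using f by (auto simp: h PiE_def extensional_def)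
    moreover have "h ` V = f ` V" using insert.hyps(2) by (auto simp: h)
    moreover have "inj_on h V" unfolding h using f by (intro inj_on_fun_updI)
    ultimately show "h \<in> ?I (insert x V)" using f(4) insert.hyps(2) by (simp add: h)
  qed
  have "k ^ card (insert x V) = k ^ card V * k" using insert.hyps by simp
  also have "\<dots> \<le> card (?I V) * k" using insert by simp
  also have "\<dots> = (\<Sum>f\<in>?I V. k)" by simp
  also have "\<dots> \<le> (\<Sum>f\<in>?I V. card ({..<r} - f ` V))"
  proof (intro sum_mono)
    fix f assume "f \<in> ?I V"
    then have "card (f ` V) = card V" "f ` V \<subseteq> {..<r}" by (auto simp: card_image)
    then show "k \<le> card ({..<r} - f ` V)"
      using insert.prems insert.hyps by (simp add: card_Diff_subset)
  qed
  also have "\<dots> = card (Sigma (?I V) (\<lambda>f. {..<r} - f ` V))"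
    using finI[OF insert.hyps(1)] by (subst card_SigmaI) auto
  also have "\<dots> = card ((\<lambda>(f, y). f(x := y)) ` Sigma (?I V) (\<lambda>f. {..<r} - f ` V))"
    by (rule card_image[OF inj, symmetric])
  also have "\<dots> \<le> card (?I (insert x V))"
    using finI[of "insert x V"] insert.hyps(1) by (intro card_mono sub) auto
  finally show ?case .
qed

text \<open>Within a pattern, a walk is determined by its values at the times of first
  visits.\<close>

lemma card_pattern_class_le:
  "card {w \<in> good_walks n L. walk_pattern L w = \<sigma>} \<le> n ^ card (\<sigma> ` {..L})"
proof (cases "{w \<in> good_walks n L. walk_pattern L w = \<sigma>} = {}")
  case False
  then obtain w0 where w0: "walk_pattern L w0 = \<sigma>" by auto
  have \<sigma>L: "\<sigma> t \<le> L" if "t \<le> L" for t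
    using walk_pattern_le[OF that, of w0] that w0 by simp
  let ?C = "{w \<in> good_walks n L. walk_pattern L w = \<sigma>}"
  have "inj_on (\<lambda>w. restrict w (\<sigma> ` {..L})) ?C"
  proof (rule inj_onI)
    fix w w' assume w: "w \<in> ?C" and w': "w' \<in> ?C"
      and eq: "restrict w (\<sigma> ` {..L}) = restrict w' (\<sigma> ` {..L})"
    show "w = w'"
    proof
      fix t
      show "w t = w' t"
      proof (cases "t \<le> L")
        case True
        have "w t = w (\<sigma> t)" "w' t = w' (\<sigma> t)"
          using walk_at_pattern[OF True, of w] walk_at_pattern[OF True, of w'] w w' by simp_all
        moreover have "w (\<sigma> t) = w' (\<sigma> t)" using fun_cong[OF eq, of "\<sigma> t"] True by simp
        ultimately show ?thesis by simp
      next
        case False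
        then show ?thesis using w w' by (auto simp: good_walks_def closed_walks_def PiE_def extensional_def)
      qed
    qed
  qed
  moreover have "(\<lambda>w. restrict w (\<sigma> ` {..L})) ` ?C \<subseteq> PiE (\<sigma> ` {..L}) (\<lambda>_. {..<n})"
    using \<sigma>L by (force simp: good_walks_def closed_walks_def)
  ultimately have "card ?C \<le> card (PiE (\<sigma> ` {..L}) (\<lambda>_. {..<n}))"
    by (intro card_inj_on_le finite_PiE) auto
  then show ?thesis by (simp add: card_PiE)
next
  case True
  show ?thesis unfolding True by simp
qed

text \<open>Every injective labelling of the first-visit times, composed with
  \<open>\<sigma>\<close>, is a walk with pattern \<open>\<sigma>\<close>; it is good because
  \<open>w0\<close> is.\<close>

lemma card_pattern_class_ge:
  assumes w0: "w0 \<in> good_walks n L" "walk_pattern L w0 = \<sigma>" and r: "k + card (\<sigma> ` {..L}) \<le> r"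
  shows "k ^ card (\<sigma> ` {..L}) \<le> card {w \<in> good_walks r L. walk_pattern L w = \<sigma>}"
proof -
  let ?V = "\<sigma> ` {..L}"
  let ?I = "{f \<in> PiE ?V (\<lambda>_. {..<r}). inj_on f ?V}"
  let ?C = "{w \<in> good_walks r L. walk_pattern L w = \<sigma>}"
  have \<sigma>\<sigma>: "\<sigma> (\<sigma> t) = \<sigma> t" if "t \<le> L" for t
    using walk_at_pattern[OF that, of w0] walk_pattern_le[OF that, of w0] that
      walk_pattern_eq_iff[of "\<sigma> t" L t w0] unfolding w0(2) by simp
  have "inj_on (\<lambda>f. \<lambda>t\<in>{..L}. f (\<sigma> t)) ?I"
  proof (rule inj_onI)
    fix f f' assume f: "f \<in> ?I" "f' \<in> ?I" and eq: "(\<lambda>t\<in>{..L}. f (\<sigma> t)) = (\<lambda>t\<in>{..L}. f' (\<sigma> t))"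
    show "f = f'"
    proof
      fix z
      show "f z = f' z"
      proof (cases "z \<in> ?V")
        case True
        then obtain t where "t \<le> L" "z = \<sigma> t" by auto
        then show ?thesis using fun_cong[OF eq, of t] by simp
      qed (use f in \<open>auto simp: PiE_def extensional_def\<close>)
    qed
  qed
  moreover have "(\<lambda>f. \<lambda>t\<in>{..L}. f (\<sigma> t)) ` ?I \<subseteq> ?C"
  proof (rule image_subsetI)
    fix f assume f: "f \<in> ?I"
    define w where "w = (\<lambda>t\<in>{..L}. f (\<sigma> t))"
    have same: "w0 s = w0 t \<longleftrightarrow> w s = w t" if "s \<le> L" "t \<le> L" for s t
      using walk_pattern_eq_iff[OF that, of w0] that f unfolding w0(2) w_def by (auto simp: inj_on_eq_iff)
    have "w \<in> PiE {..L} (\<lambda>_. {..<r})" using f by (auto simp: w_def)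
    with good_walks_cong[OF same w0(1)] have "w \<in> good_walks r L" by blast
    moreover have "walk_pattern L w = \<sigma>" using walk_pattern_cong[OF same] w0(2) by simp
    ultimately show "(\<lambda>t\<in>{..L}. f (\<sigma> t)) \<in> ?C" by (simp add: w_def)
  qed
  ultimately have "card ?I \<le> card ?C" by (intro card_inj_on_le) (auto simp: finite_good_walks)
  with card_injective_funs_ge[OF _ r] show ?thesis by (meson finite_atMost finite_imageI le_trans)
qed

lemma card_walk_vertices_pattern:
  assumes "walk_pattern L w = \<sigma>"
  shows "card (w ` {..L}) = card (\<sigma> ` {..L})"
proof -
  have "w ` {..L} = w ` (\<sigma> ` {..L})"
    using walk_at_pattern[of _ L w] assms by (force simp: image_image)
  moreover have "inj_on w (\<sigma> ` {..L})"
  proof (rule inj_onI)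
    fix x y assume "x \<in> \<sigma> ` {..L}" "y \<in> \<sigma> ` {..L}" "w x = w y"
    then obtain s t where st: "s \<le> L" "t \<le> L" "x = \<sigma> s" "y = \<sigma> t" by auto
    then have "w s = w t" using walk_at_pattern[of s L w] walk_at_pattern[of t L w] assms \<open>w x = w y\<close> by simp
    then show "x = y" using walk_pattern_eq_iff[OF st(1,2), of w] assms st by simp
  qed
  ultimately show ?thesis by (simp add: card_image)
qed

text \<open>Walks are grouped by their coincidence pattern; each pattern with \<open>m\<close> distinct vertices has at most
  \<open>n ^ m\<close> realisations in \<open>{..<n}\<close> and at least \<open>p ^ m\<close> in \<open>{..<2 * p + 1}\<close>.\<close>

lemma weighted_good_walks_le:
  fixes \<rho> :: real
  assumes \<rho>: "0 \<le> \<rho>" "real n * \<rho> \<le> real p" and p: "0 < p"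
  shows "(\<Sum>w\<in>good_walks n (2 * p). \<rho> ^ (card (w ` {..2 * p}) - 1)) \<le>
    real n * real (card (good_walks (2 * p + 1) (2 * p)))"
proof -
  let ?L = "2 * p"
  let ?r = "2 * p + 1"
  define \<Sigma> where "\<Sigma> = walk_pattern ?L ` good_walks n ?L"
  have fin: "finite \<Sigma>" by (simp add: \<Sigma>_def finite_good_walks)
  let ?C = "\<lambda>n \<sigma>. {w \<in> good_walks n ?L. walk_pattern ?L w = \<sigma>}"
  have "(\<Sum>w\<in>good_walks n ?L. \<rho> ^ (card (w ` {..?L}) - 1)) =
      (\<Sum>\<sigma>\<in>\<Sigma>. \<Sum>w\<in>?C n \<sigma>. \<rho> ^ (card (w ` {..?L}) - 1))"
    by (intro sum.group[symmetric] finite_good_walks fin) (simp add: \<Sigma>_def)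
  also have "\<dots> \<le> (\<Sum>\<sigma>\<in>\<Sigma>. real n * real (card (?C ?r \<sigma>)))"
  proof (intro sum_mono)
    fix \<sigma> assume "\<sigma> \<in> \<Sigma>"
    then obtain w0 where w0: "w0 \<in> good_walks n ?L" "walk_pattern ?L w0 = \<sigma>" by (auto simp: \<Sigma>_def)
    define m where "m = card (\<sigma> ` {..?L})"
    have m: "m \<le> p + 1" "0 < m"
      using card_good_walk_vertices[OF w0(1)] card_walk_vertices_pattern[OF w0(2)]
      by (auto simp: m_def card_gt_0_iff)
    have "(\<Sum>w\<in>?C n \<sigma>. \<rho> ^ (card (w ` {..?L}) - 1)) = (\<Sum>w\<in>?C n \<sigma>. \<rho> ^ (m - 1))"
    proof (intro sum.cong refl)
      fix w assume "w \<in> ?C n \<sigma>"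
      then have "walk_pattern ?L w = \<sigma>" by simp
      from card_walk_vertices_pattern[OF this] show "\<rho> ^ (card (w ` {..?L}) - 1) = \<rho> ^ (m - 1)"
        by (simp only: m_def)
    qed
    also have "\<dots> = real (card (?C n \<sigma>)) * \<rho> ^ (m - 1)" by simp
    also have "\<dots> \<le> real (n ^ m) * \<rho> ^ (m - 1)"
      using card_pattern_class_le[of n ?L \<sigma>] \<rho> by (intro mult_right_mono) (auto simp: m_def simp flip: of_nat_power)
    also have "\<dots> = real n * (real n * \<rho>) ^ (m - 1)"
      using m(2) by (cases m) (simp_all add: power_mult_distrib)
    also have "\<dots> \<le> real n * real p ^ (m - 1)"
      using \<rho> by (intro mult_left_mono power_mono) auto
    \<comment> \<open>One factor \<open>p\<close> is given away so that the exponent matches the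
      lower count of the pattern.\<close>
    also have "\<dots> \<le> real n * real p ^ m"
      using p by (intro mult_left_mono power_increasing) auto
    \<comment> \<open>Since \<open>m \<le> p + 1\<close>, the dimension \<open>2 * p + 1\<close>
      leaves at least \<open>p\<close> values beyond the \<open>m\<close> in use.\<close>
    also have "\<dots> \<le> real n * real (card (?C ?r \<sigma>))"
      using card_pattern_class_ge[OF w0, of p ?r] m
      by (intro mult_left_mono) (auto simp: m_def simp flip: of_nat_power)
    finally show "(\<Sum>w\<in>?C n \<sigma>. \<rho> ^ (card (w ` {..?L}) - 1)) \<le> real n * real (card (?C ?r \<sigma>))" .
  qed
  also have "\<dots> = real n * real (\<Sum>\<sigma>\<in>\<Sigma>. card (?C ?r \<sigma>))" by (simp add: sum_distrib_left)
  also have "(\<Sum>\<sigma>\<in>\<Sigma>. card (?C ?r \<sigma>)) = card (\<Union>\<sigma>\<in>\<Sigma>. ?C ?r \<sigma>)"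
    by (intro card_UN_disjoint[symmetric] fin) (auto simp: finite_good_walks)
  also have "real n * real \<dots> \<le> real n * real (card (good_walks ?r ?L))"
    by (intro mult_left_mono of_nat_mono card_mono finite_good_walks) auto
  finally show ?thesis .
qed

section \<open>Expected walk sums of random symmetric matrices\<close>

definition sym_mat :: "(nat \<times> nat \<Rightarrow> real) \<Rightarrow> nat \<Rightarrow> nat \<Rightarrow> real" where
  "sym_mat g i j = (if i = j then 0 else g (min i j, max i j))"

definition vertex_pairs :: "nat \<Rightarrow> (nat \<times> nat) set" where
  "vertex_pairs n = {(i, j). i < j \<and> j < n}"

lemma finite_vertex_pairs: "finite (vertex_pairs n)"
  by (rule finite_subset[of _ "{..<n} \<times> {..<n}"]) (auto simp: vertex_pairs_def)

lemma sym_fun_sym_mat: "sym_fun n (sym_mat g)"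
  by (auto simp: sym_fun_def sym_mat_def min.commute max.commute)

text \<open>Grouping the steps by edge produces one factor for each independent entry. Edges off the
  walk get exponent 0, and a step in place meets the zero diagonal.\<close>

lemma prod_walk_sym_mat:
  assumes w: "w \<in> closed_walks n L"
  shows "(\<Prod>t<L. sym_mat g (w t) (w (Suc t))) =
    (if \<forall>t<L. w t \<noteq> w (Suc t) then \<Prod>e\<in>vertex_pairs n. g e ^ edge_mult w L e else 0)"
proof (cases "\<forall>t<L. w t \<noteq> w (Suc t)")
  case True
  have bound: "w t < n" if "t \<le> L" for t using w that by (auto simp: closed_walks_def)
  have edge: "walk_edge w t \<in> vertex_pairs n" if "t < L" for t
    using True that bound[of t] bound[of "Suc t"] by (auto simp: walk_edge_def vertex_pairs_def min_def max_def)
  have "(\<Prod>t<L. sym_mat g (w t) (w (Suc t))) = (\<Prod>t<L. g (walk_edge w t))"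
    using True by (intro prod.cong) (auto simp: sym_mat_def walk_edge_def)
  also have "\<dots> = (\<Prod>e\<in>vertex_pairs n. \<Prod>t | t \<in> {..<L} \<and> walk_edge w t = e. g (walk_edge w t))"
    using edge by (intro prod.group[symmetric] finite_vertex_pairs) auto
  also have "\<dots> = (\<Prod>e\<in>vertex_pairs n. g e ^ edge_mult w L e)"
  proof (intro prod.cong refl)
    fix e
    have "(\<Prod>t | t \<in> {..<L} \<and> walk_edge w t = e. g (walk_edge w t)) = (\<Prod>t | t \<in> {..<L} \<and> walk_edge w t = e. g e)"
      by (intro prod.cong) auto
    then show "(\<Prod>t | t \<in> {..<L} \<and> walk_edge w t = e. g (walk_edge w t)) = g e ^ edge_mult w L e"
      by (simp add: edge_mult_def)
  qed
  finally show ?thesis using True by simp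
next
  case False
  then obtain t where "t < L" "w t = w (Suc t)" by auto
  then have "(\<Prod>t<L. sym_mat g (w t) (w (Suc t))) = 0"
    by (intro prod_zero bexI[of _ t]) (auto simp: sym_mat_def)
  then show ?thesis by (subst if_not_P[OF False])
qed

lemma finite_set_Pi_pmf:
  fixes p :: "'a \<Rightarrow> 'b :: finite pmf"
  assumes "finite A"
  shows "finite (set_pmf (Pi_pmf A d p))"
  unfolding set_Pi_pmf[OF assms] by (intro finite_PiE_dflt assms) simp

lemma expectation_prod_Pi_pmf_real:
  fixes f :: "'a \<Rightarrow> 'b :: finite \<Rightarrow> real"
  assumes fin: "finite A"
  shows "measure_pmf.expectation (Pi_pmf A d p) (\<lambda>\<omega>. \<Prod>e\<in>A. f e (\<omega> e)) = (\<Prod>e\<in>A. measure_pmf.expectation (p e) (f e))"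
proof -
  have int: "integrable (measure_pmf (Pi_pmf A d p)) g" for g :: "('a \<Rightarrow> 'b) \<Rightarrow> real"
    by (rule integrable_measure_pmf_finite[OF finite_set_Pi_pmf[OF fin]])
  have "prob_space.indep_vars (measure_pmf (Pi_pmf A d p)) (\<lambda>_. borel) (\<lambda>e \<omega>. f e (\<omega> e)) A"
    by (rule prob_space.indep_vars_compose2[OF prob_space_measure_pmf indep_vars_Pi_pmf[OF fin]]) simp
  then have "measure_pmf.expectation (Pi_pmf A d p) (\<lambda>\<omega>. \<Prod>e\<in>A. f e (\<omega> e)) =
      (\<Prod>e\<in>A. measure_pmf.expectation (Pi_pmf A d p) (\<lambda>\<omega>. f e (\<omega> e)))"
    by (intro prob_space.indep_vars_lebesgue_integral[OF prob_space_measure_pmf] fin int)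
  also have "\<dots> = (\<Prod>e\<in>A. measure_pmf.expectation (p e) (f e))"
  proof (intro prod.cong refl)
    fix e assume "e \<in> A"
    have "measure_pmf.expectation (map_pmf (\<lambda>\<omega>. \<omega> e) (Pi_pmf A d p)) (f e) =
        measure_pmf.expectation (Pi_pmf A d p) (\<lambda>\<omega>. f e (\<omega> e))" by simp
    then show "measure_pmf.expectation (Pi_pmf A d p) (\<lambda>\<omega>. f e (\<omega> e)) = measure_pmf.expectation (p e) (f e)"
      using \<open>e \<in> A\<close> by (simp add: Pi_pmf_component[OF fin])
  qed
  finally show ?thesis .
qed

lemma expectation_walk_sum:
  fixes F :: "nat \<times> nat \<Rightarrow> 'b :: finite \<Rightarrow> real"
  shows "measure_pmf.expectation (Pi_pmf (vertex_pairs n) d p) (\<lambda>\<omega>. walk_sum n (sym_mat (\<lambda>e. F e (\<omega> e))) L) =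
    (\<Sum>w | w \<in> closed_walks n L \<and> (\<forall>t<L. w t \<noteq> w (Suc t)).
       \<Prod>e\<in>vertex_pairs n. measure_pmf.expectation (p e) (\<lambda>x. F e x ^ edge_mult w L e))"
proof -
  let ?W = "{w. w \<in> closed_walks n L \<and> (\<forall>t<L. w t \<noteq> w (Suc t))}"
  have int: "integrable (measure_pmf (Pi_pmf (vertex_pairs n) d p)) g" for g :: "(nat \<times> nat \<Rightarrow> 'b) \<Rightarrow> real"
    by (rule integrable_measure_pmf_finite[OF finite_set_Pi_pmf[OF finite_vertex_pairs]])
  have "walk_sum n (sym_mat (\<lambda>e. F e (\<omega> e))) L = (\<Sum>w\<in>?W. \<Prod>e\<in>vertex_pairs n. F e (\<omega> e) ^ edge_mult w L e)" for \<omega>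
  proof -
    have "walk_sum n (sym_mat (\<lambda>e. F e (\<omega> e))) L = (\<Sum>w\<in>closed_walks n L.
        if \<forall>t<L. w t \<noteq> w (Suc t) then \<Prod>e\<in>vertex_pairs n. F e (\<omega> e) ^ edge_mult w L e else 0)"
      unfolding walk_sum_def by (intro sum.cong refl) (rule prod_walk_sym_mat)
    then show ?thesis by (simp add: sum.inter_filter finite_closed_walks)
  qed
  then have "measure_pmf.expectation (Pi_pmf (vertex_pairs n) d p) (\<lambda>\<omega>. walk_sum n (sym_mat (\<lambda>e. F e (\<omega> e))) L) =
      (\<Sum>w\<in>?W. measure_pmf.expectation (Pi_pmf (vertex_pairs n) d p) (\<lambda>\<omega>. \<Prod>e\<in>vertex_pairs n. F e (\<omega> e) ^ edge_mult w L e))"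
    by (simp only: Bochner_Integration.integral_sum[OF int])
  also have "\<dots> = (\<Sum>w\<in>?W. \<Prod>e\<in>vertex_pairs n. measure_pmf.expectation (p e) (\<lambda>x. F e x ^ edge_mult w L e))"
    by (intro sum.cong refl expectation_prod_Pi_pmf_real finite_vertex_pairs)
  finally show ?thesis .
qed

text \<open>For \<open>m \<ge> 2\<close> both terms carry \<open>q * (1 - q)\<close>, and the
  remaining factors add up to at most \<open>(1 - q) + q = 1\<close>.\<close>

lemma centered_bernoulli_moment:
  fixes q \<rho> :: real
  assumes q: "0 \<le> q" "q \<le> \<rho>" "\<rho> \<le> 1"
  shows "\<bar>measure_pmf.expectation (bernoulli_pmf q) (\<lambda>x. (of_bool x - q) ^ m)\<bar> \<le>
    (if m = 0 then 1 else if m = 1 then 0 else \<rho>)"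
proof -
  have e: "measure_pmf.expectation (bernoulli_pmf q) (\<lambda>x. (of_bool x - q) ^ m) = q * (1 - q) ^ m + (1 - q) * (- q) ^ m"
    using q by (simp add: integral_bernoulli_pmf)
  consider "m = 0" | "m = 1" | k where "m = Suc (Suc k)" by (metis One_nat_def not0_implies_Suc)
  then show ?thesis
  proof cases
    case 3
    have "\<bar>q * (1 - q) ^ m + (1 - q) * (- q) ^ m\<bar> \<le> \<bar>q * (1 - q) ^ m\<bar> + \<bar>(1 - q) * (- q) ^ m\<bar>" by (rule abs_triangle_ineq)
    also have "\<dots> = q * (1 - q) * ((1 - q) ^ Suc k) + q * (1 - q) * q ^ Suc k"
      using q by (simp add: 3 abs_mult power_abs)
    also have "\<dots> \<le> q * (1 - q) * (1 - q) + q * (1 - q) * q"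
      using q power_Suc_le_self[of "1 - q" k] power_Suc_le_self[of q k]
      by (intro add_mono mult_left_mono) (auto simp: power_le_one mult_left_le)
    also have "\<dots> = q * (1 - q)" by (simp add: algebra_simps)
    also have "\<dots> \<le> \<rho>" using q by (intro order_trans[OF mult_left_le]) auto
    finally show ?thesis unfolding e using 3 by simp
  qed (unfold e, use q in auto)
qed

lemma two_point_moment:
  "measure_pmf.expectation (bernoulli_pmf (1 / 3)) (\<lambda>x. (if x then 2 else - 1 :: real) ^ m) =
     (2 ^ m + 2 * (- 1) ^ m) / 3"
  by (simp add: integral_bernoulli_pmf if_distrib[of "\<lambda>x. x ^ m"] field_simps)

text \<open>Even exponents from 2 give at least \<open>(4 + 2) / 3\<close>, odd exponents from 3 at
  least \<open>(8 - 2) / 3\<close>. The excluded exponent 1 gives the mean 0.\<close>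

lemma two_point_moment_ge_1:
  assumes "m \<noteq> 1"
  shows "1 \<le> (2 ^ m + 2 * (- 1) ^ m :: real) / 3"
proof -
  have "m = 0 \<or> (even m \<and> 2 \<le> m) \<or> (odd m \<and> 3 \<le> m)"
    using assms by presburger
  then consider "m = 0" | "even m" "2 \<le> m" | "odd m" "3 \<le> m" by blast
  then show ?thesis
  proof cases
    case 2
    have "(2::real) ^ 2 \<le> 2 ^ m" by (rule power_increasing[OF 2(2)]) simp
    then show ?thesis using 2 by simp
  next
    case 3
    have "(2::real) ^ 3 \<le> 2 ^ m" by (rule power_increasing[OF 3(2)]) simp
    then show ?thesis using 3 by simp
  qed simp
qed

lemma edge_mult_pos_iff: "0 < edge_mult w L e \<longleftrightarrow> e \<in> walk_edge w ` {..<L}"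
proof -
  have "finite {t. t < L \<and> walk_edge w t = e}" by simp
  then show ?thesis unfolding edge_mult_def by (auto simp: card_gt_0_iff)
qed

lemma walk_edge_in_vertex_pairs:
  assumes "w \<in> closed_walks n L" "t < L" "w t \<noteq> w (Suc t)"
  shows "walk_edge w t \<in> vertex_pairs n"
proof -
  have "w t < n" "w (Suc t) < n" using assms by (auto simp: closed_walks_def)
  then show ?thesis using assms(3) by (auto simp: walk_edge_def vertex_pairs_def min_def max_def)
qed

text \<open>A simply traversed edge contributes a vanishing mean. Otherwise each edge contributes at
  most \<open>\<rho>\<close>, and there are at least as many edges as vertices minus one;
  \<open>\<rho> \<le> 1\<close> lets the exponent drop to that number.\<close>

lemma expectation_walk_sum_centered_le:
  fixes q :: "nat \<times> nat \<Rightarrow> real"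
  assumes q: "\<And>e. e \<in> vertex_pairs n \<Longrightarrow> 0 \<le> q e" "\<And>e. e \<in> vertex_pairs n \<Longrightarrow> q e \<le> \<rho>"
    and \<rho>: "0 \<le> \<rho>" "\<rho> \<le> 1"
  shows "measure_pmf.expectation (Pi_pmf (vertex_pairs n) d (\<lambda>e. bernoulli_pmf (q e)))
      (\<lambda>\<omega>. walk_sum n (sym_mat (\<lambda>e. of_bool (\<omega> e) - q e)) L) \<le>
    (\<Sum>w\<in>good_walks n L. \<rho> ^ (card (w ` {..L}) - 1))"
proof -
  let ?W = "{w. w \<in> closed_walks n L \<and> (\<forall>t<L. w t \<noteq> w (Suc t))}"
  let ?E = "\<lambda>w e. measure_pmf.expectation (bernoulli_pmf (q e)) (\<lambda>x. (of_bool x - q e) ^ edge_mult w L e)"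
  have finW: "finite ?W" using finite_closed_walks by simp
  have sub: "good_walks n L \<subseteq> ?W" by (auto simp: good_walks_def)
  have bound: "(\<Prod>e\<in>vertex_pairs n. ?E w e) \<le> (if w \<in> good_walks n L then \<rho> ^ (card (w ` {..L}) - 1) else 0)"
    if w: "w \<in> ?W" for w
  proof (cases "w \<in> good_walks n L")
    case True
    have "(\<Prod>e\<in>vertex_pairs n. ?E w e) \<le> (\<Prod>e\<in>vertex_pairs n. \<bar>?E w e\<bar>)"
      unfolding abs_prod[symmetric] by (rule abs_ge_self)
    also have "\<dots> \<le> (\<Prod>e\<in>vertex_pairs n. if e \<in> walk_edge w ` {..<L} then \<rho> else 1)"
    proof (intro prod_mono conjI)
      fix e assume e: "e \<in> vertex_pairs n"
      show "\<bar>?E w e\<bar> \<le> (if e \<in> walk_edge w ` {..<L} then \<rho> else 1)"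
      proof (cases "e \<in> walk_edge w ` {..<L}")
        case e': True
        then have "2 \<le> edge_mult w L e" using good_walk_edge_mult_ge_2[OF True] by auto
        then show ?thesis
          using centered_bernoulli_moment[OF q(1)[OF e] q(2)[OF e] \<rho>(2), of "edge_mult w L e"] e' by simp
      next
        case False
        then have "edge_mult w L e = 0" using edge_mult_pos_iff[of w L e] by simp
        with False show ?thesis by simp
      qed
    qed simp
    also have "\<dots> = (\<Prod>e\<in>walk_edge w ` {..<L}. \<rho>)"
      using walk_edge_in_vertex_pairs[of w n L] w finite_vertex_pairs
      by (intro prod.mono_neutral_cong_right) auto
    also have "\<dots> = \<rho> ^ card (walk_edge w ` {..<L})" by simp
    also have "\<dots> \<le> \<rho> ^ (card (w ` {..L}) - 1)"
      using card_walk_vertices_le[of w L] \<rho> by (intro power_decreasing) auto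
    finally show ?thesis using True by simp
  next
    case False
    with w obtain t where t: "t < L" "edge_mult w L (walk_edge w t) = 1" by (auto simp: good_walks_def)
    have e: "walk_edge w t \<in> vertex_pairs n" using walk_edge_in_vertex_pairs w t by blast
    have "?E w (walk_edge w t) = 0"
      using centered_bernoulli_moment[OF q(1)[OF e] q(2)[OF e] \<rho>(2), of 1] t by simp
    then have "(\<Prod>e\<in>vertex_pairs n. ?E w e) = 0"
      using e finite_vertex_pairs by (intro prod_zero) auto
    with False show ?thesis by simp
  qed
  have "measure_pmf.expectation (Pi_pmf (vertex_pairs n) d (\<lambda>e. bernoulli_pmf (q e)))
      (\<lambda>\<omega>. walk_sum n (sym_mat (\<lambda>e. of_bool (\<omega> e) - q e)) L) = (\<Sum>w\<in>?W. \<Prod>e\<in>vertex_pairs n. ?E w e)"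
    by (rule expectation_walk_sum[where F = "\<lambda>e x. of_bool x - q e"])
  also have "\<dots> \<le> (\<Sum>w\<in>?W. if w \<in> good_walks n L then \<rho> ^ (card (w ` {..L}) - 1) else 0)"
    by (intro sum_mono bound)
  also have "\<dots> = (\<Sum>w\<in>good_walks n L. \<rho> ^ (card (w ` {..L}) - 1))"
    using sub finW by (intro sum.mono_neutral_cong_right) auto
  finally show ?thesis .
qed

text \<open>No moment of the comparison entries is negative, so the walks that are not good may be
  dropped, and every good walk contributes at least 1.\<close>

lemma card_good_walks_le_expectation:
  "real (card (good_walks r L)) \<le>
     measure_pmf.expectation (Pi_pmf (vertex_pairs r) False (\<lambda>_. bernoulli_pmf (1 / 3)))
      (\<lambda>\<omega>. walk_sum r (sym_mat (\<lambda>e. if \<omega> e then 2 else - 1)) L)"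
proof -
  let ?W = "{w. w \<in> closed_walks r L \<and> (\<forall>t<L. w t \<noteq> w (Suc t))}"
  let ?E = "\<lambda>w e. (2 ^ edge_mult w L e + 2 * (- 1) ^ edge_mult w L e :: real) / 3"
  have finW: "finite ?W" using finite_closed_walks by simp
  have sub: "good_walks r L \<subseteq> ?W" by (auto simp: good_walks_def)
  have "(\<Sum>w\<in>?W. if w \<in> good_walks r L then 1 else 0) = (\<Sum>w\<in>good_walks r L. 1 :: real)"
    using sub finW by (intro sum.mono_neutral_cong_right) auto
  then have "real (card (good_walks r L)) = (\<Sum>w\<in>?W. if w \<in> good_walks r L then 1 else 0)" by simp
  also have "\<dots> \<le> (\<Sum>w\<in>?W. \<Prod>e\<in>vertex_pairs r. ?E w e)"
  proof (intro sum_mono)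
    fix w assume w: "w \<in> ?W"
    have nonneg: "0 \<le> ?E w e" for e
      using two_point_moment_ge_1[of "edge_mult w L e"] by (cases "edge_mult w L e = 1") auto
    show "(if w \<in> good_walks r L then 1 else 0) \<le> (\<Prod>e\<in>vertex_pairs r. ?E w e)"
    proof (cases "w \<in> good_walks r L")
      case True
      have "1 \<le> ?E w e" if "e \<in> vertex_pairs r" for e
      proof (rule two_point_moment_ge_1)
        show "edge_mult w L e \<noteq> 1"
        proof
          assume 1: "edge_mult w L e = 1"
          then obtain t where "t < L" "e = walk_edge w t" using edge_mult_pos_iff[of w L e] by auto
          with good_walk_edge_mult_ge_2[OF True] 1 show False by force
        qed
      qed
      then show ?thesis using True by (simp add: prod_ge_1)
    qed (use nonneg in \<open>simp add: prod_nonneg\<close>)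
  qed
  also have "\<dots> = measure_pmf.expectation (Pi_pmf (vertex_pairs r) False (\<lambda>_. bernoulli_pmf (1 / 3)))
      (\<lambda>\<omega>. walk_sum r (sym_mat (\<lambda>e. if \<omega> e then 2 else - 1)) L)"
    unfolding expectation_walk_sum[where F = "\<lambda>e x. if x then 2 else - 1"] two_point_moment ..
  finally show ?thesis .
qed

section \<open>Norm of a random matrix with two-point entries\<close>

text \<open>Integer points that lie in the unit ball after division by \<open>4 * sqrt r\<close>. At
  this scale, coordinate errors of at most 1 add up to a squared distance of at most
  \<open>1 / 16\<close>. The explicit box only makes finiteness immediate.\<close>

definition lattice_net :: "nat \<Rightarrow> (nat \<Rightarrow> int) set" where
  "lattice_net r = {z \<in> PiE {..<r} (\<lambda>_. {- int (16 * r)..int (16 * r)}). (\<Sum>i<r. (z i)\<^sup>2) \<le> int (16 * r)}"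

definition lattice_point :: "nat \<Rightarrow> (nat \<Rightarrow> int) \<Rightarrow> nat \<Rightarrow> real" where
  "lattice_point r z = (\<lambda>i. real_of_int (z i) / (4 * sqrt (real r)))"

lemma finite_lattice_net: "finite (lattice_net r)"
  unfolding lattice_net_def
  by (rule finite_subset[OF _ finite_PiE[of "{..<r}" "\<lambda>_. {- int (16 * r)..int (16 * r)}"]]) auto

lemma sum_half_power_abs_le: "(\<Sum>k\<in>{- int K..int K}. (1 / 2 :: real) ^ nat \<bar>k\<bar>) \<le> 3"
proof -
  have "(\<Sum>k\<in>{- int K..int K}. (1 / 2 :: real) ^ nat \<bar>k\<bar>) = 3 - 2 * (1 / 2) ^ K"
  proof (induction K)
    case (Suc K)
    have "{- int (Suc K)..int (Suc K)} = insert (int (Suc K)) (insert (- int (Suc K)) {- int K..int K})" by auto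
    then show ?case using Suc by (simp add: nat_add_distrib)
  qed simp
  then show ?thesis by simp
qed

text \<open>Exponential weights: integers satisfy \<open>\<bar>k\<bar> \<le> k\<^sup>2\<close>, so
  each net point has weight at least \<open>(1 / 2) ^ (16 * r)\<close>, while the total weight of
  the box factorises and is at most \<open>3 ^ r\<close>.\<close>

lemma card_lattice_net_le: "real (card (lattice_net r)) \<le> 3 ^ r * 2 ^ (16 * r)"
proof -
  let ?B = "{- int (16 * r)..int (16 * r)}"
  let ?g = "\<lambda>z. \<Prod>i<r. (1 / 2 :: real) ^ nat \<bar>z i\<bar>"
  have "real (card (lattice_net r)) * (1 / 2) ^ (16 * r) = (\<Sum>z\<in>lattice_net r. (1 / 2) ^ (16 * r))" by simp
  also have "\<dots> \<le> (\<Sum>z\<in>lattice_net r. ?g z)"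
  proof (intro sum_mono)
    fix z assume z: "z \<in> lattice_net r"
    have "\<bar>k\<bar> \<le> k\<^sup>2" for k :: int
      using self_le_power[of "\<bar>k\<bar>" 2] by (cases "k = 0") auto
    then have "(\<Sum>i<r. \<bar>z i\<bar>) \<le> (\<Sum>i<r. (z i)\<^sup>2)" by (intro sum_mono)
    also have "\<dots> \<le> int (16 * r)" using z by (simp add: lattice_net_def)
    finally have "int (\<Sum>i<r. nat \<bar>z i\<bar>) \<le> int (16 * r)" by simp
    then have "(\<Sum>i<r. nat \<bar>z i\<bar>) \<le> 16 * r" by linarith
    then have "(1 / 2 :: real) ^ (16 * r) \<le> (1 / 2) ^ (\<Sum>i<r. nat \<bar>z i\<bar>)" by (intro power_decreasing) auto
    then show "(1 / 2) ^ (16 * r) \<le> ?g z" by (simp add: power_sum)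
  qed
  also have "\<dots> \<le> (\<Sum>z\<in>PiE {..<r} (\<lambda>_. ?B). ?g z)"
    by (intro sum_mono2 finite_PiE) (auto simp: lattice_net_def prod_nonneg)
  also have "\<dots> = (\<Prod>i<r. \<Sum>k\<in>?B. (1 / 2 :: real) ^ nat \<bar>k\<bar>)"
    by (rule prod_sum_PiE[symmetric]) auto
  also have "\<dots> \<le> (\<Prod>i<r. 3)"
    by (intro prod_mono conjI sum_half_power_abs_le sum_nonneg) auto
  finally show ?thesis by (simp add: power_one_over field_simps)
qed

lemma lattice_point_norm: "z \<in> lattice_net r \<Longrightarrow> sqnorm r (lattice_point r z) \<le> 1"
proof (cases "r = 0")
  case False
  assume z: "z \<in> lattice_net r"
  have "sqnorm r (lattice_point r z) = real_of_int (\<Sum>i<r. (z i)\<^sup>2) / (16 * real r)"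
    by (simp add: dotp_def lattice_point_def power2_eq_square sum_divide_distrib)
  also have "real_of_int (\<Sum>i<r. (z i)\<^sup>2) \<le> real_of_int (int (16 * r))"
    using z unfolding lattice_net_def of_int_le_iff by simp
  finally show ?thesis using False by (simp add: divide_right_mono)
qed (simp add: dotp_def)

lemma lattice_net_covers:
  assumes r: "0 < r" and x: "sqnorm r x \<le> 1"
  obtains z where "z \<in> lattice_net r"
    "sqnorm r (\<lambda>i. x i - lattice_point r z i) \<le> 1 / 16"
proof -
  let ?s = "4 * sqrt (real r)"
  have s: "0 < ?s" "?s\<^sup>2 = 16 * real r" using r by (simp_all add: power_mult_distrib)
  \<comment> \<open>Rounding towards zero never increases a modulus, so the rounded point stays in
    the ball; rounding to the nearest integer could leave it.\<close>
  define tr :: "real \<Rightarrow> int" where "tr t = (if 0 \<le> t then \<lfloor>t\<rfloor> else \<lceil>t\<rceil>)" for t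
  have tr1: "\<bar>real_of_int (tr t)\<bar> \<le> \<bar>t\<bar>" and tr2: "\<bar>t - real_of_int (tr t)\<bar> \<le> 1" for t
    unfolding tr_def by (auto split: if_splits) linarith+
  define z where "z = (\<lambda>i\<in>{..<r}. tr (?s * x i))"
  have sq: "(\<Sum>i<r. (z i)\<^sup>2) \<le> int (16 * r)"
  proof -
    have "real_of_int (\<Sum>i<r. (z i)\<^sup>2) = (\<Sum>i<r. (real_of_int (tr (?s * x i)))\<^sup>2)" by (simp add: z_def)
    also have "\<dots> \<le> (\<Sum>i<r. (?s * x i)\<^sup>2)" by (intro sum_mono) (use tr1 in \<open>simp add: abs_le_square_iff\<close>)
    also have "\<dots> = ?s\<^sup>2 * sqnorm r x" 
      unfolding dotp_def sum_distrib_left by (intro sum.cong refl) (simp only: power_mult_distrib power2_eq_square ac_simps)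
    also have "\<dots> \<le> ?s\<^sup>2 * 1" by (intro mult_left_mono x) simp
    finally have "real_of_int (\<Sum>i<r. (z i)\<^sup>2) \<le> real_of_int (int (16 * r))" by (simp add: s(2))
    then show ?thesis unfolding of_int_le_iff .
  qed
  have "z i \<in> {- int (16 * r)..int (16 * r)}" if "i < r" for i
  proof -
    have "(z i)\<^sup>2 \<le> (\<Sum>i<r. (z i)\<^sup>2)" using that by (intro member_le_sum) auto
    then have "(z i)\<^sup>2 \<le> int (16 * r)" using sq by simp
    moreover have "\<bar>z i\<bar> \<le> (z i)\<^sup>2"
      using self_le_power[of "\<bar>z i\<bar>" 2] by (cases "z i = 0") auto
    ultimately show ?thesis by auto
  qed
  then have "z \<in> lattice_net r" using sq by (auto simp: lattice_net_def z_def)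
  moreover have "sqnorm r (\<lambda>i. x i - lattice_point r z i) \<le> 1 / 16"
  proof -
    have "sqnorm r (\<lambda>i. x i - lattice_point r z i) \<le> (\<Sum>i<r. 1 / ?s\<^sup>2)"
      unfolding dotp_def
    proof (intro sum_mono)
      fix i assume i: "i \<in> {..<r}"
      have "x i - lattice_point r z i = (?s * x i - real_of_int (tr (?s * x i))) / ?s"
        using i s(1) by (simp add: lattice_point_def z_def diff_divide_distrib)
      then have "(x i - lattice_point r z i) * (x i - lattice_point r z i) = (?s * x i - real_of_int (tr (?s * x i)))\<^sup>2 / ?s\<^sup>2"
        by (simp add: power2_eq_square)
      also have "(?s * x i - real_of_int (tr (?s * x i)))\<^sup>2 \<le> 1"
        using tr2[of "?s * x i"] by (simp add: abs_square_le_1)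
      finally show "(x i - lattice_point r z i) * (x i - lattice_point r z i) \<le> 1 / ?s\<^sup>2"
        by (simp add: divide_right_mono)
    qed
    then show ?thesis using r by (simp add: s(2))
  qed
  ultimately show ?thesis by (rule that)
qed

text \<open>The usual net argument, run as an iteration from a crude bound instead of through a
  supremum. The net has radius \<open>1 / 4\<close>, so rounding both arguments turns a bound
  \<open>2 * m + D\<close> into \<open>m + 2 * (2 * m + D) / 4\<close>.\<close>

lemma bilinear_le_of_net:
  assumes r: "0 < r"
    and m: "\<And>z z'. z \<in> lattice_net r \<Longrightarrow> z' \<in> lattice_net r \<Longrightarrow>
      dotp r (lattice_point r z) (mat_app r Y (lattice_point r z')) \<le> m"
    and xy: "sqnorm r x \<le> 1" "sqnorm r y \<le> 1"
  shows "dotp r x (mat_app r Y y) \<le> 2 * m"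
proof -
  define B where "B x y = dotp r x (mat_app r Y y)" for x y
  have B1: "B (\<lambda>i. u i - v i) y = B u y - B v y" for u v y by (simp add: B_def dotp_diff_left)
  have app_diff: "mat_app r Y (\<lambda>i. u i - v i) = (\<lambda>i. mat_app r Y u i - mat_app r Y v i)" for u v
    by (simp add: mat_app_def right_diff_distrib sum_subtractf)
  have app_scale: "mat_app r Y (\<lambda>i. c * u i) = (\<lambda>i. c * mat_app r Y u i)" for u c
    by (simp add: mat_app_def sum_distrib_left mult.left_commute)
  have B2: "B y (\<lambda>i. u i - v i) = B y u - B y v" for u v y by (simp add: B_def app_diff dotp_diff_right)
  have B3: "B (\<lambda>i. c * u i) y = c * B u y" "B y (\<lambda>i. c * u i) = c * B y u" for c u y
    by (simp_all add: B_def app_scale dotp_scale_left dotp_scale_right)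
  \<comment> \<open>Starting point of the iteration; only its finiteness matters, as its excess over
    \<open>2 * m\<close> is halved at each round.\<close>
  define C where "C = (\<Sum>i<r. \<Sum>j<r. \<bar>Y i j\<bar>)"
  have C: "B x y \<le> C" if "sqnorm r x \<le> 1" "sqnorm r y \<le> 1" for x y
  proof -
    have comp: "\<bar>x i\<bar> \<le> 1" if "sqnorm r x \<le> 1" "i < r" for x i
    proof -
      have "x i * x i \<le> sqnorm r x" unfolding dotp_def using that by (intro member_le_sum) auto
      then show ?thesis using that(1) by (simp add: abs_square_le_1[symmetric] power2_eq_square)
    qed
    have "B x y = (\<Sum>i<r. \<Sum>j<r. x i * (Y i j * y j))" by (simp add: B_def dotp_def mat_app_def sum_distrib_left)
    also have "\<dots> \<le> C" unfolding C_def
    proof (intro sum_mono)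
      fix i j assume "i \<in> {..<r}" "j \<in> {..<r}"
      then have "\<bar>x i\<bar> \<le> 1" "\<bar>y j\<bar> \<le> 1" using comp that by auto
      then have "\<bar>x i\<bar> * (\<bar>Y i j\<bar> * \<bar>y j\<bar>) \<le> 1 * (\<bar>Y i j\<bar> * 1)" by (intro mult_mono) auto
      moreover have "x i * (Y i j * y j) \<le> \<bar>x i\<bar> * (\<bar>Y i j\<bar> * \<bar>y j\<bar>)"
        using abs_ge_self[of "x i * (Y i j * y j)"] by (simp add: abs_mult)
      ultimately show "x i * (Y i j * y j) \<le> \<bar>Y i j\<bar>" by simp
    qed
    finally show ?thesis .
  qed
  have sixteen: "sqnorm r (\<lambda>i. 4 * u i) = 16 * sqnorm r u" for u
    by (simp add: dotp_scale_left dotp_scale_right)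
  \<comment> \<open>Rounding both arguments to the net halves the excess of any bound over \<open>2 * m\<close>.\<close>
  have step: "B x y \<le> 2 * m + D / 2"
    if D: "\<And>x y. sqnorm r x \<le> 1 \<Longrightarrow> sqnorm r y \<le> 1 \<Longrightarrow> B x y \<le> 2 * m + D"
      and x: "sqnorm r x \<le> 1" and y: "sqnorm r y \<le> 1" for D x y
  proof -
    obtain z where z: "z \<in> lattice_net r"
      "sqnorm r (\<lambda>i. x i - lattice_point r z i) \<le> 1 / 16"
      by (rule lattice_net_covers[OF r x])
    obtain z' where z': "z' \<in> lattice_net r"
      "sqnorm r (\<lambda>i. y i - lattice_point r z' i) \<le> 1 / 16"
      by (rule lattice_net_covers[OF r y])
    let ?x = "lattice_point r z" and ?y = "lattice_point r z'"
    have "B (\<lambda>i. 4 * (x i - ?x i)) y \<le> 2 * m + D"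
      by (rule D[OF _ y]) (subst sixteen[of "\<lambda>i. x i - ?x i"], use z(2) in simp)
    then have 1: "4 * (B x y - B ?x y) \<le> 2 * m + D" by (simp add: B3 B1)
    have "B ?x (\<lambda>i. 4 * (y i - ?y i)) \<le> 2 * m + D"
      by (rule D[OF lattice_point_norm[OF z(1)]]) (subst sixteen[of "\<lambda>i. y i - ?y i"], use z'(2) in simp)
    then have 2: "4 * (B ?x y - B ?x ?y) \<le> 2 * m + D" by (simp add: B3 B2)
    have "B ?x ?y \<le> m" using m[OF z(1) z'(1)] by (simp add: B_def)
    with 1 2 show ?thesis by simp
  qed
  have iter: "\<forall>x y. sqnorm r x \<le> 1 \<longrightarrow> sqnorm r y \<le> 1 \<longrightarrow> B x y \<le> 2 * m + (C - 2 * m) / 2 ^ k" for k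
  proof (induction k)
    case 0
    then show ?case using C by simp
  next
    case (Suc k)
    then show ?case using step[of "(C - 2 * m) / 2 ^ k"] by (simp add: mult.commute)
  qed
  have "(\<lambda>k. 2 * m + (C - 2 * m) * (1 / 2) ^ k) \<longlonglongrightarrow> 2 * m + (C - 2 * m) * 0"
    by (intro tendsto_intros LIMSEQ_realpow_zero) auto
  then have "B x y \<le> 2 * m + (C - 2 * m) * 0"
    by (rule LIMSEQ_le_const) (use iter xy in \<open>auto simp: power_one_over\<close>)
  then show ?thesis by (simp add: B_def)
qed

lemma operator_norm_le_of_net:
  assumes r: "0 < r"
    and m: "\<And>z z'. z \<in> lattice_net r \<Longrightarrow> z' \<in> lattice_net r \<Longrightarrow>
      dotp r (lattice_point r z) (mat_app r Y (lattice_point r z')) \<le> m"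
  shows "sqnorm r (mat_app r Y x) \<le> (2 * m)\<^sup>2 * sqnorm r x"
proof -
  define a b where "a = sqrt (sqnorm r (mat_app r Y x))" and "b = sqrt (sqnorm r x)"
  have ab: "0 \<le> a" "0 \<le> b" "a\<^sup>2 = sqnorm r (mat_app r Y x)" "b\<^sup>2 = sqnorm r x"
    by (simp_all add: a_def b_def dotp_self_nonneg)
  show ?thesis
  proof (cases "a = 0 \<or> b = 0")
    case True
    moreover have "a = 0" if "b = 0"
    proof -
      have "\<forall>k<r. x k = 0" using that dotp_self_eq_0_iff[of r x] by (simp add: b_def)
      then show ?thesis by (simp add: a_def dotp_def mat_app_def)
    qed
    ultimately have "a = 0" by blast
    then show ?thesis using ab by (metis mult_nonneg_nonneg power_zero_numeral zero_le_power2)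
  next
    case False
    then have pos: "0 < a" "0 < b" using ab by auto
    let ?u = "\<lambda>i. 1 / a * mat_app r Y x i" and ?v = "\<lambda>i. 1 / b * x i"
    have 1: "sqnorm r ?u \<le> 1" "sqnorm r ?v \<le> 1"
      unfolding dotp_scale_left dotp_scale_right using pos ab(3,4)[symmetric] by (simp_all add: power2_eq_square)
    have "mat_app r Y ?v = (\<lambda>i. 1 / b * mat_app r Y x i)"
      by (simp add: mat_app_def sum_divide_distrib)
    then have "dotp r ?u (mat_app r Y ?v) = 1 / a * (1 / b * a\<^sup>2)"
      by (simp only: dotp_scale_left dotp_scale_right ab(3))
    also have "\<dots> = a / b" using pos by (simp add: power2_eq_square)
    finally have "a / b \<le> 2 * m" using bilinear_le_of_net[OF r m 1] by simp
    then have "a \<le> 2 * m * b" using pos by (simp add: field_simps)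
    then have "a\<^sup>2 \<le> (2 * m * b)\<^sup>2" using pos by (intro power_mono) auto
    then show ?thesis by (simp only: power_mult_distrib ab(3,4))
  qed
qed

text \<open>The linear term stands alone because it averages out for a centred variable, which
  leaves a subgaussian bound on the exponential moment.\<close>

lemma exp_le_add_exp_square: "exp x \<le> x + exp (x\<^sup>2)" for x :: real
proof -
  have sq: "1 + x\<^sup>2 \<le> exp (x\<^sup>2)" by (rule exp_ge_add_one_self)
  consider "1 \<le> x" | "0 \<le> x" "x \<le> 1" | "- 1 \<le> x" "x \<le> 0" | "x \<le> - 1" by linarith
  then show ?thesis
  proof cases
    case 1
    then have "x \<le> x\<^sup>2" using self_le_power[of x 2] by simp
    then have "exp x \<le> exp (x\<^sup>2)" by simp
    with 1 show ?thesis by linarith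
  next
    case 2
    with exp_bound[of x] sq show ?thesis by linarith
  next
    case 3
    define y where "y = - x"
    have y: "0 \<le> y" "y \<le> 1" using 3 by (auto simp: y_def)
    have "exp (- y) \<le> 1 / (1 + y)"
      using exp_ge_add_one_self[of y] y by (simp add: exp_minus divide_inverse le_imp_inverse_le)
    also have "1 / (1 + y) \<le> 1 - y + y\<^sup>2"
    proof -
      have "(1 - y + y\<^sup>2) * (1 + y) = 1 + y ^ 3" by (simp add: algebra_simps power2_eq_square power3_eq_cube)
      then show ?thesis using y by (simp add: divide_le_eq)
    qed
    finally have "exp x \<le> 1 + x + x\<^sup>2" by (simp add: y_def)
    with sq show ?thesis by linarith
  next
    case 4
    then have "\<bar>x\<bar> \<le> \<bar>x\<bar>\<^sup>2" using self_le_power[of "\<bar>x\<bar>" 2] by simp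
    then have "0 \<le> x + x\<^sup>2" using 4 by simp
    moreover have "exp x \<le> 1" using 4 by simp
    ultimately show ?thesis using sq by linarith
  qed
qed

lemma two_point_mgf:
  fixes s :: real
  shows "measure_pmf.expectation (bernoulli_pmf (1 / 3)) (\<lambda>x. exp (s * (if x then 2 else - 1))) \<le> exp (4 * s\<^sup>2)"
proof -
  have "measure_pmf.expectation (bernoulli_pmf (1 / 3)) (\<lambda>x. exp (s * (if x then 2 else - 1)))
      = exp (2 * s) / 3 + 2 / 3 * exp (- s)" by (simp add: integral_bernoulli_pmf mult.commute)
  \<comment> \<open>The linear terms \<open>2 * s / 3\<close> and \<open>- 2 * s / 3\<close> cancel,
    since the law has mean 0.\<close>
  also have "\<dots> \<le> (2 * s + exp ((2 * s)\<^sup>2)) / 3 + 2 / 3 * (- s + exp ((- s)\<^sup>2))"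
    by (intro add_mono divide_right_mono mult_left_mono exp_le_add_exp_square) auto
  also have "\<dots> = exp (4 * s\<^sup>2) / 3 + 2 / 3 * exp (s\<^sup>2)" by (simp add: power_mult_distrib field_simps)
  also have "\<dots> \<le> exp (4 * s\<^sup>2) / 3 + 2 / 3 * exp (4 * s\<^sup>2)" by (intro add_mono mult_left_mono) auto
  finally show ?thesis by simp
qed

text \<open>Collecting the two symmetric positions makes the form linear in the independent entries,
  so its exponential moment factorises.\<close>

lemma bilinear_sym_mat:
  "dotp n x (mat_app n (sym_mat g) y) =
     (\<Sum>e\<in>vertex_pairs n. g e * (x (fst e) * y (snd e) + x (snd e) * y (fst e)))"
proof -
  let ?f = "\<lambda>i j. x i * (sym_mat g i j * y j)"
  have "dotp n x (mat_app n (sym_mat g) y) = (\<Sum>i<n. \<Sum>j<n. ?f i j)"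
    by (simp add: dotp_def mat_app_def sum_distrib_left)
  also have "\<dots> = (\<Sum>(i, j)\<in>{..<n} \<times> {..<n}. ?f i j)" by (simp add: sum.cartesian_product)
  also have "\<dots> = (\<Sum>(i, j)\<in>vertex_pairs n \<union> prod.swap ` vertex_pairs n. ?f i j)"
    by (rule sum.mono_neutral_right) (auto simp: vertex_pairs_def sym_mat_def image_iff split: if_splits)
  also have "\<dots> = (\<Sum>(i, j)\<in>vertex_pairs n. ?f i j) + (\<Sum>(i, j)\<in>prod.swap ` vertex_pairs n. ?f i j)"
    by (rule sum.union_disjoint[OF finite_vertex_pairs finite_imageI[OF finite_vertex_pairs]])
      (auto simp: vertex_pairs_def)
  also have "(\<Sum>(i, j)\<in>prod.swap ` vertex_pairs n. ?f i j) = (\<Sum>(i, j)\<in>vertex_pairs n. ?f j i)"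
    by (subst sum.reindex) (auto simp: case_prod_beta' o_def intro!: inj_onI)
  also have "(\<Sum>(i, j)\<in>vertex_pairs n. ?f i j) + (\<Sum>(i, j)\<in>vertex_pairs n. ?f j i) =
      (\<Sum>e\<in>vertex_pairs n. g e * (x (fst e) * y (snd e) + x (snd e) * y (fst e)))"
    unfolding sum.distrib[symmetric]
    by (intro sum.cong) (auto simp: sym_mat_def vertex_pairs_def min_def max_def algebra_simps)
  finally show ?thesis .
qed

lemma sum_vertex_pairs_square_le:
  assumes "sqnorm n x \<le> 1" "sqnorm n y \<le> 1"
  shows "(\<Sum>e\<in>vertex_pairs n. (x (fst e) * y (snd e) + x (snd e) * y (fst e))\<^sup>2) \<le> 2"
proof -
  let ?f = "\<lambda>i j. (x i)\<^sup>2 * (y j)\<^sup>2"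
  have "(\<Sum>e\<in>vertex_pairs n. (x (fst e) * y (snd e) + x (snd e) * y (fst e))\<^sup>2)
      \<le> (\<Sum>(i, j)\<in>vertex_pairs n. 2 * ?f i j + 2 * ?f j i)"
    unfolding case_prod_beta' power_mult_distrib[symmetric] by (intro sum_mono sum_square_add_le)
  also have "\<dots> = 2 * ((\<Sum>(i, j)\<in>vertex_pairs n. ?f i j) + (\<Sum>(i, j)\<in>vertex_pairs n. ?f j i))"
    by (simp add: case_prod_beta' sum.distrib sum_distrib_left)
  also have "(\<Sum>(i, j)\<in>vertex_pairs n. ?f j i) = (\<Sum>(i, j)\<in>prod.swap ` vertex_pairs n. ?f i j)"
    by (subst sum.reindex) (auto simp: case_prod_beta' o_def intro!: inj_onI)
  also have "(\<Sum>(i, j)\<in>vertex_pairs n. ?f i j) + (\<Sum>(i, j)\<in>prod.swap ` vertex_pairs n. ?f i j)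
      = (\<Sum>(i, j)\<in>vertex_pairs n \<union> prod.swap ` vertex_pairs n. ?f i j)"
    by (rule sum.union_disjoint[OF finite_vertex_pairs finite_imageI[OF finite_vertex_pairs], symmetric])
      (auto simp: vertex_pairs_def)
  also have "\<dots> \<le> (\<Sum>(i, j)\<in>{..<n} \<times> {..<n}. ?f i j)"
    by (intro sum_mono2) (auto simp: vertex_pairs_def)
  also have "\<dots> = sqnorm n x * sqnorm n y"
    by (simp add: dotp_def sum_product sum.cartesian_product power2_eq_square)
  also have "\<dots> \<le> 1 * 1" using assms dotp_self_nonneg by (intro mult_mono) auto
  finally show ?thesis by simp
qed

lemma expectation_exp_bilinear_le:
  assumes "sqnorm r x \<le> 1" "sqnorm r y \<le> 1"
  shows "measure_pmf.expectation (Pi_pmf (vertex_pairs r) d (\<lambda>_. bernoulli_pmf (1 / 3)))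
      (\<lambda>\<omega>. exp (\<theta> * dotp r x (mat_app r (sym_mat (\<lambda>e. if \<omega> e then 2 else - 1)) y))) \<le> exp (8 * \<theta>\<^sup>2)"
proof -
  define c where "c e = x (fst e) * y (snd e) + x (snd e) * y (fst e)" for e
  let ?E = "\<lambda>e. measure_pmf.expectation (bernoulli_pmf (1 / 3)) (\<lambda>b. exp (\<theta> * c e * (if b then 2 else - 1)))"
  have "exp (\<theta> * dotp r x (mat_app r (sym_mat (\<lambda>e. if \<omega> e then 2 else - 1)) y)) =
      (\<Prod>e\<in>vertex_pairs r. exp (\<theta> * c e * (if \<omega> e then 2 else - 1)))" for \<omega>
    unfolding bilinear_sym_mat exp_sum[OF finite_vertex_pairs, symmetric] sum_distrib_left c_def
    by (simp only: mult.commute mult.left_commute)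
  then have "measure_pmf.expectation (Pi_pmf (vertex_pairs r) d (\<lambda>_. bernoulli_pmf (1 / 3)))
      (\<lambda>\<omega>. exp (\<theta> * dotp r x (mat_app r (sym_mat (\<lambda>e. if \<omega> e then 2 else - 1)) y))) = (\<Prod>e\<in>vertex_pairs r. ?E e)"
    by (simp only: expectation_prod_Pi_pmf_real[OF finite_vertex_pairs,
        where f = "\<lambda>e b. exp (\<theta> * c e * (if b then 2 else - 1))"])
  also have "\<dots> \<le> (\<Prod>e\<in>vertex_pairs r. exp (4 * (\<theta> * c e)\<^sup>2))"
    by (intro prod_mono conjI two_point_mgf integral_nonneg_AE) auto
  also have "\<dots> = exp (4 * \<theta>\<^sup>2 * (\<Sum>e\<in>vertex_pairs r. (c e)\<^sup>2))"
    by (simp add: exp_sum[OF finite_vertex_pairs] sum_distrib_left power_mult_distrib mult.assoc)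
  also have "\<dots> \<le> exp (4 * \<theta>\<^sup>2 * 2)"
    unfolding exp_le_cancel_iff c_def by (intro mult_left_mono sum_vertex_pairs_square_le assms) auto
  finally show ?thesis by simp
qed

lemma power_le_fact_exp:
  fixes u :: real
  assumes "0 \<le> u"
  shows "u ^ k \<le> fact k * exp u"
proof -
  have "u ^ k / fact k = (\<Sum>n\<in>{k}. u ^ n /\<^sub>R fact n)" by (simp add: divide_inverse mult.commute)
  also have "\<dots> \<le> (\<Sum>n. u ^ n /\<^sub>R fact n)"
    by (rule sum_le_suminf[OF summable_exp_generic]) (use assms in auto)
  also have "\<dots> = exp u" by (simp add: exp_def)
  finally show ?thesis by (simp add: field_simps)
qed

text \<open>The trace is bounded through the norm, the norm through the maximum over the net, and a
  power of that maximum through a sum of exponentials, whose expectation is subgaussian. All losses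
  are exponential in \<open>r\<close>, hence in \<open>p\<close>.\<close>

lemma expectation_two_point_walk_sum_le:
  assumes p: "0 < p" and r: "r = 2 * p + 1"
  shows "measure_pmf.expectation (Pi_pmf (vertex_pairs r) d (\<lambda>_. bernoulli_pmf (1 / 3)))
      (\<lambda>\<omega>. walk_sum r (sym_mat (\<lambda>e. if \<omega> e then 2 else - 1)) (2 * p)) \<le> exp (212 * real p) * real p ^ p"
proof -
  let ?P = "Pi_pmf (vertex_pairs r) d (\<lambda>_. bernoulli_pmf (1 / 3))"
  let ?Y = "\<lambda>\<omega>. sym_mat (\<lambda>e. if \<omega> e then 2 else - 1)"
  let ?N = "lattice_net r \<times> lattice_net r"
  let ?B = "\<lambda>\<omega> z. dotp r (lattice_point r (fst z)) (mat_app r (?Y \<omega>) (lattice_point r (snd z)))"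
  have int: "integrable (measure_pmf ?P) g" for g :: "_ \<Rightarrow> real"
    by (rule integrable_measure_pmf_finite[OF finite_set_Pi_pmf[OF finite_vertex_pairs]])
  have r0: "0 < r" using r by simp
  \<comment> \<open>With this scale the exponential moment costs
    \<open>exp (8 * \<theta>\<^sup>2) = exp (32 * r)\<close>, of the same type as the size of the
    net.\<close>
  define \<theta> where "\<theta> = 2 * sqrt (real r)"
  \<comment> \<open>The zero point makes the net nonempty and the maximum \<open>m\<close>
    nonnegative.\<close>
  have zero: "(\<lambda>i\<in>{..<r}. 0) \<in> lattice_net r" by (auto simp: lattice_net_def)
  have pw: "walk_sum r (?Y \<omega>) (2 * p) \<le> real r * (fact (2 * p) / real r ^ p * (\<Sum>z\<in>?N. exp (\<theta> * ?B \<omega> z)))" for \<omega>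
  proof -
    define m where "m = Max (?B \<omega> ` ?N)"
    have fin: "finite (?B \<omega> ` ?N)" by (simp add: finite_lattice_net)
    have ne: "?B \<omega> ` ?N \<noteq> {}" using zero by blast
    have m: "dotp r (lattice_point r z) (mat_app r (?Y \<omega>) (lattice_point r z')) \<le> m"
      if "z \<in> lattice_net r" "z' \<in> lattice_net r" for z z'
      unfolding m_def using that by (intro Max_ge fin) force
    obtain z0 where z0: "z0 \<in> ?N" "m = ?B \<omega> z0" using Max_in[OF fin ne] unfolding m_def by blast
    have "dotp r (lattice_point r (\<lambda>i\<in>{..<r}. 0)) y = 0" for y
      by (simp add: dotp_def lattice_point_def)
    then have m0: "0 \<le> m" using m[OF zero zero] by simp
    have "walk_sum r (?Y \<omega>) (2 * p) \<le> real r * (2 * m) ^ (2 * p)"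
      by (intro walk_sum_le sym_fun_sym_mat operator_norm_le_of_net[OF r0] m)
    also have "(2 * m) ^ (2 * p) = (\<theta> * m) ^ (2 * p) / real r ^ p"
    proof -
      have "(\<theta> * m) ^ (2 * p) = (2 * m) ^ (2 * p) * (sqrt (real r) ^ 2) ^ p"
        by (simp add: \<theta>_def power_mult_distrib power_mult)
      then show ?thesis using r0 by simp
    qed
    also have "(\<theta> * m) ^ (2 * p) \<le> fact (2 * p) * exp (\<theta> * m)"
      by (rule power_le_fact_exp) (use m0 in \<open>simp add: \<theta>_def\<close>)
    also have "exp (\<theta> * m) \<le> (\<Sum>z\<in>?N. exp (\<theta> * ?B \<omega> z))"
      unfolding z0(2) by (rule member_le_sum[OF z0(1)]) (auto simp: finite_lattice_net)
    finally show ?thesis by (simp add: divide_right_mono mult_left_mono)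
  qed
  have "measure_pmf.expectation ?P (\<lambda>\<omega>. walk_sum r (?Y \<omega>) (2 * p)) \<le>
      measure_pmf.expectation ?P (\<lambda>\<omega>. real r * (fact (2 * p) / real r ^ p * (\<Sum>z\<in>?N. exp (\<theta> * ?B \<omega> z))))"
    by (intro integral_mono int pw)
  also have "\<dots> = real r * (fact (2 * p) / real r ^ p * (\<Sum>z\<in>?N. measure_pmf.expectation ?P (\<lambda>\<omega>. exp (\<theta> * ?B \<omega> z))))"
    by (simp only: integral_mult_right_zero Bochner_Integration.integral_sum[OF int])
  also have "\<dots> \<le> real r * (fact (2 * p) / real r ^ p * (\<Sum>z\<in>?N. exp (8 * \<theta>\<^sup>2)))"
    by (intro mult_left_mono sum_mono expectation_exp_bilinear_le lattice_point_norm) auto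
  also have "(\<Sum>z\<in>?N. exp (8 * \<theta>\<^sup>2)) = (real (card (lattice_net r)))\<^sup>2 * exp (32 * real r)"
    by (simp add: \<theta>_def power_mult_distrib card_cartesian_product power2_eq_square)
  \<comment> \<open>The exponents 1, 36 and 32 come from the dimension factor, the pairs of net
    points and the exponential moment; together they give 69.\<close>
  also have "real r * (fact (2 * p) / real r ^ p * ((real (card (lattice_net r)))\<^sup>2 * exp (32 * real r)))
      \<le> exp (real r) * (real r ^ p * (exp (36 * real r) * exp (32 * real r)))"
  proof (intro mult_mono)
    show "real r \<le> exp (real r)" using exp_ge_add_one_self[of "real r"] by linarith
    have "fact (2 * p) \<le> real (2 * p) ^ (2 * p)" using fact_le_power[of "2 * p", where 'a = real] by simp
    also have "\<dots> \<le> real r ^ (2 * p)" by (intro power_mono) (simp_all add: r)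
    also have "\<dots> = real r ^ p * real r ^ p" by (simp add: mult_2 power_add)
    finally show "fact (2 * p) / real r ^ p \<le> real r ^ p" using r0 by (simp add: divide_le_eq)
    have "real (card (lattice_net r)) \<le> 3 ^ r * 2 ^ (16 * r)" by (rule card_lattice_net_le)
    also have "\<dots> \<le> exp 2 ^ r * exp 1 ^ (16 * r)"
      using exp_ge_add_one_self[of 2] exp_ge_add_one_self[of 1] by (intro mult_mono power_mono) auto
    also have "\<dots> = exp (18 * real r)" by (simp flip: exp_of_nat_mult exp_add)
    finally have "real (card (lattice_net r)) \<le> exp (18 * real r)" .
    then have "(real (card (lattice_net r)))\<^sup>2 \<le> (exp (18 * real r))\<^sup>2" by (intro power_mono) auto
    then show "(real (card (lattice_net r)))\<^sup>2 \<le> exp (36 * real r)" by (simp flip: exp_of_nat_mult)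
  qed auto
  also have "\<dots> = exp (69 * real r) * real r ^ p" by (simp add: mult.commute mult.left_commute flip: exp_add)
  \<comment> \<open>Here \<open>r = 2 * p + 1 \<le> 3 * p\<close>, so 69 becomes 207; bounding
    \<open>3 ^ p\<close> by \<open>exp (5 * p)\<close> makes it 212.\<close>
  also have "\<dots> \<le> exp (69 * (3 * real p)) * (3 * real p) ^ p"
    using p r by (intro mult_mono power_mono) auto
  also have "\<dots> = exp (207 * real p) * (3 ^ p * real p ^ p)" by (simp add: power_mult_distrib)
  also have "\<dots> \<le> exp (207 * real p) * (exp (5 * real p) * real p ^ p)"
  proof (intro mult_left_mono mult_right_mono)
    have "(3::real) ^ p \<le> exp 5 ^ p" using exp_ge_add_one_self[of 5] by (intro power_mono) auto
    then show "(3::real) ^ p \<le> exp (5 * real p)" by (simp add: exp_of_nat_mult[symmetric] mult.commute)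
  qed auto
  also have "\<dots> = exp (212 * real p) * real p ^ p" by (simp flip: exp_add mult.assoc)
  finally show ?thesis .
qed

text \<open>Markov's inequality for the walk sum of length \<open>2 * p\<close>: a violation of the
  norm bound by any vector forces the walk sum above \<open>c\<close>.\<close>

lemma centered_adjacency_norm:
  fixes q :: "nat \<times> nat \<Rightarrow> real"
  assumes q: "\<And>e. e \<in> vertex_pairs n \<Longrightarrow> 0 \<le> q e" "\<And>e. e \<in> vertex_pairs n \<Longrightarrow> q e \<le> \<rho>"
    and \<rho>: "0 \<le> \<rho>" "\<rho> \<le> 1" and n: "0 < n" and p: "0 < p" "real n * \<rho> \<le> real p" "ln (real n) \<le> real p"
  shows "measure_pmf.prob (Pi_pmf (vertex_pairs n) d (\<lambda>e. bernoulli_pmf (q e)))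
     {\<omega>. \<not> (\<forall>x. sqnorm n (mat_app n (sym_mat (\<lambda>e. of_bool (\<omega> e) - q e)) x) \<le> exp 214 * real p * sqnorm n x)}
    \<le> 1 / real n"
proof -
  let ?P = "Pi_pmf (vertex_pairs n) d (\<lambda>e. bernoulli_pmf (q e))"
  let ?S = "\<lambda>\<omega>. sym_mat (\<lambda>e. of_bool (\<omega> e) - q e)"
  \<comment> \<open>The exponent exceeds the 212 of the moment bound by 2: the surplus
    \<open>exp (2 * p) \<ge> n ^ 2\<close> pays for the factor \<open>n\<close> and leaves
    probability \<open>1 / n\<close>.\<close>
  define c where "c = exp (214 * real p) * real p ^ p"
  have c: "0 < c" using p by (simp add: c_def)
  have int: "integrable (measure_pmf ?P) g" for g :: "_ \<Rightarrow> real"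
    by (rule integrable_measure_pmf_finite[OF finite_set_Pi_pmf[OF finite_vertex_pairs]])
  have n_le: "real n \<le> exp (real p)" using n p(3) by (metis exp_le_cancel_iff exp_ln of_nat_0_less_iff)
  have "measure_pmf.expectation ?P (\<lambda>\<omega>. walk_sum n (?S \<omega>) (2 * p)) \<le>
      (\<Sum>w\<in>good_walks n (2 * p). \<rho> ^ (card (w ` {..2 * p}) - 1))"
    by (rule expectation_walk_sum_centered_le[OF q \<rho>])
  also have "\<dots> \<le> real n * real (card (good_walks (2 * p + 1) (2 * p)))"
    by (rule weighted_good_walks_le[OF \<rho>(1) p(2,1)])
  also have "\<dots> \<le> real n * (exp (212 * real p) * real p ^ p)"
    by (intro mult_left_mono order_trans[OF card_good_walks_le_expectation expectation_two_point_walk_sum_le[OF p(1) refl]]) simp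
  finally have E: "measure_pmf.expectation ?P (\<lambda>\<omega>. walk_sum n (?S \<omega>) (2 * p)) \<le> \<dots>" .
  have "{\<omega>. \<not> (\<forall>x. sqnorm n (mat_app n (?S \<omega>) x) \<le> exp 214 * real p * sqnorm n x)}
      \<subseteq> {\<omega>. c \<le> walk_sum n (?S \<omega>) (2 * p)}"
  proof
    fix \<omega>
    assume "\<omega> \<in> {\<omega>. \<not> (\<forall>x. sqnorm n (mat_app n (?S \<omega>) x) \<le> exp 214 * real p * sqnorm n x)}"
    then obtain x where x: "exp 214 * real p * sqnorm n x < sqnorm n (mat_app n (?S \<omega>) x)"
      by (auto simp: not_le)
    have "c * sqnorm n x ^ p = (exp 214 * real p * sqnorm n x) ^ p"
      by (simp add: c_def power_mult_distrib exp_of_nat_mult[symmetric] mult.commute)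
    also have "\<dots> < (sqnorm n (mat_app n (?S \<omega>) x)) ^ p"
      using x p(1) dotp_self_nonneg by (intro power_strict_mono) auto
    also have "\<dots> \<le> walk_sum n (?S \<omega>) (2 * p) * sqnorm n x ^ p"
      by (rule operator_norm_le_walk_sum[OF sym_fun_sym_mat p(1)])
    finally have "c * sqnorm n x ^ p < walk_sum n (?S \<omega>) (2 * p) * sqnorm n x ^ p" .
    moreover have "0 \<le> sqnorm n x ^ p" by (simp add: dotp_self_nonneg)
    ultimately have "c < walk_sum n (?S \<omega>) (2 * p)" by (simp add: mult_less_cancel_right)
    then show "\<omega> \<in> {\<omega>. c \<le> walk_sum n (?S \<omega>) (2 * p)}" by simp
  qed
  then have "measure_pmf.prob ?P {\<omega>. \<not> (\<forall>x. sqnorm n (mat_app n (?S \<omega>) x) \<le> exp 214 * real p * sqnorm n x)}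
      \<le> measure_pmf.prob ?P {\<omega> \<in> space (measure_pmf ?P). c \<le> walk_sum n (?S \<omega>) (2 * p)}"
    by (intro measure_pmf.finite_measure_mono) auto
  also have "\<dots> \<le> measure_pmf.expectation ?P (\<lambda>\<omega>. walk_sum n (?S \<omega>) (2 * p)) / c"
    using integral_Markov_inequality_measure[OF int, of "{}" "\<lambda>\<omega>. walk_sum n (?S \<omega>) (2 * p)" c] c
    by (simp add: walk_sum_nonneg sym_fun_sym_mat)
  also have "\<dots> \<le> real n * (exp (212 * real p) * real p ^ p) / c" using E c by (intro divide_right_mono) auto
  also have "\<dots> = real n * exp (212 * real p) / exp (214 * real p)" using p by (simp add: c_def)
  also have "\<dots> = real n / (exp (real p) * exp (real p))"
    by (simp add: field_simps flip: exp_add)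
  also have "\<dots> \<le> real n / (real n * real n)" using n n_le by (intro divide_left_mono mult_mono) auto
  also have "\<dots> = 1 / real n" using n by simp
  finally show ?thesis .
qed

section \<open>Risk of the estimator\<close>

lemma symmetric_svd_exists:
  assumes A: "A \<in> carrier_mat n n" and sym: "\<And>i j. i < n \<Longrightarrow> j < n \<Longrightarrow> A $$ (i, j) = A $$ (j, i)"
  shows "\<exists>s u v. is_svd n A s u v"
proof -
  let ?es = "ordered_eigenvalues A"
  obtain w where w: "orthonormal n w"
    and ew: "\<And>k i. k < n \<Longrightarrow> i < n \<Longrightarrow> mat_app n (\<lambda>i j. A $$ (i, j)) (w k) i = ?es ! k * w k i"
    and anti: "\<And>k l. k \<le> l \<Longrightarrow> l < n \<Longrightarrow> \<bar>?es ! l\<bar> \<le> \<bar>?es ! k\<bar>"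
    by (rule symmetric_eigenbasis[OF A sym]) blast+
  \<comment> \<open>The sign of the eigenvalue moves into the right singular vector. For eigenvalue
    0 it is 1, so the vector keeps length 1.\<close>
  define sg :: "nat \<Rightarrow> real" where "sg k = (if 0 \<le> ?es ! k then 1 else - 1)" for k
  have sg: "sg k * sg k = 1" "\<bar>?es ! k\<bar> * sg k = ?es ! k" for k by (auto simp: sg_def)
  define u where "u k = vec n (w k)" for k
  define v where "v k = vec n (\<lambda>i. sg k * w k i)" for k
  have "A $$ (i, j) = (\<Sum>k<n. \<bar>?es ! k\<bar> * vec_index (u k) i * vec_index (v k) j)" if "i < n" "j < n" for i j
  proof -
    have "A $$ (i, j) = (\<Sum>l<n. if l = j then A $$ (i, l) else 0)" using that by simp
    also have "\<dots> = (\<Sum>l<n. A $$ (i, l) * (\<Sum>k<n. w k l * w k j))"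
      using orthonormal_columns[OF w _ that(2)] by (intro sum.cong) auto
    also have "\<dots> = (\<Sum>k<n. mat_app n (\<lambda>i j. A $$ (i, j)) (w k) i * w k j)"
      unfolding mat_app_def sum_distrib_left sum_distrib_right by (subst sum.swap) (simp add: mult.assoc)
    also have "\<dots> = (\<Sum>k<n. \<bar>?es ! k\<bar> * vec_index (u k) i * vec_index (v k) j)"
    proof (intro sum.cong refl)
      fix k assume "k \<in> {..<n}"
      then have "mat_app n (\<lambda>i j. A $$ (i, j)) (w k) i * w k j = (\<bar>?es ! k\<bar> * sg k) * w k i * w k j"
        using ew that by (simp add: sg)
      then show "mat_app n (\<lambda>i j. A $$ (i, j)) (w k) i * w k j = \<bar>?es ! k\<bar> * vec_index (u k) i * vec_index (v k) j"
        using that by (simp add: u_def v_def ac_simps)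
    qed
    finally show ?thesis .
  qed
  then have "A = mat n n (\<lambda>(k, l). \<Sum>i<n. \<bar>?es ! i\<bar> * vec_index (u i) k * vec_index (v i) l)"
    using A by (intro eq_matI) auto
  moreover have "orthonormal_family n u"
    using w by (auto simp: orthonormal_family_def orthonormal_def dotp_def scalar_prod_def u_def atLeast0LessThan)
  moreover have "orthonormal_family n v"
  proof -
    have "scalar_prod (v i) (v j) = sg i * sg j * dotp n (w i) (w j)" for i j
      by (simp add: scalar_prod_def v_def atLeast0LessThan dotp_def sum_distrib_left ac_simps)
    then show ?thesis
      using w sg(1) by (simp add: orthonormal_family_def orthonormal_def v_def)
  qed
  ultimately have "is_svd n A (\<lambda>k. \<bar>?es ! k\<bar>) u v" using anti by (auto simp: is_svd_def)
  then show ?thesis by blast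
qed

text \<open>The error bound holds for every singular value decomposition, so it suffices to extract
  the one selected by the choice operator and know that it is genuine.\<close>

lemma sv_threshold_decomposition:
  assumes A: "A \<in> carrier_mat n n" and sym: "\<And>i j. i < n \<Longrightarrow> j < n \<Longrightarrow> A $$ (i, j) = A $$ (j, i)"
  obtains s u v where "orthonormal n u" "orthonormal n v" "\<And>k. k < n \<Longrightarrow> 0 \<le> s k"
    "\<And>i j. i < n \<Longrightarrow> j < n \<Longrightarrow> A $$ (i, j) = (\<Sum>k<n. s k * u k i * v k j)"
    "\<And>i j. i < n \<Longrightarrow> j < n \<Longrightarrow> sv_threshold n A \<tau> $$ (i, j) = (\<Sum>k | k < n \<and> \<tau> \<le> s k. s k * u k i * v k j)"
proof -
  obtain s u v where suv: "(SOME (s, u, v). is_svd n A s u v) = (s, u, v)" by (metis prod_cases3)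
  have "is_svd n A s u v"
    using someI_ex[of "\<lambda>(s, u, v). is_svd n A s u v"] symmetric_svd_exists[OF A sym] unfolding suv by auto
  then have svd: "orthonormal_family n u" "orthonormal_family n v" "\<And>k. k < n \<Longrightarrow> 0 \<le> s k"
    "A = mat n n (\<lambda>(k, l). \<Sum>i<n. s i * vec_index (u i) k * vec_index (v i) l)"
    by (auto simp: is_svd_def)
  have on: "orthonormal n (\<lambda>k. vec_index (x k))" if "orthonormal_family n x" for x
  proof -
    have "dotp n (vec_index (x i)) (vec_index (x j)) = scalar_prod (x i) (x j)" if "j < n" for i j
    proof -
      have "dim_vec (x j) = n" using \<open>orthonormal_family n x\<close> that by (auto simp: orthonormal_family_def)
      then show ?thesis by (simp add: dotp_def scalar_prod_def atLeast0LessThan)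
    qed
    then show ?thesis using that by (simp add: orthonormal_family_def orthonormal_def)
  qed
  show ?thesis
  proof (rule that[OF on[OF svd(1)] on[OF svd(2)] svd(3)])
    show "A $$ (i, j) = (\<Sum>k<n. s k * vec_index (u k) i * vec_index (v k) j)" if "i < n" "j < n" for i j
      by (subst svd(4)) (use that in simp)
    show "sv_threshold n A \<tau> $$ (i, j) = (\<Sum>k | k < n \<and> \<tau> \<le> s k. s k * vec_index (u k) i * vec_index (v k) j)"
      if "i < n" "j < n" for i j
      using that by (simp add: sv_threshold_def suv)
  qed simp_all
qed

lemma frobenius_norm_sq_minus:
  assumes "dim_row N = n" "dim_col N = n"
  shows "(frobenius_norm (M - N))\<^sup>2 = (\<Sum>i<n. \<Sum>j<n. (M $$ (i, j) - N $$ (i, j))\<^sup>2)"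
  using assms by (simp add: frobenius_norm_def sum_nonneg)

text \<open>Clipping is projection onto an interval that contains \<open>m\<close>.\<close>

lemma clip_error_le:
  fixes m t :: real
  assumes "0 \<le> m" "m \<le> 1"
  shows "(m - min 1 (max 0 t))\<^sup>2 \<le> (m - t)\<^sup>2"
  unfolding abs_le_square_iff[symmetric] using assms by (auto simp: min_def max_def abs_if)

lemma usvt_error_le_sq:
  fixes M :: "real mat"
  assumes M: "\<And>i j. i < n \<Longrightarrow> j < n \<Longrightarrow> 0 \<le> M $$ (i, j)" "\<And>i j. i < n \<Longrightarrow> j < n \<Longrightarrow> M $$ (i, j) \<le> 1"
  shows "(frobenius_norm (M - usvt n \<rho> \<tau> A))\<^sup>2 \<le> (real n)\<^sup>2"
proof -
  have "(frobenius_norm (M - usvt n \<rho> \<tau> A))\<^sup>2 = (\<Sum>i<n. \<Sum>j<n. (M $$ (i, j) - usvt n \<rho> \<tau> A $$ (i, j))\<^sup>2)"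
    by (rule frobenius_norm_sq_minus) (simp_all add: usvt_def)
  also have "\<dots> \<le> (\<Sum>i<n. \<Sum>j<n. 1)"
  proof (intro sum_mono)
    fix i j assume ij: "i \<in> {..<n}" "j \<in> {..<n}"
    then have "0 \<le> usvt n \<rho> \<tau> A $$ (i, j)" "usvt n \<rho> \<tau> A $$ (i, j) \<le> 1" by (auto simp: usvt_def)
    with M[of i j] ij have "\<bar>M $$ (i, j) - usvt n \<rho> \<tau> A $$ (i, j)\<bar> \<le> 1" by (simp add: abs_le_iff)
    then show "(M $$ (i, j) - usvt n \<rho> \<tau> A $$ (i, j))\<^sup>2 \<le> 1" by (simp add: abs_square_le_1)
  qed
  finally show ?thesis by (simp add: power2_eq_square)
qed

text \<open>The estimator copies the upper triangle of the thresholded matrix, so the error of a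
  pair is charged to the sum over both of its positions. This doubles the Frobenius error; on the
  diagonal both matrices vanish.\<close>

lemma usvt_error_le:
  fixes M A :: "real mat"
  assumes M: "M \<in> carrier_mat n n" "\<And>i j. i < n \<Longrightarrow> j < n \<Longrightarrow> M $$ (i, j) = M $$ (j, i)"
    "\<And>i j. i < n \<Longrightarrow> j < n \<Longrightarrow> 0 \<le> M $$ (i, j)" "\<And>i j. i < n \<Longrightarrow> j < n \<Longrightarrow> M $$ (i, j) \<le> 1"
    "\<And>i. i < n \<Longrightarrow> M $$ (i, i) = 0"
    and A: "A \<in> carrier_mat n n" "\<And>i j. i < n \<Longrightarrow> j < n \<Longrightarrow> A $$ (i, j) = A $$ (j, i)"
    and \<rho>: "0 < \<rho>" and \<tau>: "0 < \<tau>" and R: "R \<le> n"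
    and E: "\<And>x. sqnorm n (mat_app n (\<lambda>i j. A $$ (i, j) - \<rho> * M $$ (i, j)) x) \<le> (\<tau> / 2)\<^sup>2 * sqnorm n x"
  shows "(frobenius_norm (M - usvt n \<rho> \<tau> A))\<^sup>2 \<le>
    2 / \<rho>\<^sup>2 * (3 * real R * \<tau>\<^sup>2 + 2 * \<rho>\<^sup>2 * (\<Sum>j=R..<n. (ordered_eigenvalues M ! j)\<^sup>2))"
proof -
  obtain s u v where u: "orthonormal n u" and v: "orthonormal n v" and s: "\<And>k. k < n \<Longrightarrow> 0 \<le> s k"
    and Ae: "\<And>i j. i < n \<Longrightarrow> j < n \<Longrightarrow> A $$ (i, j) = (\<Sum>k<n. s k * u k i * v k j)"
    and th: "\<And>i j. i < n \<Longrightarrow> j < n \<Longrightarrow> sv_threshold n A \<tau> $$ (i, j) = (\<Sum>k | k < n \<and> \<tau> \<le> s k. s k * u k i * v k j)"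
    by (rule sv_threshold_decomposition[OF A(1) A(2), where \<tau> = \<tau>]) blast+
  obtain w where w: "orthonormal n w"
    and ew: "\<And>k i. k < n \<Longrightarrow> i < n \<Longrightarrow> mat_app n (\<lambda>i j. M $$ (i, j)) (w k) i = ordered_eigenvalues M ! k * w k i"
    by (rule symmetric_eigenbasis[OF M(1) M(2)]) blast+
  define h where "h i j = ((sv_threshold n A \<tau> $$ (i, j) - \<rho> * M $$ (i, j))\<^sup>2)" for i j
  have h0: "0 \<le> h i j" for i j by (simp add: h_def)
  have "(\<Sum>i<n. \<Sum>j<n. h i j) \<le> 3 * real R * \<tau>\<^sup>2 + 2 * \<rho>\<^sup>2 * (\<Sum>j=R..<n. (ordered_eigenvalues M ! j)\<^sup>2)"
    using sv_threshold_error[OF u v w Ae A(2) M(2) s ew \<tau> E R] th by (simp add: h_def)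
  moreover have "(frobenius_norm (M - usvt n \<rho> \<tau> A))\<^sup>2 \<le> 2 / \<rho>\<^sup>2 * (\<Sum>i<n. \<Sum>j<n. h i j)"
  proof -
    have "(frobenius_norm (M - usvt n \<rho> \<tau> A))\<^sup>2 = (\<Sum>i<n. \<Sum>j<n. (M $$ (i, j) - usvt n \<rho> \<tau> A $$ (i, j))\<^sup>2)"
      by (rule frobenius_norm_sq_minus) (simp_all add: usvt_def)
    also have "\<dots> \<le> (\<Sum>i<n. \<Sum>j<n. (h i j + h j i) / \<rho>\<^sup>2)"
    proof (intro sum_mono)
      fix i j assume ij: "i \<in> {..<n}" "j \<in> {..<n}"
      show "(M $$ (i, j) - usvt n \<rho> \<tau> A $$ (i, j))\<^sup>2 \<le> (h i j + h j i) / \<rho>\<^sup>2"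
      proof (cases "i = j")
        case True
        then show ?thesis using ij M(5) h0 by (simp add: usvt_def)
      next
        case False
        let ?i = "min i j" and ?j = "max i j"
        have Mm: "M $$ (i, j) = M $$ (?i, ?j)" using M(2)[of i j] ij by (simp add: min_def max_def)
        have "(M $$ (i, j) - usvt n \<rho> \<tau> A $$ (i, j))\<^sup>2 \<le> (M $$ (i, j) - sv_threshold n A \<tau> $$ (?i, ?j) / \<rho>)\<^sup>2"
          using False ij M by (simp add: usvt_def clip_error_le)
        also have "\<dots> = h ?i ?j / \<rho>\<^sup>2"
        proof -
          have "M $$ (i, j) - sv_threshold n A \<tau> $$ (?i, ?j) / \<rho> = - (sv_threshold n A \<tau> $$ (?i, ?j) - \<rho> * M $$ (?i, ?j)) / \<rho>"
            using \<rho> by (simp add: Mm field_simps)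
          then show ?thesis by (simp only: h_def power_divide power2_minus)
        qed
        also have "\<dots> \<le> (h i j + h j i) / \<rho>\<^sup>2"
          using h0[of i j] h0[of j i] by (intro divide_right_mono) (auto simp: min_def max_def)
        finally show ?thesis .
      qed
    qed
    also have "\<dots> = ((\<Sum>i<n. \<Sum>j<n. h i j) + (\<Sum>i<n. \<Sum>j<n. h j i)) / \<rho>\<^sup>2"
      by (simp add: sum.distrib flip: sum_divide_distrib)
    also have "(\<Sum>i<n. \<Sum>j<n. h j i) = (\<Sum>i<n. \<Sum>j<n. h i j)" by (rule sum.swap)
    finally show ?thesis by simp
  qed
  moreover have "0 \<le> 2 / \<rho>\<^sup>2" by simp
  ultimately show ?thesis by (meson mult_left_mono order_trans)
qed

section \<open>From the conditional risk to the risk under the joint law\<close>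

lemma adjacency_pmf_vertex_pairs:
  "adjacency_pmf n \<rho> M =
     map_pmf (\<lambda>e. mat n n (\<lambda>(i, j). sym_mat (\<lambda>p. of_bool (e p)) i j))
       (Pi_pmf (vertex_pairs n) False (\<lambda>p. bernoulli_pmf (\<rho> * M $$ p)))"
  by (simp add: adjacency_pmf_def vertex_pairs_def sym_mat_def case_prod_unfold)

text \<open>Off the event that the noise is large, the deterministic bound applies; on it, the loss is at
  most \<open>n ^ 2\<close>.\<close>

lemma usvt_conditional_risk:
  fixes M :: "real mat"
  assumes M: "M \<in> carrier_mat n n" "\<And>i j. i < n \<Longrightarrow> j < n \<Longrightarrow> M $$ (i, j) = M $$ (j, i)"
    "\<And>i j. i < n \<Longrightarrow> j < n \<Longrightarrow> 0 \<le> M $$ (i, j)" "\<And>i j. i < n \<Longrightarrow> j < n \<Longrightarrow> M $$ (i, j) \<le> 1"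
    "\<And>i. i < n \<Longrightarrow> M $$ (i, i) = 0"
    and \<rho>: "0 < \<rho>" "\<rho> \<le> 1" and n: "0 < n" and \<tau>: "0 < \<tau>" and R: "R \<le> n"
    and p: "0 < p" "real n * \<rho> \<le> real p" "ln (real n) \<le> real p" "exp 214 * real p \<le> (\<tau> / 2)\<^sup>2"
  shows "(\<integral>\<^sup>+A. ennreal ((frobenius_norm (M - usvt n \<rho> \<tau> A))\<^sup>2) \<partial>measure_pmf (adjacency_pmf n \<rho> M)) \<le>
    ennreal (2 / \<rho>\<^sup>2 * (3 * real R * \<tau>\<^sup>2 + 2 * \<rho>\<^sup>2 * (\<Sum>j=R..<n. (ordered_eigenvalues M ! j)\<^sup>2)) + real n)"
proof -
  define G where "G = 2 / \<rho>\<^sup>2 * (3 * real R * \<tau>\<^sup>2 + 2 * \<rho>\<^sup>2 * (\<Sum>j=R..<n. (ordered_eigenvalues M ! j)\<^sup>2))"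
  have G: "0 \<le> G" by (simp add: G_def sum_nonneg)
  define q where "q e = \<rho> * M $$ e" for e
  define g where "g \<omega> = mat n n (\<lambda>(i, j). sym_mat (\<lambda>p. of_bool (\<omega> p)) i j)" for \<omega> :: "nat \<times> nat \<Rightarrow> bool"
  let ?P = "Pi_pmf (vertex_pairs n) False (\<lambda>e. bernoulli_pmf (q e))"
  let ?S = "\<lambda>\<omega>. sym_mat (\<lambda>e. of_bool (\<omega> e) - q e)"
  define bad where "bad = {\<omega>. \<not> (\<forall>x. sqnorm n (mat_app n (?S \<omega>) x) \<le> exp 214 * real p * sqnorm n x)}"
  have q: "0 \<le> q e" "q e \<le> \<rho>" if e: "e \<in> vertex_pairs n" for e
  proof -
    obtain i j where "e = (i, j)" "i < n" "j < n" using e by (auto simp: vertex_pairs_def)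
    then show "0 \<le> q e" "q e \<le> \<rho>" using M(3,4)[of i j] \<rho> by (auto simp: q_def mult_left_le)
  qed
  have prob: "measure_pmf.prob ?P bad \<le> 1 / real n"
    unfolding bad_def by (rule centered_adjacency_norm[OF q _ \<rho>(2) n p(1-3)]) (use \<rho> in auto)
  let ?F = "\<lambda>A. (frobenius_norm (M - usvt n \<rho> \<tau> A))\<^sup>2"
  \<comment> \<open>The zero diagonal of \<open>M\<close> makes the noise exactly a matrix of
    independent centred entries above the diagonal, with nothing left over.\<close>
  have noise: "g \<omega> $$ (i, j) - \<rho> * M $$ (i, j) = ?S \<omega> i j" if "i < n" "j < n" for \<omega> i j
    using that M(2)[of i j] M(5)[of i] by (auto simp: g_def sym_mat_def q_def min_def max_def)
  have pw: "?F (g \<omega>) \<le> G + (real n)\<^sup>2 * indicator bad \<omega>" for \<omega>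
  proof (cases "\<omega> \<in> bad")
    case True
    then show ?thesis using usvt_error_le_sq[of n M \<rho> \<tau> "g \<omega>", OF M(3,4)] G by simp
  next
    case False
    have "?F (g \<omega>) \<le> G" unfolding G_def
    proof (rule usvt_error_le[OF M _ _ \<rho>(1) \<tau> R])
      show "g \<omega> \<in> carrier_mat n n" by (simp add: g_def)
      show "g \<omega> $$ (i, j) = g \<omega> $$ (j, i)" if "i < n" "j < n" for i j
        using that by (simp add: g_def sym_mat_def min.commute max.commute)
      fix x
      have eq: "mat_app n (\<lambda>i j. g \<omega> $$ (i, j) - \<rho> * M $$ (i, j)) x i = mat_app n (?S \<omega>) x i" if "i < n" for i
        unfolding mat_app_def using noise that by (intro sum.cong) auto
      have "sqnorm n (mat_app n (\<lambda>i j. g \<omega> $$ (i, j) - \<rho> * M $$ (i, j)) x)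
          = sqnorm n (mat_app n (?S \<omega>) x)"
        by (rule dotp_cong) (simp_all add: eq)
      also have "\<dots> \<le> exp 214 * real p * sqnorm n x" using False unfolding bad_def by blast
      also have "\<dots> \<le> (\<tau> / 2)\<^sup>2 * sqnorm n x" by (intro mult_right_mono p(4) dotp_self_nonneg)
      finally show "sqnorm n (mat_app n (\<lambda>i j. g \<omega> $$ (i, j) - \<rho> * M $$ (i, j)) x)
          \<le> (\<tau> / 2)\<^sup>2 * sqnorm n x" .
    qed
    then show ?thesis using False by simp
  qed
  have "(\<integral>\<^sup>+A. ennreal (?F A) \<partial>measure_pmf (adjacency_pmf n \<rho> M)) = (\<integral>\<^sup>+\<omega>. ennreal (?F (g \<omega>)) \<partial>measure_pmf ?P)"
    unfolding adjacency_pmf_vertex_pairs g_def q_def by simp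
  also have "\<dots> \<le> (\<integral>\<^sup>+\<omega>. ennreal (G + (real n)\<^sup>2 * indicator bad \<omega>) \<partial>measure_pmf ?P)"
    by (intro nn_integral_mono ennreal_leI pw)
  also have "\<dots> = ennreal (measure_pmf.expectation ?P (\<lambda>\<omega>. G + (real n)\<^sup>2 * indicator bad \<omega>))"
    by (intro nn_integral_eq_integral integrable_measure_pmf_finite finite_set_Pi_pmf finite_vertex_pairs)
      (use G in auto)
  also have "measure_pmf.expectation ?P (\<lambda>\<omega>. G + (real n)\<^sup>2 * indicator bad \<omega>) = G + (real n)\<^sup>2 * measure_pmf.prob ?P bad"
    by (subst Bochner_Integration.integral_add)
      (auto intro!: integrable_measure_pmf_finite finite_set_Pi_pmf finite_vertex_pairs)
  also have "ennreal \<dots> \<le> ennreal (G + (real n)\<^sup>2 * (1 / real n))"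
    by (intro ennreal_leI add_left_mono mult_left_mono prob) simp
  also have "(real n)\<^sup>2 * (1 / real n) = real n" using n by (simp add: power2_eq_square)
  finally show ?thesis by (simp add: G_def)
qed

lemma space_cube_distribution: "cube_distribution \<mu> \<Longrightarrow> space \<mu> = unit_cube"
  by (auto simp: cube_distribution_def cube_space_def space_restrict_space dest: sets_eq_imp_space_eq)

lemma measurable_edge_probability:
  assumes f: "graphon f" and \<mu>: "cube_distribution \<mu>" and ij: "i < n" "j < n"
  shows "(\<lambda>x. f (x i) (x j)) \<in> borel_measurable (Pi\<^sub>M {..<n} (\<lambda>_. \<mu>))"
proof -
  have sets: "sets (cube_space \<Otimes>\<^sub>M cube_space) = sets (\<mu> \<Otimes>\<^sub>M \<mu>)"
    using \<mu> by (intro sets_pair_measure_cong) (auto simp: cube_distribution_def)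
  have "(\<lambda>(x, y). f x y) \<in> borel_measurable (\<mu> \<Otimes>\<^sub>M \<mu>)"
    using f measurable_cong_sets[OF sets refl] by (auto simp: graphon_def)
  then have "(\<lambda>x. (\<lambda>(x, y). f x y) (x i, x j)) \<in> borel_measurable (Pi\<^sub>M {..<n} (\<lambda>_. \<mu>))"
    by (rule measurable_compose[rotated])
      (intro measurable_Pair measurable_component_singleton; use ij in simp)
  then show ?thesis by simp
qed

text \<open>Needed to integrate over the bind. There are finitely many edge configurations, and the
  probability of each is a polynomial in the edge probabilities, which depend measurably on the
  positions.\<close>

lemma measurable_adjacency_pmf:
  assumes f: "graphon f" and \<mu>: "cube_distribution \<mu>" and \<rho>: "0 < \<rho>" "\<rho> \<le> 1"
  shows "(\<lambda>x. measure_pmf (adjacency_pmf n \<rho> (edge_prob_mat f n x)))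
    \<in> measurable (Pi\<^sub>M {..<n} (\<lambda>_. \<mu>)) (subprob_algebra (count_space UNIV))"
proof (rule measurable_subprob_algebra)
  fix S :: "real mat set"
  let ?X = "Pi\<^sub>M {..<n} (\<lambda>_. \<mu>)"
  let ?V = "vertex_pairs n"
  define g where "g \<omega> = mat n n (\<lambda>(i, j). sym_mat (\<lambda>p. of_bool (\<omega> p)) i j)" for \<omega> :: "nat \<times> nat \<Rightarrow> bool"
  define F where "F = PiE_dflt ?V False (\<lambda>_. UNIV :: bool set)"
  define h where "h x \<omega> = (\<Prod>e\<in>?V. if \<omega> e then \<rho> * f (x (fst e)) (x (snd e)) else 1 - \<rho> * f (x (fst e)) (x (snd e)))" for x \<omega>
  have fin: "finite F" unfolding F_def by (intro finite_PiE_dflt finite_vertex_pairs) auto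
  have "emeasure (measure_pmf (adjacency_pmf n \<rho> (edge_prob_mat f n x))) S = ennreal (\<Sum>\<omega>\<in>g -` S \<inter> F. h x \<omega>)"
    if x: "x \<in> space ?X" for x
  proof -
    let ?P = "Pi_pmf ?V False (\<lambda>p. bernoulli_pmf (\<rho> * edge_prob_mat f n x $$ p))"
    have cube: "x i \<in> unit_cube" if "i < n" for i
      using x that by (auto simp: space_PiM space_cube_distribution[OF \<mu>])
    have "set_pmf ?P \<subseteq> F" unfolding F_def by (auto simp: set_Pi_pmf[OF finite_vertex_pairs] PiE_dflt_def)
    then have "emeasure (measure_pmf ?P) (g -` S) = emeasure (measure_pmf ?P) (g -` S \<inter> F)"
      by (intro emeasure_eq_AE) (auto simp: AE_measure_pmf_iff)
    also have "\<dots> = ennreal (\<Sum>\<omega>\<in>g -` S \<inter> F. pmf ?P \<omega>)"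
      using fin by (intro emeasure_measure_pmf_finite) auto
    also have "(\<Sum>\<omega>\<in>g -` S \<inter> F. pmf ?P \<omega>) = (\<Sum>\<omega>\<in>g -` S \<inter> F. h x \<omega>)"
    proof (intro sum.cong refl)
      fix \<omega> assume "\<omega> \<in> g -` S \<inter> F"
      then have "pmf ?P \<omega> = (\<Prod>e\<in>?V. pmf (bernoulli_pmf (\<rho> * edge_prob_mat f n x $$ e)) (\<omega> e))"
        by (intro pmf_Pi' finite_vertex_pairs) (auto simp: F_def PiE_dflt_def)
      also have "\<dots> = h x \<omega>" unfolding h_def
      proof (intro prod.cong refl)
        fix e assume "e \<in> ?V"
        then obtain i j where e: "e = (i, j)" "i < j" "j < n" by (auto simp: vertex_pairs_def)
        have "0 \<le> f (x i) (x j)" "f (x i) (x j) \<le> 1"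
          using f cube[of i] cube[of j] e by (auto simp: graphon_def)
        then have "0 \<le> \<rho> * f (x i) (x j)" "\<rho> * f (x i) (x j) \<le> 1" using \<rho> by (auto simp: mult_le_one)
        then show "pmf (bernoulli_pmf (\<rho> * edge_prob_mat f n x $$ e)) (\<omega> e) =
          (if \<omega> e then \<rho> * f (x (fst e)) (x (snd e)) else 1 - \<rho> * f (x (fst e)) (x (snd e)))"
          using e by (cases "\<omega> e") (auto simp: edge_prob_mat_def)
      qed
      finally show "pmf ?P \<omega> = h x \<omega>" .
    qed
    finally show ?thesis by (simp add: adjacency_pmf_vertex_pairs g_def)
  qed
  moreover have "(\<lambda>x. ennreal (\<Sum>\<omega>\<in>g -` S \<inter> F. h x \<omega>)) \<in> borel_measurable ?X"
  proof -
    have "(\<lambda>x. h x \<omega>) \<in> borel_measurable ?X" for \<omega>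
      unfolding h_def
    proof (rule borel_measurable_prod)
      fix e assume "e \<in> ?V"
      then have "(\<lambda>x. f (x (fst e)) (x (snd e))) \<in> borel_measurable ?X"
        by (intro measurable_edge_probability[OF f \<mu>]) (auto simp: vertex_pairs_def)
      then show "(\<lambda>x. if \<omega> e then \<rho> * f (x (fst e)) (x (snd e)) else 1 - \<rho> * f (x (fst e)) (x (snd e))) \<in> borel_measurable ?X"
        by (cases "\<omega> e") simp_all
    qed
    then show ?thesis by measurable
  qed
  ultimately show "(\<lambda>x. emeasure (measure_pmf (adjacency_pmf n \<rho> (edge_prob_mat f n x))) S) \<in> borel_measurable ?X"
    by (subst measurable_cong) auto
qed (auto intro: prob_space_imp_subprob_space prob_space_measure_pmf)

text \<open>A uniform bound on the conditional risk passes to the joint law. If \<open>F\<close> is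
  not integrable, its integral is 0 by convention and the bound is immediate; otherwise
  integrability itself supplies the measurability of \<open>F\<close>, and the iterated integral
  applies.\<close>

lemma graphon_law_integral_le:
  assumes f: "graphon f" and \<mu>: "cube_distribution \<mu>" and \<rho>: "0 < \<rho>" "\<rho> \<le> 1"
    and F: "\<And>z. 0 \<le> F z" and B: "0 \<le> B"
    and bound: "\<And>x. (\<forall>i<n. x i \<in> unit_cube) \<Longrightarrow>
       (\<integral>\<^sup>+A. ennreal (F (x, A)) \<partial>measure_pmf (adjacency_pmf n \<rho> (edge_prob_mat f n x))) \<le> ennreal B"
  shows "(\<integral>z. F z \<partial>graphon_law f \<mu> n \<rho>) \<le> B"
proof (cases "integrable (graphon_law f \<mu> n \<rho>) F")
  case False
  then show ?thesis using B by (simp add: not_integrable_integral_eq)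
next
  case True
  let ?X = "Pi\<^sub>M {..<n} (\<lambda>_. \<mu>)"
  let ?N = "?X \<Otimes>\<^sub>M count_space (UNIV :: real mat set)"
  let ?adj = "\<lambda>x. measure_pmf (adjacency_pmf n \<rho> (edge_prob_mat f n x))"
  let ?k = "\<lambda>x. distr (?adj x) ?N (\<lambda>A. (x, A))"
  interpret \<mu>: prob_space \<mu> using \<mu> by (simp add: cube_distribution_def)
  interpret X: prob_space ?X by (intro prob_space_PiM) unfold_locales
  have k: "?k \<in> measurable ?X (subprob_algebra ?N)"
  proof (rule measurable_distr2[where f = Pair and L = ?X and M = "count_space UNIV" and g = ?adj])
    show "case_prod Pair \<in> measurable ?N ?N" by simp
    show "?adj \<in> measurable ?X (subprob_algebra (count_space UNIV))"
      by (rule measurable_adjacency_pmf[OF f \<mu> \<rho>])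
  qed
  have law: "graphon_law f \<mu> n \<rho> = ?X \<bind> ?k" by (simp add: graphon_law_def Let_def)
  have sets: "sets (graphon_law f \<mu> n \<rho>) = sets ?N"
    unfolding law by (intro sets_bind X.not_empty) simp
  have "F \<in> borel_measurable (graphon_law f \<mu> n \<rho>)" using True by (rule borel_measurable_integrable)
  then have Fm: "F \<in> borel_measurable ?N" using measurable_cong_sets[OF sets refl] by blast
  from Fm have Fe: "(\<lambda>z. ennreal (F z)) \<in> borel_measurable ?N" by measurable
  have "(\<integral>\<^sup>+z. ennreal (F z) \<partial>graphon_law f \<mu> n \<rho>) = (\<integral>\<^sup>+x. \<integral>\<^sup>+z. ennreal (F z) \<partial>?k x \<partial>?X)"
    unfolding law by (rule nn_integral_bind[OF Fe k])
  also have "\<dots> \<le> (\<integral>\<^sup>+x. ennreal B \<partial>?X)"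
  proof (intro nn_integral_mono)
    fix x assume x: "x \<in> space ?X"
    then have cube: "\<forall>i<n. x i \<in> unit_cube" by (auto simp: space_PiM space_cube_distribution[OF \<mu>])
    have "Pair x \<in> measurable (?adj x) ?N"
      using measurable_Pair1'[OF x] measurable_cong_sets[OF sets_measure_pmf_count_space refl] by blast
    then have "(\<integral>\<^sup>+z. ennreal (F z) \<partial>?k x) = (\<integral>\<^sup>+A. ennreal (F (x, A)) \<partial>?adj x)"
      by (rule nn_integral_distr) (use Fe in simp)
    then show "(\<integral>\<^sup>+z. ennreal (F z) \<partial>?k x) \<le> ennreal B" using bound[OF cube] by simp
  qed
  also have "\<dots> = ennreal B" by (simp add: X.emeasure_space_1)
  finally have "(\<integral>\<^sup>+z. ennreal (F z) \<partial>graphon_law f \<mu> n \<rho>) \<le> ennreal B" .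
  moreover have "(\<integral>\<^sup>+z. ennreal (F z) \<partial>graphon_law f \<mu> n \<rho>) = ennreal (\<integral>z. F z \<partial>graphon_law f \<mu> n \<rho>)"
    by (rule nn_integral_eq_integral[OF True]) (simp add: F)
  ultimately show ?thesis using B by simp
qed

text \<open>Choice of parameters. With \<open>D = n * \<rho>\<close>, the estimation error is of
  order \<open>R / D\<close>, and the remaining terms are of order \<open>1 / D\<close>; the latter
  are absorbed because \<open>D \<ge> K > 1\<close> keeps \<open>ln D\<close> away from 0.\<close>

lemma usvt_MSE_bound:
  fixes f :: "real ^ 'd::finite \<Rightarrow> real ^ 'd \<Rightarrow> real"
  assumes f: "graphon f" and \<mu>: "cube_distribution \<mu>" and \<rho>: "0 < \<rho>" "\<rho> \<le> 1"
    and c: "0 < c0" "0 < c1" and C: "0 < C" and K: "1 < K"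
    and tail: "\<And>x r. (\<forall>i<n. x i \<in> unit_cube) \<Longrightarrow> r < n \<Longrightarrow>
       1 / (real n)\<^sup>2 * (\<Sum>i=r..<n. (ordered_eigenvalues (edge_prob_mat f n x) ! i)\<^sup>2)
         \<le> c1 * (1 / real n + exp (- c0 * real r powr (1 / real CARD('d))))"
    and nC: "C * ln (real n) \<le> real n * \<rho>" and nK: "K \<le> real n * \<rho>"
    and c'': "c'' = 2 * sqrt (exp 214 * (3 + 1 / C))"
  shows "MSE f \<mu> n \<rho> (usvt n \<rho> (c'' * sqrt (real n * \<rho>)))
    \<le> (6 * c''\<^sup>2 * (1 / c0 ^ CARD('d) + 1 / ln K ^ CARD('d)) + 8 * c1 / ln K ^ CARD('d) + 1 / ln K ^ CARD('d))
        * (ln (real n * \<rho>) ^ CARD('d) / (real n * \<rho>))"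
proof -
  let ?d = "CARD('d)"
  define D where "D = real n * \<rho>"
  have D: "1 < D" "0 < ln D" using nK K by (auto simp: D_def)
  have n: "0 < n" using D(1) by (cases n) (auto simp: D_def)
  have Dn: "D \<le> real n" using \<rho> by (simp add: D_def mult_left_le)
  have n1: "1 \<le> real n" using n by simp
  define \<tau> where "\<tau> = c'' * sqrt D"
  have c''0: "0 < c''" using C by (simp add: c'' add_pos_pos)
  have \<tau>: "0 < \<tau>" using c''0 D by (simp add: \<tau>_def)
  have \<tau>2: "\<tau>\<^sup>2 = c''\<^sup>2 * D" using D by (simp add: \<tau>_def power_mult_distrib)
  \<comment> \<open>A sum instead of a maximum satisfies both lower bounds at once. It is at most
    \<open>(3 + 1 / C) * D\<close>, which is the factor built into \<open>c''\<close>.\<close>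
  define p where "p = nat \<lceil>D\<rceil> + nat \<lceil>ln (real n)\<rceil>"
  have ln0: "0 \<le> ln (real n)" using n1 by simp
  have p: "0 < p" "real n * \<rho> \<le> real p" "ln (real n) \<le> real p" "real p \<le> D + ln (real n) + 2"
    using D ln0 unfolding p_def D_def[symmetric] by linarith+
  have "ln (real n) \<le> D / C" using nC C by (simp add: D_def field_simps)
  then have "real p \<le> (3 + 1 / C) * D" using p(4) D(1) by (simp add: algebra_simps)
  then have "exp 214 * real p \<le> exp 214 * ((3 + 1 / C) * D)" by (intro mult_left_mono) auto
  also have "\<dots> = (\<tau> / 2)\<^sup>2"
    using C by (simp add: power_divide \<tau>2 c'' power_mult_distrib add_nonneg_nonneg)
  finally have p\<tau>: "exp 214 * real p \<le> (\<tau> / 2)\<^sup>2" .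
  define L where "L = ln D ^ ?d"
  have L: "0 < L" using D by (simp add: L_def)
  have lnK: "0 < ln K" using K by simp
  have LK: "1 \<le> L / ln K ^ ?d"
  proof -
    have "ln K \<le> ln D" using nK K by (simp add: D_def)
    then have "ln K ^ ?d \<le> L" unfolding L_def using lnK by (intro power_mono) auto
    then show ?thesis using lnK by (simp add: le_divide_eq)
  qed
  \<comment> \<open>The smallest integer for which
    \<open>exp (- c0 * R0 powr (1 / d)) \<le> 1 / D\<close>, where \<open>d\<close> is the
    dimension.\<close>
  define R0 where "R0 = nat \<lceil>(ln D / c0) ^ ?d\<rceil>"
  have R0: "(ln D / c0) ^ ?d \<le> real R0" "real R0 \<le> (ln D / c0) ^ ?d + 1"
  proof -
    have "0 \<le> (ln D / c0) ^ ?d" using D c by simp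
    then show "(ln D / c0) ^ ?d \<le> real R0" "real R0 \<le> (ln D / c0) ^ ?d + 1" unfolding R0_def by linarith+
  qed
  define R where "R = min n R0"
  have R: "R \<le> n" "real R \<le> L * (1 / c0 ^ ?d + 1 / ln K ^ ?d)"
  proof -
    have "real R \<le> (ln D / c0) ^ ?d + 1" using R0(2) by (simp add: R_def)
    also have "\<dots> \<le> L / c0 ^ ?d + L / ln K ^ ?d" using LK by (simp add: L_def power_divide)
    finally show "real R \<le> L * (1 / c0 ^ ?d + 1 / ln K ^ ?d)" by (simp add: algebra_simps)
  qed (simp add: R_def)
  have T: "1 / (real n)\<^sup>2 * (\<Sum>i=R..<n. (ordered_eigenvalues (edge_prob_mat f n x) ! i)\<^sup>2) \<le> 2 * c1 / D"
    if x: "\<forall>i<n. x i \<in> unit_cube" for x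
  proof (cases "R < n")
    \<comment> \<open>Then \<open>R = n\<close> and the tail sum is empty.\<close>
    case False
    then show ?thesis using c D by (simp add: R_def)
  next
    case True
    have R_eq: "R = R0" using True by (simp add: R_def)
    have "ln D / c0 = ((ln D / c0) ^ ?d) powr (1 / real ?d)"
      using D c by (simp add: powr_powr flip: powr_realpow)
    also have "\<dots> \<le> real R powr (1 / real ?d)"
      using R0(1) D c unfolding R_eq by (intro powr_mono2) auto
    finally have "ln D \<le> c0 * real R powr (1 / real ?d)" using c by (simp add: field_simps)
    then have "exp (- c0 * real R powr (1 / real ?d)) \<le> exp (- ln D)" by simp
    also have "\<dots> = 1 / D" using D by (simp add: exp_minus divide_inverse)
    finally have e: "exp (- c0 * real R powr (1 / real ?d)) \<le> 1 / D" .
    have "1 / real n \<le> 1 / D" using D Dn by (intro divide_left_mono) auto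
    with e have "c1 * (1 / real n + exp (- c0 * real R powr (1 / real ?d))) \<le> c1 * (1 / D + 1 / D)"
      using c by (intro mult_left_mono add_mono) auto
    with tail[OF x True] show ?thesis by (simp add: mult.commute)
  qed
  define G where "G = (6 * c''\<^sup>2 * (1 / c0 ^ ?d + 1 / ln K ^ ?d) + 8 * c1 / ln K ^ ?d + 1 / ln K ^ ?d) * (L / D)"
  have G0: "0 \<le> G" using c L D lnK by (simp add: G_def)
  have "(\<integral>z. (case z of (x, A) \<Rightarrow> (frobenius_norm (edge_prob_mat f n x - usvt n \<rho> \<tau> A))\<^sup>2) \<partial>graphon_law f \<mu> n \<rho>)
      \<le> (real n)\<^sup>2 * G"
  proof (rule graphon_law_integral_le[OF f \<mu> \<rho>])
    fix x :: "nat \<Rightarrow> real ^ 'd" assume x: "\<forall>i<n. x i \<in> unit_cube"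
    let ?M = "edge_prob_mat f n x"
    let ?T = "\<Sum>j=R..<n. (ordered_eigenvalues ?M ! j)\<^sup>2"
    note props = edge_prob_mat_props[OF f, where n = n and x = x]
    have "(\<integral>\<^sup>+A. ennreal ((frobenius_norm (?M - usvt n \<rho> \<tau> A))\<^sup>2) \<partial>measure_pmf (adjacency_pmf n \<rho> ?M)) \<le>
        ennreal (2 / \<rho>\<^sup>2 * (3 * real R * \<tau>\<^sup>2 + 2 * \<rho>\<^sup>2 * ?T) + real n)"
      by (rule usvt_conditional_risk[OF _ _ _ _ _ \<rho> n \<tau> R(1) p(1-3) p\<tau>])
        (use x props in \<open>auto simp: edge_prob_mat_def\<close>)
    also have "\<dots> \<le> ennreal ((real n)\<^sup>2 * G)"
    proof (rule ennreal_leI)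
      \<comment> \<open>The squared threshold is \<open>c''\<^sup>2 * D\<close>, and
        \<open>D / \<rho>\<^sup>2\<close> equals \<open>n\<^sup>2 / D\<close>; this brings out the
        common factor \<open>n\<^sup>2\<close>.\<close>
      have "2 / \<rho>\<^sup>2 * (3 * real R * \<tau>\<^sup>2 + 2 * \<rho>\<^sup>2 * ?T) + real n =
          (real n)\<^sup>2 * (6 * c''\<^sup>2 * (real R / D) + 4 * (1 / (real n)\<^sup>2 * ?T) + 1 / real n)"
        unfolding \<tau>2 D_def using \<rho> n by (simp add: field_simps power2_eq_square)
      also have "\<dots> \<le> (real n)\<^sup>2 * (6 * c''\<^sup>2 * (L * (1 / c0 ^ ?d + 1 / ln K ^ ?d) / D) + 4 * (2 * c1 / D) + 1 / D)"
        using T[OF x] R(2) D Dn c by (intro mult_left_mono add_mono divide_right_mono) (auto intro!: divide_left_mono)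
      also have "\<dots> \<le> (real n)\<^sup>2 * G"
      proof (rule mult_left_mono)
        have "8 * c1 / D * 1 \<le> 8 * c1 / D * (L / ln K ^ ?d)" "1 / D * 1 \<le> 1 / D * (L / ln K ^ ?d)"
          using LK c D by (intro mult_left_mono; simp)+
        then show "6 * c''\<^sup>2 * (L * (1 / c0 ^ ?d + 1 / ln K ^ ?d) / D) + 4 * (2 * c1 / D) + 1 / D \<le> G"
          by (simp add: G_def algebra_simps add_divide_distrib)
      qed simp
      finally show "2 / \<rho>\<^sup>2 * (3 * real R * \<tau>\<^sup>2 + 2 * \<rho>\<^sup>2 * ?T) + real n \<le> (real n)\<^sup>2 * G" .
    qed
    finally show "(\<integral>\<^sup>+A. ennreal (case (x, A) of (x, A) \<Rightarrow> (frobenius_norm (edge_prob_mat f n x - usvt n \<rho> \<tau> A))\<^sup>2)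
        \<partial>measure_pmf (adjacency_pmf n \<rho> ?M)) \<le> ennreal ((real n)\<^sup>2 * G)" by simp
  qed (use G0 in auto)
  then have "MSE f \<mu> n \<rho> (usvt n \<rho> \<tau>) \<le> 1 / (real n)\<^sup>2 * ((real n)\<^sup>2 * G)"
    unfolding MSE_def by (intro mult_left_mono) auto
  also have "\<dots> = G" using n by simp
  finally show ?thesis by (simp add: G_def L_def \<tau>_def D_def)
qed

theorem theorem4:
  fixes a b :: real
  assumes "a > 0" and "b > 0"
  shows "(\<exists>c0>0. \<exists>c1>0.
            \<forall>(f :: real ^ 'd::finite \<Rightarrow> real ^ 'd \<Rightarrow> real) (n :: nat) x (r :: nat).
              graphon f \<longrightarrow> analytic_bound a b f \<longrightarrow>
              (\<forall>i<n. x i \<in> unit_cube) \<longrightarrow> r < n \<longrightarrow>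
              1 / (real n)\<^sup>2 * (\<Sum>i=r..<n. (ordered_eigenvalues (edge_prob_mat f n x) ! i)\<^sup>2)
                \<le> c1 * (1 / real n + exp (- c0 * real r powr (1 / real CARD('d)))))
       \<and> (\<forall>C>0. \<forall>K>1. \<exists>c'>0. \<exists>c''>0.
            \<forall>(f :: real ^ 'd \<Rightarrow> real ^ 'd \<Rightarrow> real) (\<mu> :: (real ^ 'd) measure) (n :: nat) (\<rho> :: real).
              graphon f \<longrightarrow> analytic_bound a b f \<longrightarrow> cube_distribution \<mu> \<longrightarrow>
              0 < \<rho> \<longrightarrow> \<rho> \<le> 1 \<longrightarrow>
              real n * \<rho> \<ge> C * ln (real n) \<longrightarrow> real n * \<rho> \<ge> K \<longrightarrow>
              MSE f \<mu> n \<rho> (usvt n \<rho> (c'' * sqrt (real n * \<rho>)))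
                \<le> c' * (ln (real n * \<rho>) ^ CARD('d) / (real n * \<rho>)))"
proof -
  \<comment> \<open>The grid resolution depends on \<open>a\<close> alone. Hence \<open>c0\<close>
    depends only on \<open>a\<close>, and \<open>c1\<close> only on \<open>b\<close> and the
    dimension.\<close>
  obtain N :: nat where N: "4 * a \<le> real N" using real_arch_simple by blast
  then have N0: "0 < real N" using assms(1) by linarith
  define c0 where "c0 = ln 4 / real N"
  define c1 where "c1 = 2 + 8 * (b * real CARD('d) * 2 ^ CARD('d))\<^sup>2"
  have c: "0 < c0" "0 < c1" using N0 by (auto simp: c0_def c1_def add_pos_nonneg)
  have tail: "1 / (real n)\<^sup>2 * (\<Sum>i=r..<n. (ordered_eigenvalues (edge_prob_mat f n x) ! i)\<^sup>2)
                \<le> c1 * (1 / real n + exp (- c0 * real r powr (1 / real CARD('d))))"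
    if "graphon f" "analytic_bound a b f" "\<forall>i<n. x i \<in> unit_cube" "r < n"
    for f :: "real ^ 'd \<Rightarrow> real ^ 'd \<Rightarrow> real" and n x r
    unfolding c0_def c1_def by (rule analytic_eigenvalue_tail[OF that(1,2) assms N _ that(4)]) (use that(3) in blast)
  have part2: "\<exists>c'>0. \<exists>c''>0.
            \<forall>(f :: real ^ 'd \<Rightarrow> real ^ 'd \<Rightarrow> real) (\<mu> :: (real ^ 'd) measure) (n :: nat) (\<rho> :: real).
              graphon f \<longrightarrow> analytic_bound a b f \<longrightarrow> cube_distribution \<mu> \<longrightarrow>
              0 < \<rho> \<longrightarrow> \<rho> \<le> 1 \<longrightarrow>
              real n * \<rho> \<ge> C * ln (real n) \<longrightarrow> real n * \<rho> \<ge> K \<longrightarrow>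
              MSE f \<mu> n \<rho> (usvt n \<rho> (c'' * sqrt (real n * \<rho>)))
                \<le> c' * (ln (real n * \<rho>) ^ CARD('d) / (real n * \<rho>))" if C: "0 < C" and K: "1 < K" for C K
  proof -
    \<comment> \<open>Half the threshold must dominate the noise: with this value
      \<open>(\<tau> / 2)\<^sup>2\<close> is \<open>exp 214 * (3 + 1 / C) * n * \<rho>\<close>. It
      depends on \<open>C\<close> only.\<close>
    define c'' where "c'' = 2 * sqrt (exp 214 * (3 + 1 / C))"
    define c' where "c' = 6 * c''\<^sup>2 * (1 / c0 ^ CARD('d) + 1 / ln K ^ CARD('d)) + 8 * c1 / ln K ^ CARD('d) + 1 / ln K ^ CARD('d)"
    have "0 < c''" using C by (simp add: c''_def add_pos_pos)
    moreover have "0 < c'" using c K by (auto simp: c'_def intro!: add_nonneg_pos add_nonneg_nonneg)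
    moreover have "MSE f \<mu> n \<rho> (usvt n \<rho> (c'' * sqrt (real n * \<rho>))) \<le> c' * (ln (real n * \<rho>) ^ CARD('d) / (real n * \<rho>))"
      if "graphon f" "analytic_bound a b f" "cube_distribution \<mu>" "0 < \<rho>" "\<rho> \<le> 1"
        "C * ln (real n) \<le> real n * \<rho>" "K \<le> real n * \<rho>"
      for f :: "real ^ 'd \<Rightarrow> real ^ 'd \<Rightarrow> real" and \<mu> n \<rho>
      unfolding c'_def
      by (rule usvt_MSE_bound[OF that(1,3,4,5) c C K tail[OF that(1,2)] that(6,7) c''_def])
    ultimately show ?thesis by blast
  qed
  from c tail part2 show ?thesis by blast
qed

end
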